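(* Let $X$ be a non-empty dense-in-itself metric space. (1) The Hilbert system $\mathrm{S4}\mu$ is sound and complete over $X$ for $\mathcal L_\Box^\mu$-formulas. (2) The Hilbert system $\mathrm{S4}t$ is sound and complete over $X$ for $\mathcal L_\Box^{\langle t\rangle}$-formulas.
   Context: A metric space is regarded as a topological space with its metric topology; a space is dense in itself if no singleton subset is open. $\mathrm{cl}$ denotes closure. LANGUAGES. $\mathsf{Var}$ is an infinite set of propositional variables (atoms). $\mathcal L_\Box^\mu$-formulas: atoms; $\top$; $\neg\varphi$; $\varphi\wedge\psi$; $\Box\varphi$; and $\mu q\varphi$ where $q\in\mathsf{Var}$ and $\varphi$ is positive in $q$ (every free occurrence of $q$ in $\varphi$ lies under an even number of negations; $\mu q$ binds $q$). $\mathcal L_\Box^{\langle t\rangle}$-formulas: atoms; $\top$; $\neg\varphi$; $\varphi\wedge\psi$; $\Box\varphi$; and $\langle t\rangle\Delta$ for each non-empty finite set $\Delta$ of formulas. Abbreviations: $\vee,\to,\leftrightarrow$ as usual, $\Diamond\varphi=\neg\Box\neg\varphi$, $\Box^*\varphi=\varphi\wedge\Box\varphi$. $\varphi(\psi/q)$ is the result of replacing each free occurrence of $q$ in $\varphi$ by $\psi$. SEMANTICS. An assignment into $X$ is a map $h:\mathsf{Var}\to\wp(X)$. Truth $(X,h),x\models\varphi$ at $x\in X$: atoms $p$ are true iff $x\in h(p)$; $\top$ and Booleans as usual; $\Box\varphi$ is true at $x$ iff some open neighbourhood $O$ of $x$ has $\varphi$ true at every $y\in O$; $\langle t\rangle\Delta$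 is true at $x$ iff there is $S\subseteq X$ with $x\in S\subseteq\bigcap_{\delta\in\Delta}\mathrm{cl}([\![\delta]\!]_h\cap S)$, where $[\![\delta]\!]_h=\{y\in X:(X,h),y\models\delta\}$; $\mu q\varphi$ is true at $x$ iff $x$ is in the least fixed point of the monotonic map $S\mapsto[\![\varphi]\!]_{h[S/q]}$ on $\wp(X)$, where $h[S/q]$ agrees with $h$ except that it sends $q$ to $S$. A formula is valid in $X$ if it is true at every point of $X$ under every assignment into $X$. SYSTEMS. $\mathrm{S4}\mu$ (for $\mathcal L_\Box^\mu$): axioms are all instances of propositional tautologies; $\Box(\varphi\to\psi)\to(\Box\varphi\to\Box\psi)$; $\Box\varphi\to\varphi$; $\Box\varphi\to\Box\Box\varphi$; and the fixed point axiom $\varphi(\mu q\varphi/q)\to\mu q\varphi$ (for $\varphi$ positive in $q$, provided no free occurrence of an atom in $\mu q\varphi$ gets bound in $\varphi(\mu q\varphi/q)$). Rules: modus ponens; from $\varphi$ infer $\Box\varphi$; and the fixed point rule: from $\varphi(\psi/q)\to\psi$ infer $\mu q\varphi\to\psi$ (for $\varphi$ positive in $q$, provided no free occurrence of an atom in $\psi$ gets bound in $\varphi(\psi/q)$). $\mathrm{S4}t$ (for $\mathcal L_\Box^{\langle t\rangle}$): axioms are all instances of propositional tautologies; $\Box(\varphi\to\psi)\to(\Box\varphi\to\Box\psi)$; $\Box\varphi\to\varphi$; $\Box\varphi\to\Box\Box\varphi$; (Fix) $\langle t\rangle\Gamma\to\Diamond(\gamma\wedge\langle t\rangle\Gamma)$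 for each $\gamma\in\Gamma$; (Ind) $\Box^*(\varphi\to\bigwedge_{\gamma\in\Gamma}\Diamond(\gamma\wedge\varphi))\to(\varphi\to\langle t\rangle\Gamma)$. Rules: modus ponens and from $\varphi$ infer $\Box\varphi$. A Hilbert system is sound over $X$ if all its theorems are valid in $X$, and complete over $X$ if every formula of its language that is valid in $X$ is a theorem.
   Formalization: S4μ is here also closed under renaming of bound atoms (formulas are read up to such renaming); with literal substitution and the stated side conditions, the valid formula μr(p ∨ μp(r ∨ p)) → p is not derivable, so completeness would fail. *)

theory Defs
  imports "HOL-Analysis.Analysis" "HOL-Library.FSet"
begin

section \<open>Propositional tautologies\<close>

datatype 'v pfm = PAtom 'v | PTop | PNeg "'v pfm" | PAnd "'v pfm" "'v pfm"

primrec ptruth :: "('v \<Rightarrow> bool) \<Rightarrow> 'v pfm \<Rightarrow> bool" where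
  "ptruth v (PAtom p) = v p"
| "ptruth v PTop = True"
| "ptruth v (PNeg a) = (\<not> ptruth v a)"
| "ptruth v (PAnd a b) = (ptruth v a \<and> ptruth v b)"

definition tautology :: "'v pfm \<Rightarrow> bool" where
  "tautology a \<longleftrightarrow> (\<forall>v. ptruth v a)"


section \<open>The language with the least fixed point operator\<close>

text \<open>The datatype does not enforce the positivity condition on \<open>MMu\<close>; the formulas of the
  language are the terms satisfying \<open>mu_formula\<close> below.\<close>

datatype 'v mfm =
    MAtom 'v
  | MTop
  | MNeg "'v mfm"
  | MAnd "'v mfm" "'v mfm"
  | MBox "'v mfm"
  | MMu 'v "'v mfm"

abbreviation MImp :: "'v mfm \<Rightarrow> 'v mfm \<Rightarrow> 'v mfm" where
  "MImp a b \<equiv> MNeg (MAnd a (MNeg b))"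

primrec mfree :: "'v mfm \<Rightarrow> 'v set" where
  "mfree (MAtom p) = {p}"
| "mfree MTop = {}"
| "mfree (MNeg a) = mfree a"
| "mfree (MAnd a b) = mfree a \<union> mfree b"
| "mfree (MBox a) = mfree a"
| "mfree (MMu p a) = mfree a - {p}"

text \<open>\<open>mparity q a True\<close>: every free occurrence of \<open>q\<close> in \<open>a\<close> lies under an even number of
  negations; \<open>mparity q a False\<close>: under an odd number.\<close>

primrec mparity :: "'v \<Rightarrow> 'v mfm \<Rightarrow> bool \<Rightarrow> bool" where
  "mparity q (MAtom p) e = (p = q \<longrightarrow> e)"
| "mparity q MTop e = True"
| "mparity q (MNeg a) e = mparity q a (\<not> e)"
| "mparity q (MAnd a b) e = (mparity q a e \<and> mparity q b e)"
| "mparity q (MBox a) e = mparity q a e"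
| "mparity q (MMu p a) e = (p = q \<or> mparity q a e)"

abbreviation mpositive :: "'v \<Rightarrow> 'v mfm \<Rightarrow> bool" where
  "mpositive q a \<equiv> mparity q a True"

primrec mu_formula :: "'v mfm \<Rightarrow> bool" where
  "mu_formula (MAtom p) = True"
| "mu_formula MTop = True"
| "mu_formula (MNeg a) = mu_formula a"
| "mu_formula (MAnd a b) = (mu_formula a \<and> mu_formula b)"
| "mu_formula (MBox a) = mu_formula a"
| "mu_formula (MMu q a) = (mu_formula a \<and> mpositive q a)"

text \<open>\<open>msubst a s q\<close> is \<open>a(s/q)\<close>: literal replacement of the free occurrences of \<open>q\<close>, with no
  renaming of bound atoms. \<open>mfree_for s q a\<close> says that no free occurrence of an atom in \<open>s\<close> gets
  bound in \<open>a(s/q)\<close>.\<close>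

primrec msubst :: "'v mfm \<Rightarrow> 'v mfm \<Rightarrow> 'v \<Rightarrow> 'v mfm" where
  "msubst (MAtom p) s q = (if p = q then s else MAtom p)"
| "msubst MTop s q = MTop"
| "msubst (MNeg a) s q = MNeg (msubst a s q)"
| "msubst (MAnd a b) s q = MAnd (msubst a s q) (msubst b s q)"
| "msubst (MBox a) s q = MBox (msubst a s q)"
| "msubst (MMu p a) s q = (if p = q then MMu p a else MMu p (msubst a s q))"

primrec mfree_for :: "'v mfm \<Rightarrow> 'v \<Rightarrow> 'v mfm \<Rightarrow> bool" where
  "mfree_for s q (MAtom p) = True"
| "mfree_for s q MTop = True"
| "mfree_for s q (MNeg a) = mfree_for s q a"
| "mfree_for s q (MAnd a b) = (mfree_for s q a \<and> mfree_for s q b)"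
| "mfree_for s q (MBox a) = mfree_for s q a"
| "mfree_for s q (MMu p a) =
     (p = q \<or> ((q \<in> mfree a \<longrightarrow> p \<notin> mfree s) \<and> mfree_for s q a))"

text \<open>Renaming of bound atoms.\<close>

inductive malpha :: "'v mfm \<Rightarrow> 'v mfm \<Rightarrow> bool" where
  malpha_refl: "malpha a a"
| malpha_sym: "malpha a b \<Longrightarrow> malpha b a"
| malpha_trans: "malpha a b \<Longrightarrow> malpha b c \<Longrightarrow> malpha a c"
| malpha_Neg: "malpha a a' \<Longrightarrow> malpha (MNeg a) (MNeg a')"
| malpha_And: "malpha a a' \<Longrightarrow> malpha b b' \<Longrightarrow> malpha (MAnd a b) (MAnd a' b')"
| malpha_Box: "malpha a a' \<Longrightarrow> malpha (MBox a) (MBox a')"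
| malpha_Mu: "malpha a a' \<Longrightarrow> malpha (MMu q a) (MMu q a')"
| malpha_rename: "r \<notin> mfree a \<Longrightarrow> mfree_for (MAtom r) q a \<Longrightarrow>
    malpha (MMu q a) (MMu r (msubst a (MAtom r) q))"

text \<open>The truth set of a formula. \<open>lfp\<close> is the intersection of all pre-fixed points, which is the
  least fixed point for the monotonic maps arising from formulas satisfying \<open>mu_formula\<close>.\<close>

primrec mtruth :: "'v mfm \<Rightarrow> ('v \<Rightarrow> 'a::topological_space set) \<Rightarrow> 'a set" where
  "mtruth (MAtom p) h = h p"
| "mtruth MTop h = UNIV"
| "mtruth (MNeg a) h = - mtruth a h"
| "mtruth (MAnd a b) h = mtruth a h \<inter> mtruth b h"
| "mtruth (MBox a) h = {x. \<exists>W. open W \<and> x \<in> W \<and> (\<forall>y\<in>W. y \<in> mtruth a h)}"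
| "mtruth (MMu q a) h = lfp (\<lambda>S. mtruth a (h(q := S)))"

definition mvalid :: "'a::topological_space itself \<Rightarrow> 'v mfm \<Rightarrow> bool" where
  "mvalid _ a \<longleftrightarrow> (\<forall>(h :: 'v \<Rightarrow> 'a set) x. x \<in> mtruth a h)"

primrec minst :: "('v \<Rightarrow> 'v mfm) \<Rightarrow> 'v pfm \<Rightarrow> 'v mfm" where
  "minst s (PAtom p) = s p"
| "minst s PTop = MTop"
| "minst s (PNeg a) = MNeg (minst s a)"
| "minst s (PAnd a b) = MAnd (minst s a) (minst s b)"

text \<open>The clause \<open>S4mu_alpha\<close> expresses that formulas are identified up to renaming of bound atoms.
  Since \<open>msubst\<close> does not rename, the side conditions of the two fixed point clauses block certain
  instances: for \<open>\<mu>r(p \<or> \<mu>p(r \<or> p))\<close>, all those that substitute a formula with \<open>p\<close> free.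
  Such instances become available once the bound atoms are renamed apart. Without this
  identification the valid formula \<open>\<mu>r(p \<or> \<mu>p(r \<or> p)) \<rightarrow> p\<close> is not derivable.\<close>

inductive S4mu :: "'v mfm \<Rightarrow> bool" where
  S4mu_taut: "tautology t \<Longrightarrow> mu_formula (minst s t) \<Longrightarrow> S4mu (minst s t)"
| S4mu_K: "mu_formula a \<Longrightarrow> mu_formula b \<Longrightarrow>
    S4mu (MImp (MBox (MImp a b)) (MImp (MBox a) (MBox b)))"
| S4mu_T: "mu_formula a \<Longrightarrow> S4mu (MImp (MBox a) a)"
| S4mu_4: "mu_formula a \<Longrightarrow> S4mu (MImp (MBox a) (MBox (MBox a)))"
| S4mu_fixax: "mu_formula (MMu q a) \<Longrightarrow> mfree_for (MMu q a) q a \<Longrightarrow>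
    S4mu (MImp (msubst a (MMu q a) q) (MMu q a))"
| S4mu_MP: "S4mu (MImp a b) \<Longrightarrow> S4mu a \<Longrightarrow> S4mu b"
| S4mu_nec: "S4mu a \<Longrightarrow> S4mu (MBox a)"
| S4mu_fixrule: "mu_formula (MMu q a) \<Longrightarrow> mfree_for b q a \<Longrightarrow>
    S4mu (MImp (msubst a b q) b) \<Longrightarrow> S4mu (MImp (MMu q a) b)"
| S4mu_alpha: "S4mu a \<Longrightarrow> malpha a b \<Longrightarrow> S4mu b"


section \<open>The language with the tangle operator\<close>

text \<open>Non-emptiness of the set under \<open>TTangle\<close> is imposed by \<open>tangle_formula\<close>.\<close>

datatype 'v tfm =
    TAtom 'v
  | TTop
  | TNeg "'v tfm"
  | TAnd "'v tfm" "'v tfm"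
  | TBox "'v tfm"
  | TTangle "'v tfm fset"

abbreviation TImp :: "'v tfm \<Rightarrow> 'v tfm \<Rightarrow> 'v tfm" where
  "TImp a b \<equiv> TNeg (TAnd a (TNeg b))"

abbreviation TDia :: "'v tfm \<Rightarrow> 'v tfm" where
  "TDia a \<equiv> TNeg (TBox (TNeg a))"

abbreviation TBoxStar :: "'v tfm \<Rightarrow> 'v tfm" where
  "TBoxStar a \<equiv> TAnd a (TBox a)"

fun TConj :: "'v tfm list \<Rightarrow> 'v tfm" where
  "TConj [] = TTop"
| "TConj [a] = a"
| "TConj (a # b # bs) = TAnd a (TConj (b # bs))"

primrec tangle_formula :: "'v tfm \<Rightarrow> bool" where
  "tangle_formula (TAtom p) = True"
| "tangle_formula TTop = True"
| "tangle_formula (TNeg a) = tangle_formula a"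
| "tangle_formula (TAnd a b) = (tangle_formula a \<and> tangle_formula b)"
| "tangle_formula (TBox a) = tangle_formula a"
| "tangle_formula (TTangle G) = (G \<noteq> {||} \<and> (\<forall>b \<in> fset (tangle_formula |`| G). b))"

text \<open>In the clause for \<open>TTangle\<close>, \<open>D\<close> ranges over the truth sets of the members of \<open>G\<close>; see
  \<open>ttruth_TTangle\<close> below.\<close>

primrec ttruth :: "('v \<Rightarrow> 'a::topological_space set) \<Rightarrow> 'v tfm \<Rightarrow> 'a set" where
  "ttruth h (TAtom p) = h p"
| "ttruth h TTop = UNIV"
| "ttruth h (TNeg a) = - ttruth h a"
| "ttruth h (TAnd a b) = ttruth h a \<inter> ttruth h b"
| "ttruth h (TBox a) = {x. \<exists>W. open W \<and> x \<in> W \<and> (\<forall>y\<in>W. y \<in> ttruth h a)}"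
| "ttruth h (TTangle G) =
     {x. \<exists>S. x \<in> S \<and> S \<subseteq> (\<Inter>D \<in> fset (ttruth h |`| G). closure (D \<inter> S))}"

lemma tangle_formula_TTangle:
  "tangle_formula (TTangle G) \<longleftrightarrow> G \<noteq> {||} \<and> (\<forall>d \<in> fset G. tangle_formula d)"
  by simp

lemma ttruth_TTangle:
  "ttruth h (TTangle G) =
     {x. \<exists>S. x \<in> S \<and> S \<subseteq> (\<Inter>d \<in> fset G. closure (ttruth h d \<inter> S))}"
  by simp

definition tvalid :: "'a::topological_space itself \<Rightarrow> 'v tfm \<Rightarrow> bool" where
  "tvalid _ a \<longleftrightarrow> (\<forall>(h :: 'v \<Rightarrow> 'a set) x. x \<in> ttruth h a)"

primrec tinst :: "('v \<Rightarrow> 'v tfm) \<Rightarrow> 'v pfm \<Rightarrow> 'v tfm" where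
  "tinst s (PAtom p) = s p"
| "tinst s PTop = TTop"
| "tinst s (PNeg a) = TNeg (tinst s a)"
| "tinst s (PAnd a b) = TAnd (tinst s a) (tinst s b)"

text \<open>In \<open>S4t_Ind\<close> the conjunction over the set of formulas is formed along an arbitrary
  repetition-free enumeration \<open>gs\<close> of that set.\<close>

inductive S4t :: "'v tfm \<Rightarrow> bool" where
  S4t_taut: "tautology t \<Longrightarrow> tangle_formula (tinst s t) \<Longrightarrow> S4t (tinst s t)"
| S4t_K: "tangle_formula a \<Longrightarrow> tangle_formula b \<Longrightarrow>
    S4t (TImp (TBox (TImp a b)) (TImp (TBox a) (TBox b)))"
| S4t_T: "tangle_formula a \<Longrightarrow> S4t (TImp (TBox a) a)"
| S4t_4: "tangle_formula a \<Longrightarrow> S4t (TImp (TBox a) (TBox (TBox a)))"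
| S4t_Fix: "tangle_formula (TTangle G) \<Longrightarrow> g |\<in>| G \<Longrightarrow>
    S4t (TImp (TTangle G) (TDia (TAnd g (TTangle G))))"
| S4t_Ind: "tangle_formula (TTangle G) \<Longrightarrow> tangle_formula a \<Longrightarrow>
    distinct gs \<Longrightarrow> fset_of_list gs = G \<Longrightarrow>
    S4t (TImp (TBoxStar (TImp a (TConj (map (\<lambda>g. TDia (TAnd g a)) gs)))) (TImp a (TTangle G)))"
| S4t_MP: "S4t (TImp a b) \<Longrightarrow> S4t a \<Longrightarrow> S4t b"
| S4t_nec: "S4t a \<Longrightarrow> S4t (TBox a)"

end

theory Submission
  imports Defs
begin

text \<open>Completeness. A canonical general frame (maximal consistent sets, with the sets of worlds
  definable by formulas) refutes every non-theorem, provided least fixed points and tangles are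
  taken among definable sets. For a finite set \<open>\<Sigma>\<close> of definable sets, let the future of a world be
  the set of \<open>\<Sigma>\<close>-types it sees, and its profile the set of pairs (type, future) it sees. Call a world
  stable if the profile cannot shrink above it without the future shrinking as well. Stable worlds
  fall into finitely many homogeneous clusters, one for each profile, and these form a finite S4 model with the same truth
  values: within a cluster, a union of types is definable, so the definable least fixed point is
  the one computed in the finite model. Finally, every finite preorder generated by a point is the
  image of a dense-in-itself metric space under an interior map, and preimages under interior maps
  preserve least fixed points and tangles.\<close>

section \<open>Dissections of metric spaces\<close>

text \<open>Identifying worlds of equal type alone, as in ordinary filtration, loses control of
  fixed points and tangles. Stability repairs this: a step up from a stable world either stays in
  its cluster, all of whose types it can see again, or shrinks the future, which happens only
  finitely often. Truth can therefore be compared cluster by cluster, by induction on the size of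
  the profile, everything beyond the cluster being settled already. Profiles record futures along
  with types because a state reachable in the quotient has to be witnessed by a real successor, and
  the future of that successor tells whether it has left the cluster. The successor need not have
  the profile of the state; type and future suffice. On the topological side neither separability
  nor completeness is available, so the dissections rest on maximal separated sets alone, supplied
  by Zorn's lemma at each scale.\<close>

definition separated :: "real \<Rightarrow> 'a::metric_space set \<Rightarrow> bool" where
  "separated e E \<longleftrightarrow> (\<forall>x\<in>E. \<forall>y\<in>E. x \<noteq> y \<longrightarrow> e \<le> dist x y)"

lemma maximal_separated:
  fixes A :: "'a::metric_space set"
  assumes "e > 0"
  obtains E where "E \<subseteq> A" "separated e E" "\<And>a. a \<in> A \<Longrightarrow> \<exists>x\<in>E. dist a x < e"
proof -
  let ?P = "{E. E \<subseteq> A \<and> separated e E}"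
  have "\<exists>M\<in>?P. \<forall>X\<in>?P. M \<subseteq> X \<longrightarrow> X = M"
  proof (rule subset_Zorn')
    fix C assume C: "subset.chain ?P C"
    show "\<Union>C \<in> ?P"
    proof -
      have "\<Union>C \<subseteq> A" using C by (auto simp: subset.chain_def)
      moreover have "separated e (\<Union>C)"
        unfolding separated_def
      proof (intro ballI impI)
        fix x y assume "x \<in> \<Union>C" "y \<in> \<Union>C" "x \<noteq> y"
        then obtain X Y where XY: "X \<in> C" "Y \<in> C" "x \<in> X" "y \<in> Y" by auto
        then have "X \<subseteq> Y \<or> Y \<subseteq> X" using C unfolding subset.chain_def by blast
        then obtain Q where "Q \<in> C" "x \<in> Q" "y \<in> Q" using XY by blast
        moreover have "separated e Q" using C \<open>Q \<in> C\<close> by (auto simp: subset.chain_def)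
        ultimately show "e \<le> dist x y" using \<open>x \<noteq> y\<close> by (auto simp: separated_def)
      qed
      ultimately show ?thesis by simp
    qed
  qed
  then obtain E where E: "E \<subseteq> A" "separated e E"
    and max: "\<And>X. X \<subseteq> A \<Longrightarrow> separated e X \<Longrightarrow> E \<subseteq> X \<Longrightarrow> X = E" by auto
  have "\<exists>x\<in>E. dist a x < e" if a: "a \<in> A" for a
  proof (rule ccontr)
    assume "\<not> ?thesis"
    then have far: "\<And>x. x \<in> E \<Longrightarrow> e \<le> dist a x" by force
    then have "separated e (insert a E)" using E(2)
      by (auto simp: separated_def dist_commute)
    then have "insert a E = E" using max[of "insert a E"] E a by auto
    then have "a \<in> E" by auto
    then show False using far[of a] assms by simp
  qed
  then show ?thesis using that E by blast
qed

lemma separated_ball: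
  assumes "separated e E" "x \<in> E" "y \<in> E" "dist z x < e/2" "dist z y < e/2"
  shows "x = y"
proof (rule ccontr)
  assume "x \<noteq> y"
  then have "e \<le> dist x y" using assms by (auto simp: separated_def)
  also have "\<dots> \<le> dist z x + dist z y" by (metis dist_commute dist_triangle)
  finally show False using assms by simp
qed

text \<open>A convergent sequence in the union is eventually within \<open>e/4\<close> of its limit,
  so its centres are within \<open>e/2\<close> of the limit and coincide by
  \<open>separated_ball\<close>; from then on it stays in one closed ball.\<close>

lemma closed_Union_separated_cballs:
  assumes "separated e E" "e > 0" "\<And>x. x \<in> E \<Longrightarrow> r x \<le> e/4"
  shows "closed (\<Union>x\<in>E. cball x (r x))"
proof (rule closed_sequential_limits[THEN iffD2], intro allI impI, elim conjE)
  fix s l assume s: "\<forall>n. s n \<in> (\<Union>x\<in>E. cball x (r x))" and l: "s \<longlonglongrightarrow> l"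
  obtain N where N: "\<And>n. n \<ge> N \<Longrightarrow> dist (s n) l < e/4"
    using l[unfolded lim_sequentially, rule_format, of "e/4"] assms(2) by auto
  obtain c where c: "\<And>n. c n \<in> E" "\<And>n. dist (c n) (s n) \<le> r (c n)"
  proof -
    have "\<forall>n. \<exists>x. x \<in> E \<and> dist x (s n) \<le> r x" using s by auto
    from choice[OF this] show ?thesis using that by blast
  qed
  have "dist l (c n) < e/2" if "n \<ge> N" for n
  proof -
    have "dist l (c n) \<le> dist (s n) l + dist (c n) (s n)"
      by (metis dist_commute dist_triangle)
    also have "\<dots> < e/4 + e/4" using N[OF that] c(2)[of n] assms(3)[OF c(1)[of n]] by linarith
    finally show ?thesis by simp
  qed
  then have eq: "c n = c N" if "n \<ge> N" for n
    using separated_ball[OF assms(1) c(1) c(1)] that by blast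
  have "\<forall>n\<ge>N. s n \<in> cball (c N) (r (c N))" using eq c(2) by (metis mem_cball)
  then have "l \<in> cball (c N) (r (c N))"
    using Lim_in_closed_set[OF closed_cball _ _ l] by (metis eventually_sequentially sequentially_bot)
  then show "l \<in> (\<Union>x\<in>E. cball x (r x))" using c(1) by blast
qed

lemma closed_separated:
  assumes "separated e E" "e > 0"
  shows "closed E"
proof -
  have "closed (\<Union>x\<in>E. cball x 0)"
    by (rule closed_Union_separated_cballs[OF assms]) (use assms(2) in simp)
  then show ?thesis by simp
qed

text \<open>Singletons are not open, so each neighbourhood of a point of \<open>E\<close> contains
  another point, and within radius \<open>e/2\<close> that point is outside \<open>E\<close>. This
  is where density in itself enters the dissections.\<close>

lemma closure_open_diff_separated:
  fixes E :: "'a::{metric_space, perfect_space} set"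
  assumes "separated e E" "e > 0" "open A"
  shows "A \<subseteq> closure (A - E)"
proof
  fix x assume x: "x \<in> A"
  show "x \<in> closure (A - E)"
    unfolding closure_approachable
  proof (intro allI impI)
    fix d :: real assume "d > 0"
    define U where "U = A \<inter> ball x (min d (e/2))"
    have U: "open U" "x \<in> U" using \<open>d > 0\<close> assms x by (auto simp: U_def)
    then have "U \<noteq> {y}" for y using not_open_singleton[of y] by auto
    then obtain y where y: "y \<in> U" "y \<noteq> x" using U by blast
    show "\<exists>y\<in>A - E. dist y x < d"
    proof (cases "x \<in> E \<and> y \<in> E")
      case True
      then have "e \<le> dist x y" using assms y by (auto simp: separated_def)
      then show ?thesis using y assms(2) by (auto simp: U_def)
    next
      case False
      then have "x \<in> A - E \<or> y \<in> A - E" using x y by (auto simp: U_def)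
      moreover have "dist y x < d" "dist x x < d" using y \<open>d > 0\<close> by (auto simp: U_def dist_commute)
      ultimately show ?thesis by blast
    qed
  qed
qed

text \<open>\<open>Z\<close> collects the points of the dissecting set and \<open>W\<close> the open pieces found so far; later stages
  work in \<open>G - Z - W\<close>.\<close>

definition dissection :: "'a::metric_space set \<Rightarrow> 'a set \<Rightarrow> 'a set \<Rightarrow> bool" where
  "dissection G Z W \<longleftrightarrow> closed Z \<and> open W \<and> W \<subseteq> G \<and> Z \<inter> W = {} \<and> closure W \<subseteq> W \<union> Z \<and>
     frontier G \<subseteq> Z \<and> Z \<subseteq> closure (G - Z - W)"

lemma dissection_region:
  assumes "dissection G Z W" "open G"
  shows "open (G - Z - W)"
proof -
  have "G - Z - W = G - (Z \<union> closure W)"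
    using assms closure_subset[of W] unfolding dissection_def by blast
  then show ?thesis using assms unfolding dissection_def by (auto intro!: open_Diff closed_Un)
qed

text \<open>\<open>E\<close> is a maximal \<open>e\<close>-separated subset of the region points
  within \<open>e\<close> of \<open>Z\<close>. The region accumulates at \<open>Z\<close>, so a
  point of \<open>Z\<close> has a region point within \<open>e\<close>, and that one a point of
  \<open>E\<close> within \<open>e\<close>: hence the factor 2.\<close>

lemma dissection_near:
  assumes D: "dissection G Z W" and e: "e > 0"
  obtains E where "E \<subseteq> G - Z - W" "separated e E"
    "\<And>x. x \<in> E \<Longrightarrow> \<exists>z\<in>Z. dist x z < e" "\<And>z. z \<in> Z \<Longrightarrow> \<exists>x\<in>E. dist x z < 2 * e"
proof -
  let ?A = "{a \<in> G - Z - W. \<exists>z\<in>Z. dist a z < e}"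
  obtain E where E: "E \<subseteq> ?A" "separated e E" "\<And>a. a \<in> ?A \<Longrightarrow> \<exists>x\<in>E. dist a x < e"
    by (rule maximal_separated[OF e, of ?A]) blast
  have "\<exists>x\<in>E. dist x z < 2 * e" if z: "z \<in> Z" for z
  proof -
    have "z \<in> closure (G - Z - W)" using D z by (auto simp: dissection_def)
    then obtain a where a: "a \<in> G - Z - W" "dist a z < e"
      using e unfolding closure_approachable by blast
    then obtain x where "x \<in> E" "dist a x < e" using E(3)[of a] z by blast
    moreover have "dist x z \<le> dist a x + dist a z" by (metis dist_commute dist_triangle)
    ultimately show ?thesis using a by force
  qed
  then show ?thesis using that[of E] E by blast
qed

lemma dissection_add_points:
  fixes G :: "'a::{metric_space, perfect_space} set"
  assumes D: "dissection G Z W" and G: "open G" and E: "E \<subseteq> G - Z - W" "separated e E" "e > 0"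
  shows "dissection G (Z \<union> E) W"
proof -
  let ?A = "G - Z - W"
  have "?A \<subseteq> closure (?A - E)"
    by (rule closure_open_diff_separated[OF E(2,3) dissection_region[OF D G]])
  then have "closure ?A \<subseteq> closure (?A - E)" by (simp add: closure_minimal)
  moreover have "Z \<union> E \<subseteq> closure ?A"
    using D E(1) closure_subset[of ?A] by (auto simp: dissection_def)
  moreover have "?A - E = G - (Z \<union> E) - W" by auto
  ultimately have "Z \<union> E \<subseteq> closure (G - (Z \<union> E) - W)" by auto
  then show ?thesis using D closed_separated[OF E(2,3)] E(1)
    unfolding dissection_def by auto
qed

text \<open>Replacing an open set by the interior of its closure makes its frontier accessible from
  outside, which keeps the last condition of \<open>dissection\<close>.\<close>

lemma dissection_add_open:
  assumes D: "dissection G Z W" and G: "open G"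
    and V: "V = interior (closure V)" "closure V \<subseteq> G - Z - W"
  shows "dissection G (Z \<union> frontier V) (W \<union> V)"
proof -
  let ?A = "G - Z - W"
  have oV: "open V" using V(1) open_interior by metis
  have A: "open ?A" by (rule dissection_region[OF D G])
  have eq: "G - (Z \<union> frontier V) - (W \<union> V) = ?A - closure V"
    using oV closure_subset[of V] by (auto simp: frontier_def interior_open)
  have "z \<in> closure (?A - closure V)" if z: "z \<in> Z" for z
  proof -
    have "z \<in> - closure V" using z V(2) by auto
    moreover have "z \<in> closure ?A" using z D by (auto simp: dissection_def)
    ultimately have "z \<in> closure (- closure V \<inter> ?A)"
      using open_Int_closure_subset[of "- closure V" ?A] by (auto simp: open_Compl)
    then show ?thesis by (metis Diff_eq Int_commute)
  qed
  moreover have "z \<in> closure (?A - closure V)" if z: "z \<in> frontier V" for z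
  proof -
    have z': "z \<in> closure V" "z \<notin> V" using z oV by (auto simp: frontier_def interior_open)
    then have "z \<in> - interior (closure V)" using V(1) by auto
    then have "z \<in> closure (- closure V)" by (simp add: closure_complement)
    then have "z \<in> closure (?A \<inter> - closure V)"
      using open_Int_closure_subset[OF A, of "- closure V"] z' V(2) by auto
    then show ?thesis by (simp add: Diff_eq)
  qed
  ultimately have "Z \<union> frontier V \<subseteq> closure (G - (Z \<union> frontier V) - (W \<union> V))"
    unfolding eq by auto
  moreover have "V \<inter> frontier V = {}" using oV by (auto simp: frontier_def interior_open)
  moreover have "frontier V \<subseteq> closure V" "V \<subseteq> closure V"
    by (auto simp: frontier_def closure_subset)
  moreover have "closure (W \<union> V) \<subseteq> W \<union> V \<union> (Z \<union> frontier V)"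
    using D oV by (auto simp: dissection_def frontier_def interior_open)
  ultimately show ?thesis using D oV V(2)
    unfolding dissection_def by auto
qed

text \<open>\<open>b\<close> tells whether the stage serves a label of open pieces or a label of
  points of the dissecting set. New open parts must stay within \<open>2 * e\<close> of
  \<open>Z\<close>, so that pieces of late stages can accumulate only at the closure of the union of
  all \<open>Z\<close>.\<close>

definition dissection_step ::
    "real \<Rightarrow> 'a::metric_space set \<Rightarrow> bool \<Rightarrow> 'a set \<times> 'a set \<Rightarrow> 'a set \<times> 'a set \<Rightarrow> bool" where
  "dissection_step e G b p p' \<longleftrightarrow> (case p of (Z, W) \<Rightarrow> case p' of (Z', W') \<Rightarrow>
     Z \<subseteq> Z' \<and> W \<subseteq> W' \<and> open (W' - W) \<and>
     (\<forall>w\<in>W' - W. \<exists>z\<in>Z. dist w z < 2 * e) \<and>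
     (\<forall>z\<in>Z. \<exists>x\<in>(if b then W' - W else Z' - Z). x \<in> G \<and> dist x z < 2 * e))"

lemma dissection_step_exists:
  fixes G :: "'a::{metric_space, perfect_space} set"
  assumes D: "dissection G Z W" and G: "open G" and e: "e > 0"
  shows "\<exists>Z' W'. dissection G Z' W' \<and> dissection_step e G b (Z, W) (Z', W')"
proof -
  obtain E where E: "E \<subseteq> G - Z - W" "separated e E"
    and near: "\<And>x. x \<in> E \<Longrightarrow> \<exists>z\<in>Z. dist x z < e" "\<And>z. z \<in> Z \<Longrightarrow> \<exists>x\<in>E. dist x z < 2 * e"
    using dissection_near[OF D e] by metis
  show ?thesis
  proof (cases b)
    case False
    have "dissection_step e G b (Z, W) (Z \<union> E, W)"
      unfolding dissection_step_def using False E near(2) by auto blast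
    then show ?thesis using dissection_add_points[OF D G E e] by blast
  next
    case True
    have A: "open (G - Z - W)" by (rule dissection_region[OF D G])
    have "\<exists>r. 0 < r \<and> r \<le> e/4 \<and> cball x r \<subseteq> G - Z - W" if "x \<in> E" for x
    proof -
      obtain r where r: "r > 0" "cball x r \<subseteq> G - Z - W"
        using open_contains_cball[THEN iffD1, OF A, rule_format, of x] E(1) \<open>x \<in> E\<close> by blast
      have "cball x (min r (e/4)) \<subseteq> cball x r" by auto
      then show ?thesis using r e by (intro exI[of _ "min r (e/4)"]) auto
    qed
    then obtain r where r: "\<And>x. x \<in> E \<Longrightarrow> 0 < r x" "\<And>x. x \<in> E \<Longrightarrow> r x \<le> e/4"
      "\<And>x. x \<in> E \<Longrightarrow> cball x (r x) \<subseteq> G - Z - W" by metis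
    \<comment> \<open>By the bound \<open>e/4\<close> the closed balls have a closed union inside
      the region, which therefore contains the closure of \<open>V0\<close>. Passing to the interior
      of that closure gives the regular open set that \<open>dissection_add_open\<close> asks
      for.\<close>
    define V0 where "V0 = (\<Union>x\<in>E. ball x (r x))"
    define V where "V = interior (closure V0)"
    have "open V0" unfolding V0_def by auto
    then have V0V: "V0 \<subseteq> V" unfolding V_def by (simp add: closure_subset interior_maximal)
    have "closure V0 \<subseteq> (\<Union>x\<in>E. cball x (r x))"
      using closed_Union_separated_cballs[OF E(2) e r(2)]
      by (intro closure_minimal) (auto simp: V0_def)
    moreover have cl: "closure V = closure V0"
      using V0V closure_mono[of V0 V] closure_mono[of V "closure V0"] interior_subset
      unfolding V_def by (metis closure_closure subset_antisym)
    ultimately have cV: "closure V \<subseteq> (\<Union>x\<in>E. cball x (r x))" by simp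
    then have V: "V = interior (closure V)" "closure V \<subseteq> G - Z - W"
      using r(3) cl by (auto simp: V_def)
    have "open V" by (simp add: V_def)
    moreover have VW: "W \<union> V - W = V" using V(2) closure_subset[of V] by auto
    moreover have "\<exists>z\<in>Z. dist w z < 2 * e" if "w \<in> V" for w
    proof -
      have "w \<in> (\<Union>x\<in>E. cball x (r x))" using cV that closure_subset[of V] by blast
      then obtain x where x: "x \<in> E" "dist x w \<le> r x" by auto
      obtain z where z: "z \<in> Z" "dist x z < e" using near(1) x by blast
      have "dist w z \<le> dist x w + dist x z" by (metis dist_commute dist_triangle)
      then show ?thesis using x z r(2)[OF x(1)] e by force
    qed
    moreover have "\<exists>x\<in>V. x \<in> G \<and> dist x z < 2 * e" if "z \<in> Z" for z
    proof -
      obtain x where x: "x \<in> E" "dist x z < 2 * e" using near(2)[OF \<open>z \<in> Z\<close>] by blast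
      then have "x \<in> ball x (r x)" using r(1) by simp
      then have "x \<in> V0" using x unfolding V0_def by blast
      then show ?thesis using x V0V E(1) by auto
    qed
    ultimately have "dissection_step e G b (Z, W) (Z \<union> frontier V, W \<union> V)"
      unfolding dissection_step_def using True by auto
    then show ?thesis using dissection_add_open[OF D G V] by blast
  qed
qed

lemma mod_le_exists:
  fixes N :: nat assumes "l < N" shows "\<exists>k\<ge>n. k mod N = l"
proof -
  have "n * 1 \<le> n * N" using assms by (intro mult_le_mono2) simp
  then have "n \<le> n * N + l" by linarith
  then show ?thesis using assms by (intro exI[of _ "n * N + l"]) simp
qed

lemma inverse_Suc_small:
  assumes "(d::real) > 0" shows "\<exists>n. \<forall>k\<ge>n. 2 * inverse (real (Suc k)) < d"
proof -
  obtain n where n: "inverse (real (Suc n)) < d/2"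
    using reals_Archimedean[of "d/2"] assms by auto
  have le: "inverse (real (Suc k)) \<le> inverse (real (Suc n))" if "k \<ge> n" for k
    using that by (intro le_imp_inverse_le) auto
  then have "2 * inverse (real (Suc k)) < d" if "k \<ge> n" for k
    using n le[OF that] by linarith
  then show ?thesis by blast
qed

lemma increments_disjoint:
  assumes "incseq A" "x \<in> A (Suc m) - A m" "x \<in> A (Suc n) - A n"
  shows "m = n"
proof (rule ccontr)
  assume "m \<noteq> n"
  then consider "Suc m \<le> n" | "Suc n \<le> m" by linarith
  then show False using assms incseqD[OF assms(1)] by cases blast+
qed

text \<open>Stages run cyclically through all labels with precision tending to 0, so each label
  recurs at every scale near the dissecting set. Labels in \<open>J\<close> sit on the closure of
  that set, labels in \<open>I\<close> fill the rest of \<open>G\<close>.\<close>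

theorem dissection_labelling:
  fixes G :: "'a::{metric_space, perfect_space} set" and I J :: "'l set"
  assumes G: "open G" "G \<noteq> {}" and fin: "finite I" "finite J"
    and ne: "I \<noteq> {}" "J \<noteq> {}" and disj: "I \<inter> J = {}"
  obtains lab where "\<And>x. x \<in> G \<Longrightarrow> lab x \<in> I \<union> J"
    "\<And>i. i \<in> I \<Longrightarrow> open {x \<in> G. lab x = i}"
    "\<And>x l. x \<in> closure G \<Longrightarrow> x \<notin> G \<or> lab x \<in> J \<Longrightarrow> l \<in> I \<union> J \<Longrightarrow>
       x \<in> closure {y \<in> G. lab y = l}"
    "\<exists>x\<in>G. lab x \<in> J"
proof -
  obtain x0 where x0: "x0 \<in> G" using G by auto
  obtain i0 j0 where i0: "i0 \<in> I" and j0: "j0 \<in> J" using ne by auto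
  obtain ls where ls: "set ls = I \<union> J" using fin by (metis finite_UnI finite_list)
  define N where "N = length ls"
  have N: "N > 0" using ls ne by (auto simp: N_def)
  define la where "la k = ls ! (k mod N)" for k
  have la: "la k \<in> I \<union> J" for k using N ls by (metis la_def N_def mod_less_divisor nth_mem)
  have la_surj: "\<exists>k\<ge>n. la k = l" if l: "l \<in> I \<union> J" for n l
  proof -
    obtain m where m: "m < N" "ls ! m = l" using l ls by (metis in_set_conv_nth N_def)
    then show ?thesis using mod_le_exists[OF m(1), of n] by (auto simp: la_def)
  qed
  define e :: "nat \<Rightarrow> real" where "e k = inverse (real (Suc k))" for k
  have e: "e k > 0" for k by (simp add: e_def)
  have "\<exists>p. \<forall>k. (dissection G (fst (p k)) (snd (p k)) \<and> (k = 0 \<longrightarrow> x0 \<in> fst (p k) \<and> snd (p k) = {})) \<and>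
      dissection_step (e k) G (la k \<in> I) (p k) (p (Suc k))"
  proof (rule dependent_nat_choice)
    \<comment> \<open>The frontier is put in from the start so that all labels accumulate there too;
      \<open>x0\<close> gives the dissecting set a point inside \<open>G\<close> even when the
      frontier is empty.\<close>
    have "{x0} \<union> frontier G \<subseteq> closure (G - ({x0} \<union> frontier G) - {})"
    proof -
      have s: "separated 1 {x0}" by (simp add: separated_def)
      have "G - ({x0} \<union> frontier G) - {} = G - {x0}"
        using G by (auto simp: frontier_def interior_open)
      moreover have "closure G \<subseteq> closure (G - {x0})"
        using closure_open_diff_separated[OF s _ G(1)] by (simp add: closure_minimal)
      ultimately show ?thesis using x0 closure_subset[of G] by (auto simp: frontier_def)
    qed
    then have "dissection G ({x0} \<union> frontier G) {}" by (auto simp: dissection_def)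
    then show "\<exists>p. dissection G (fst p) (snd p) \<and> (0 = (0::nat) \<longrightarrow> x0 \<in> fst p \<and> snd p = {})"
      by (intro exI[of _ "({x0} \<union> frontier G, {})"]) auto
  next
    fix p :: "'a set \<times> 'a set" and k :: nat
    assume "dissection G (fst p) (snd p) \<and> (k = 0 \<longrightarrow> x0 \<in> fst p \<and> snd p = {})"
    then show "\<exists>q. (dissection G (fst q) (snd q) \<and> (Suc k = 0 \<longrightarrow> x0 \<in> fst q \<and> snd q = {})) \<and>
       dissection_step (e k) G (la k \<in> I) p q"
      using dissection_step_exists[OF _ G(1) e, of "fst p" "snd p"] by fastforce
  qed
  then obtain p where "\<forall>k. dissection G (fst (p k)) (snd (p k)) \<and> (k = 0 \<longrightarrow> x0 \<in> fst (p k) \<and> snd (p k) = {}) \<and>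
      dissection_step (e k) G (la k \<in> I) (p k) (p (Suc k))" by auto
  moreover define Z W where "Z k = fst (p k)" and "W k = snd (p k)" for k
  ultimately have D: "\<And>k. dissection G (Z k) (W k)" and x0Z: "x0 \<in> Z 0" and W00: "W 0 = {}"
    and step: "\<And>k. dissection_step (e k) G (la k \<in> I) (Z k, W k) (Z (Suc k), W (Suc k))"
    by auto
  have ZS: "Z k \<subseteq> Z (Suc k)" and WS: "W k \<subseteq> W (Suc k)" and oW: "open (W (Suc k) - W k)" for k
    using step[of k] by (auto simp: dissection_step_def)
  have W_near: "\<exists>z\<in>Z k. dist w z < 2 * e k" if "w \<in> W (Suc k) - W k" for w k
    using step[of k] that unfolding dissection_step_def by blast
  have accI: "\<exists>x\<in>W (Suc k) - W k. x \<in> G \<and> dist x z < 2 * e k" if "z \<in> Z k" "la k \<in> I" for z k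
    using step[of k] that unfolding dissection_step_def by auto
  have accJ: "\<exists>x\<in>Z (Suc k) - Z k. x \<in> G \<and> dist x z < 2 * e k" if "z \<in> Z k" "la k \<notin> I" for z k
    using step[of k] that unfolding dissection_step_def by auto
  have incZ: "incseq Z" and incW: "incseq W" using ZS WS by (simp_all add: incseq_SucI)
  define ZZ WW where "ZZ = (\<Union>k. Z k)" and "WW = (\<Union>k. W k)"
  have WG: "WW \<subseteq> G" using D unfolding WW_def dissection_def by blast
  have W0: "W k \<inter> ZZ = {}" for k
  proof -
    have "W k \<inter> Z m = {}" for m
    proof -
      have "W k \<subseteq> W (max k m)" "Z m \<subseteq> Z (max k m)" using incW incZ by (simp_all add: incseqD)
      then show ?thesis using D[of "max k m"] by (auto simp: dissection_def)
    qed
    then show ?thesis by (auto simp: ZZ_def)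
  qed
  have oWW: "open WW" unfolding WW_def using D by (auto simp: dissection_def)
  have WZ: "WW \<inter> closure ZZ = {}"
  proof -
    have "WW \<inter> ZZ = {}" using W0 by (auto simp: WW_def)
    then show ?thesis using open_Int_closure_eq_empty[OF oWW] by blast
  qed
  \<comment> \<open>At distance \<open>d\<close> from \<open>ZZ\<close> only finitely many stages
    matter: pieces of stages with \<open>2 * e k < d/2\<close> miss \<open>ball x (d/2)\<close>, and
    the closure of a single \<open>W n\<close> adds only points of \<open>Z n\<close>.\<close>
  have left: "closure WW \<subseteq> WW \<union> closure ZZ"
  proof (rule ccontr)
    assume "\<not> ?thesis"
    then obtain x where x: "x \<in> closure WW" "x \<notin> WW" "x \<notin> closure ZZ" by auto
    obtain d where d: "d > 0" "\<And>z. z \<in> ZZ \<Longrightarrow> d \<le> dist z x"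
      using x(3) unfolding closure_approachable by force
    obtain n where n: "\<And>k. k \<ge> n \<Longrightarrow> 2 * e k < d/2"
      using inverse_Suc_small[of "d/2"] d(1) by (auto simp: e_def)
    have "closure (W n) \<subseteq> W n \<union> Z n" using D[of n] by (simp add: dissection_def)
    moreover have "Z n \<subseteq> closure ZZ" using closure_subset[of ZZ] by (auto simp: ZZ_def)
    ultimately have "x \<notin> closure (W n)" using x by (auto simp: WW_def)
    moreover have "WW \<subseteq> W n \<union> - ball x (d/2)"
    proof
      fix w assume w: "w \<in> WW"
      show "w \<in> W n \<union> - ball x (d/2)"
      proof (cases "w \<in> W n")
        case False
        obtain k where k: "w \<in> W k" using w by (auto simp: WW_def)
        have "\<exists>k. w \<in> W (Suc k) - W k \<and> k \<ge> n"
        proof -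
          define m where "m = (LEAST k. w \<in> W k)"
          have m: "w \<in> W m" using k unfolding m_def by (rule LeastI)
          have mn: "n < m" using m False incseqD[OF incW, of m n] by (meson not_le subsetD)
          then have "w \<notin> W (m - 1)" using not_less_Least[of "m - 1" "\<lambda>k. w \<in> W k"]
            unfolding m_def[symmetric] by simp
          then show ?thesis using m mn by (intro exI[of _ "m - 1"]) auto
        qed
        then obtain k where k: "w \<in> W (Suc k) - W k" "k \<ge> n" by blast
        then obtain z where z: "z \<in> Z k" "dist w z < 2 * e k" using W_near by blast
        have "d \<le> dist z x" using z d(2) by (auto simp: ZZ_def)
        also have "dist z x \<le> dist w z + dist x w" by (metis add.commute dist_commute dist_triangle)
        finally show ?thesis using z n[OF k(2)] by auto
      qed auto
    qed
    then have "closure WW \<subseteq> closure (W n) \<union> - ball x (d/2)"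
      by (metis closure_Un closure_mono closed_Compl closure_closed open_ball)
    ultimately show False using x(1) d(1) by auto
  qed
  \<comment> \<open>The defaults matter. \<open>j0\<close> labels \<open>Z 0\<close>, whatever
    stages of labels in \<open>I\<close> add to \<open>Z\<close>, and the limit points in
    \<open>closure ZZ\<close>. \<open>i0\<close> labels the remaining part of \<open>G\<close>, and
    any open piece arising at a stage whose label is not in \<open>I\<close>, which
    \<open>dissection_step\<close> does not exclude.\<close>
  define lab where "lab x =
    (if x \<in> WW then (if \<exists>k. x \<in> W (Suc k) - W k \<and> la k \<in> I
                      then la (SOME k. x \<in> W (Suc k) - W k \<and> la k \<in> I) else i0)
     else if x \<in> closure ZZ then (if \<exists>k. x \<in> Z (Suc k) - Z k \<and> la k \<in> J
                      then la (SOME k. x \<in> Z (Suc k) - Z k \<and> la k \<in> J) else j0)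
     else i0)" for x
  have labW: "lab x = (if la k \<in> I then la k else i0)" if "x \<in> W (Suc k) - W k" for x k
  proof -
    have "x \<in> WW" using that by (auto simp: WW_def)
    moreover have "(\<exists>k. x \<in> W (Suc k) - W k \<and> la k \<in> I) \<longleftrightarrow> la k \<in> I"
      using increments_disjoint[OF incW] that by blast
    moreover have "(SOME k. x \<in> W (Suc k) - W k \<and> la k \<in> I) = k" if "la k \<in> I"
      using increments_disjoint[OF incW] \<open>x \<in> W (Suc k) - W k\<close> that
      by (intro some_equality) auto
    ultimately show ?thesis by (simp add: lab_def)
  qed
  have labZ: "lab x = la k" if "x \<in> Z (Suc k) - Z k" "la k \<in> J" for x k
  proof -
    have "x \<in> ZZ" using that by (auto simp: ZZ_def)
    then have "x \<notin> WW" "x \<in> closure ZZ" using WZ closure_subset[of ZZ] by auto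
    moreover have "(SOME k. x \<in> Z (Suc k) - Z k \<and> la k \<in> J) = k"
      using increments_disjoint[OF incZ] that by (intro some_equality) auto
    ultimately show ?thesis using that unfolding lab_def by auto
  qed
  have labJ: "lab x \<in> J \<longleftrightarrow> x \<in> closure ZZ" if "x \<in> G" for x
  proof (cases "x \<in> WW")
    case True
    then have "lab x \<in> I" using someI_ex[of "\<lambda>k. x \<in> W (Suc k) - W k \<and> la k \<in> I"] i0
      unfolding lab_def by auto
    then show ?thesis using True WZ disj by auto
  next
    case False
    show ?thesis
    proof (cases "x \<in> closure ZZ")
      case True
      then have "lab x \<in> J" using False someI_ex[of "\<lambda>k. x \<in> Z (Suc k) - Z k \<and> la k \<in> J"] j0
        unfolding lab_def by auto
      then show ?thesis using True by simp
    next
      case f: False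
      then have "lab x = i0" using False by (simp add: lab_def)
      then show ?thesis using f disj i0 by auto
    qed
  qed
  have labI: "lab x \<in> I \<union> J" if "x \<in> G" for x
    using labJ[OF that] i0 someI_ex[of "\<lambda>k. x \<in> W (Suc k) - W k \<and> la k \<in> I"]
    by (cases "x \<in> closure ZZ") (auto simp: lab_def)
  have open_I: "open {x \<in> G. lab x = i}" if i: "i \<in> I" for i
  proof (rule open_subopen[THEN iffD2], rule ballI)
    fix x assume x: "x \<in> {x \<in> G. lab x = i}"
    then have nZ: "x \<notin> closure ZZ" using labJ[of x] i disj by auto
    have "\<exists>U. open U \<and> x \<in> U \<and> U \<subseteq> {x \<in> G. lab x = i}"
    proof (cases "x \<in> WW")
      case True
      then obtain k where k: "x \<in> W k" by (auto simp: WW_def)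
      have "\<exists>k. x \<in> W (Suc k) - W k"
      proof (rule ccontr)
        assume n: "\<nexists>k. x \<in> W (Suc k) - W k"
        have "x \<notin> W k" for k by (induction k) (use n W00 in auto)
        then show False using k by auto
      qed
      then obtain k where k: "x \<in> W (Suc k) - W k" by blast
      then have "W (Suc k) - W k \<subseteq> {y \<in> WW. lab y = lab x}"
        using labW by (auto simp: WW_def)
      then have "\<exists>U. open U \<and> x \<in> U \<and> U \<subseteq> {y \<in> WW. lab y = lab x}"
        using oW k by blast
      then show ?thesis using x WG by blast
    next
      case False
      \<comment> \<open>By \<open>left\<close> the points of \<open>G\<close> outside
        \<open>WW\<close> and \<open>closure ZZ\<close> are exactly those outside both closures, so
        they form an open set with constant label \<open>i0\<close>.\<close>
      then have "x \<in> G - closure ZZ - closure WW" using x nZ left by auto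
      moreover have "open (G - closure ZZ - closure WW)" using G by (simp add: open_Diff)
      moreover have "G - closure ZZ - closure WW \<subseteq> {x \<in> G. lab x = i}"
      proof -
        have "lab y = i0" if "y \<in> G - closure ZZ - closure WW" for y
          using that closure_subset[of WW] by (auto simp: lab_def)
        moreover have "lab x = i0" using False nZ by (simp add: lab_def)
        ultimately show ?thesis using x by auto
      qed
      ultimately show ?thesis by blast
    qed
    then show "\<exists>T. open T \<and> x \<in> T \<and> T \<subseteq> {x \<in> G. lab x = i}" .
  qed
  have acc: "x \<in> closure {y \<in> G. lab y = l}"
    if x: "x \<in> closure G" "x \<notin> G \<or> lab x \<in> J" and l: "l \<in> I \<union> J" for x l
    unfolding closure_approachable
  proof (intro allI impI)
    fix d :: real assume d: "d > 0"
    have "x \<in> closure ZZ"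
    proof (cases "x \<in> G")
      case True then show ?thesis using x labJ by auto
    next
      case False
      then have "x \<in> frontier G" using x G by (auto simp: frontier_def interior_open)
      then have "x \<in> Z 0" using D[of 0] by (auto simp: dissection_def)
      then show ?thesis using closure_subset[of ZZ] by (auto simp: ZZ_def)
    qed
    then obtain k0 z where z: "z \<in> Z k0" "dist z x < d/2"
      using d unfolding closure_approachable ZZ_def by (metis UN_E half_gt_zero)
    obtain n where n: "\<And>k. k \<ge> n \<Longrightarrow> 2 * e k < d/2"
      using inverse_Suc_small[of "d/2"] d(1) by (auto simp: e_def)
    obtain k where k: "k \<ge> max n k0" "la k = l" using la_surj[OF l] by blast
    have zk: "z \<in> Z k" using z k incseqD[OF incZ, of k0 k] by auto
    have "\<exists>y\<in>G. lab y = l \<and> dist y z < 2 * e k"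
    proof (cases "l \<in> I")
      case True
      then show ?thesis using accI[OF zk] labW k by force
    next
      case False
      then have "l \<in> J" using l by auto
      then show ?thesis using accJ[OF zk] False labZ k by force
    qed
    then obtain y where y: "y \<in> G" "lab y = l" "dist y z < 2 * e k" by blast
    have "dist y x \<le> dist y z + dist z x" by (rule dist_triangle)
    then have "dist y x < d" using y z n[of k] k by auto
    then show "\<exists>y\<in>{y \<in> G. lab y = l}. dist y x < d" using y by blast
  qed
  have "lab x0 \<in> J" using labJ[OF x0] x0Z closure_subset[of ZZ] by (auto simp: ZZ_def)
  then show ?thesis using that[of lab] labI open_I acc x0 by blast
qed

text \<open>The case without open pieces. Each stage adds a maximal separated subset of what
  remains, at ever finer scale, and is closed with dense complement in \<open>G\<close>; so
  \<open>G\<close> is never exhausted and every later stage comes near each of its points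
  again.\<close>

lemma dense_labelling:
  fixes G :: "'a::{metric_space, perfect_space} set" and J :: "'l set"
  assumes G: "open G" and J: "finite J" "J \<noteq> {}"
  obtains lab where "\<And>x. lab x \<in> J" "\<And>j. j \<in> J \<Longrightarrow> G \<subseteq> closure {y \<in> G. lab y = j}"
proof -
  obtain j0 where j0: "j0 \<in> J" using J by auto
  obtain ls where ls: "set ls = J" using J by (metis finite_list)
  define N where "N = length ls"
  have N: "N > 0" using ls J by (auto simp: N_def)
  define la where "la k = ls ! (k mod N)" for k
  have la: "la k \<in> J" for k using N ls by (metis la_def N_def mod_less_divisor nth_mem)
  have la_surj: "\<exists>k\<ge>n. la k = l" if l: "l \<in> J" for n l
  proof -
    obtain m where m: "m < N" "ls ! m = l" using l ls by (metis in_set_conv_nth N_def)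
    then show ?thesis using mod_le_exists[OF m(1), of n] by (auto simp: la_def)
  qed
  define e :: "nat \<Rightarrow> real" where "e k = inverse (real (Suc k))" for k
  have e: "e k > 0" for k by (simp add: e_def)
  define P where "P F \<longleftrightarrow> closed F \<and> G \<subseteq> closure (G - F)" for F :: "'a set"
  have "\<exists>F. \<forall>k. P (F k) \<and> (F k \<subseteq> F (Suc k) \<and>
      (\<forall>x\<in>G. \<exists>y\<in>F (Suc k) - F k. y \<in> G \<and> dist y x < 2 * e k))"
  proof (rule dependent_nat_choice)
    show "\<exists>F. P F" by (rule exI[of _ "{}"]) (simp add: P_def closure_subset)
  next
    fix F k assume F: "P F"
    have oGF: "open (G - F)" using F G by (auto simp: P_def)
    obtain E where E: "E \<subseteq> G - F" "separated (e k) E" "\<And>a. a \<in> G - F \<Longrightarrow> \<exists>x\<in>E. dist a x < e k"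
      by (rule maximal_separated[OF e[of k], of "G - F"]) blast
    have "G - F \<subseteq> closure (G - F - E)"
      by (rule closure_open_diff_separated[OF E(2) e oGF])
    then have "closure (G - F) \<subseteq> closure (G - (F \<union> E))"
      by (simp add: closure_minimal Diff_Un set_diff_eq Int_def conj_ac)
    then have "P (F \<union> E)" using F closed_separated[OF E(2) e] by (auto simp: P_def)
    moreover have "\<exists>y\<in>F \<union> E - F. y \<in> G \<and> dist y x < 2 * e k" if x: "x \<in> G" for x
    proof -
      have "x \<in> closure (G - F)" using F x by (auto simp: P_def)
      then obtain a where a: "a \<in> G - F" "dist a x < e k"
        using e[of k] unfolding closure_approachable by blast
      then obtain y where y: "y \<in> E" "dist a y < e k" using E(3)[of a] by blast
      have "dist y x \<le> dist a y + dist a x" by (metis dist_commute dist_triangle)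
      then show ?thesis using a y E(1) by force
    qed
    ultimately show "\<exists>F'. P F' \<and> (F \<subseteq> F' \<and> (\<forall>x\<in>G. \<exists>y\<in>F' - F. y \<in> G \<and> dist y x < 2 * e k))"
      by (intro exI[of _ "F \<union> E"]) auto
  qed
  then obtain F where F: "\<forall>k. P (F k) \<and> (F k \<subseteq> F (Suc k) \<and>
      (\<forall>x\<in>G. \<exists>y\<in>F (Suc k) - F k. y \<in> G \<and> dist y x < 2 * e k))" ..
  then have inc: "incseq F" by (simp add: incseq_SucI)
  have near: "\<exists>y\<in>F (Suc k) - F k. y \<in> G \<and> dist y x < 2 * e k" if "x \<in> G" for k x
    using F that by blast
  define lab where "lab x = (if \<exists>k. x \<in> F (Suc k) - F k then la (THE k. x \<in> F (Suc k) - F k) else j0)" for x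
  have lab: "lab x = la k" if "x \<in> F (Suc k) - F k" for x k
  proof -
    have "(THE k. x \<in> F (Suc k) - F k) = k"
      using increments_disjoint[OF inc] that by (intro the_equality) auto
    then show ?thesis using that unfolding lab_def by auto
  qed
  show ?thesis
  proof (rule that)
    show "lab x \<in> J" for x using la j0 by (simp add: lab_def)
    show "G \<subseteq> closure {y \<in> G. lab y = j}" if j: "j \<in> J" for j
    proof
      fix x assume x: "x \<in> G"
      show "x \<in> closure {y \<in> G. lab y = j}"
        unfolding closure_approachable
      proof (intro allI impI)
        fix d :: real assume "d > 0"
        then obtain n where n: "\<And>k. k \<ge> n \<Longrightarrow> 2 * e k < d"
          using inverse_Suc_small[of d] by (auto simp: e_def)
        obtain k where k: "k \<ge> n" "la k = j" using la_surj[OF j] by blast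
        then obtain y where "y \<in> F (Suc k) - F k" "y \<in> G" "dist y x < 2 * e k"
          using near[OF x] by blast
        then show "\<exists>y\<in>{y \<in> G. lab y = j}. dist y x < d" using lab k n[of k] by force
      qed
    qed
  qed
qed

section \<open>Interior maps onto finite preorders\<close>

text \<open>The condition on the boundary of \<open>G\<close> is what lets the maps on the pieces of a dissection
  be glued along the dissecting set.\<close>

locale interior_map_onto =
  fixes le :: "'s \<Rightarrow> 's \<Rightarrow> bool" and s :: 's and G :: "'a::topological_space set" and f :: "'a \<Rightarrow> 's"
  assumes above: "x \<in> G \<Longrightarrow> le s (f x)"
    and continuous: "x \<in> G \<Longrightarrow> \<exists>U. open U \<and> x \<in> U \<and> (\<forall>y\<in>U. y \<in> G \<and> le (f x) (f y))"
    and dense: "x \<in> G \<Longrightarrow> le (f x) t \<Longrightarrow> x \<in> closure {y \<in> G. f y = t}"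
    and boundary: "x \<in> closure G \<Longrightarrow> x \<notin> G \<Longrightarrow> le s t \<Longrightarrow> x \<in> closure {y \<in> G. f y = t}"
    and root: "\<exists>x\<in>G. f x = s"

theorem interior_map_exists:
  fixes G :: "'a::{metric_space, perfect_space} set" and S :: "'s set"
  assumes fin: "finite S" and refl: "\<And>s. s \<in> S \<Longrightarrow> le s s"
    and trans: "\<And>s t u. le s t \<Longrightarrow> le t u \<Longrightarrow> le s u" and leS: "\<And>s t. le s t \<Longrightarrow> t \<in> S"
    and s: "s \<in> S" and G: "open G" "G \<noteq> {}"
  shows "\<exists>f. interior_map_onto le s G f"
  using s G
proof (induction "card {t. le s t \<and> \<not> le t s}" arbitrary: s G rule: less_induct)
  case less
  define I where "I = {t. le s t \<and> \<not> le t s}"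
  define J where "J = {t. le s t \<and> le t s}"
  have sub: "I \<subseteq> S" "J \<subseteq> S" using leS by (auto simp: I_def J_def)
  have finIJ: "finite I" "finite J" using sub fin by (auto intro: finite_subset)
  have sJ: "s \<in> J" using refl less.prems by (auto simp: J_def)
  have IJ: "le s t \<longleftrightarrow> t \<in> I \<union> J" for t by (auto simp: I_def J_def)
  show ?case
  proof (cases "I = {}")
    case True
    obtain lab where lab: "\<And>x. lab x \<in> J" "\<And>j. j \<in> J \<Longrightarrow> G \<subseteq> closure {y \<in> G. lab y = j}"
      by (rule dense_labelling[OF less.prems(2) finIJ(2)]) (use sJ in blast)+
    have J: "le j t \<longleftrightarrow> t \<in> J" if "j \<in> J" for j t
      using that True trans by (auto simp: I_def J_def)
    have dense: "closure G \<subseteq> closure {y \<in> G. lab y = j}" if "j \<in> J" for j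
      using lab(2)[OF that] by (simp add: closure_minimal)
    have root: "\<exists>x\<in>G. lab x = s"
    proof (rule ccontr)
      assume "\<not> ?thesis"
      then have "{y \<in> G. lab y = s} = {}" by auto
      then have "G \<subseteq> closure {}" using lab(2)[OF sJ] by metis
      then show False using less.prems(3) by simp
    qed
    have le_lab: "le s (lab x)" "le (lab x) (lab y)" for x y
      using lab(1) J sJ by auto
    have "interior_map_onto le s G lab"
    proof
      show "\<exists>U. open U \<and> x \<in> U \<and> (\<forall>y\<in>U. y \<in> G \<and> le (lab x) (lab y))" if "x \<in> G" for x
        using that le_lab(2) less.prems(2) by blast
      show "x \<in> closure {y \<in> G. lab y = t}" if "x \<in> G" "le (lab x) t" for x t
        using dense[of t] that J[OF lab(1)] closure_subset[of G] by blast
      show "x \<in> closure {y \<in> G. lab y = t}" if "x \<in> closure G" "le s t" for x t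
        using dense[of t] that J[OF sJ] by blast
    qed (rule le_lab(1), rule root)
    then show ?thesis by blast
  next
    case False
    have disj: "I \<inter> J = {}" by (auto simp: I_def J_def)
    obtain lab where lab: "\<And>x. x \<in> G \<Longrightarrow> lab x \<in> I \<union> J"
      and lab_open: "\<And>i. i \<in> I \<Longrightarrow> open {x \<in> G. lab x = i}"
      and lab_acc: "\<And>x l. x \<in> closure G \<Longrightarrow> x \<notin> G \<or> lab x \<in> J \<Longrightarrow> l \<in> I \<union> J \<Longrightarrow>
       x \<in> closure {y \<in> G. lab y = l}"
      and lab_J: "\<exists>x\<in>G. lab x \<in> J"
      by (rule dissection_labelling[OF less.prems(2,3) finIJ False _ disj]) (use sJ in blast)+
    have lab_ne: "{x \<in> G. lab x = l} \<noteq> {}" if "l \<in> I \<union> J" for l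
    proof -
      obtain x where x: "x \<in> G" "lab x \<in> J" using lab_J by blast
      then have "x \<in> closure {y \<in> G. lab y = l}"
        using lab_acc[of x l] that closure_subset[of G] by blast
      then show ?thesis by (metis closure_empty empty_iff)
    qed
    define Gi where "Gi i = {x \<in> G. lab x = i}" for i
    have "\<exists>f. interior_map_onto le i (Gi i) f" if i: "i \<in> I" for i
    proof (rule less.hyps)
      \<comment> \<open>Proper, because \<open>i\<close> lies in \<open>I\<close> but is not
        strictly above itself.\<close>
      have "{t. le i t \<and> \<not> le t i} \<subset> I"
        using i trans refl leS by (auto simp: I_def)
      then show "card {t. le i t \<and> \<not> le t i} < card {t. le s t \<and> \<not> le t s}"
        using finIJ by (auto simp: I_def intro: psubset_card_mono)
      show "i \<in> S" using i sub by auto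
      show "open (Gi i)" using lab_open[OF i] by (simp add: Gi_def)
      show "Gi i \<noteq> {}" using lab_ne[of i] i by (simp add: Gi_def)
    qed
    then have "\<forall>i\<in>I. \<exists>f. interior_map_onto le i (Gi i) f" by blast
    from bchoice[OF this] obtain g where g: "\<And>i. i \<in> I \<Longrightarrow> interior_map_onto le i (Gi i) (g i)"
      by blast
    have mem: "x \<in> Gi (lab x)" if "x \<in> G" for x using that by (simp add: Gi_def)
    define f where "f x = (if lab x \<in> J then lab x else g (lab x) x)" for x
    have sf: "le s (f x)" if "x \<in> G" for x
          proof (cases "lab x \<in> J")
      case True then show ?thesis by (simp add: f_def J_def)
    next
      case False
      then have i: "lab x \<in> I" using lab[OF that] by auto
      have "le (lab x) (g (lab x) x)"
        by (rule interior_map_onto.above[OF g[OF i] mem[OF that]])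
      then show ?thesis using i trans False unfolding f_def I_def by auto
    qed
    have f_I: "{y \<in> Gi i. g i y = t} \<subseteq> {y \<in> G. f y = t}" if "i \<in> I" for i t
      using that disj by (auto simp: f_def Gi_def)
    have acc: "x \<in> closure {y \<in> G. f y = t}"
      if x: "x \<in> closure G" "x \<notin> G \<or> lab x \<in> J" and t: "le s t" for x t
    proof (cases "t \<in> J")
      case True
      then have "{y \<in> G. lab y = t} \<subseteq> {y \<in> G. f y = t}" by (auto simp: f_def)
      then show ?thesis using lab_acc[OF x, of t] True closure_mono by blast
    next
      case False
      then have t: "t \<in> I" using t IJ by auto
      then have "x \<in> closure {y \<in> G. lab y = t}" using lab_acc[OF x] by blast
      \<comment> \<open>A limit of the piece \<open>Gi t\<close> outside it is a boundary point of
        the piece, where the boundary condition of \<open>g t\<close> supplies points of value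
        \<open>t\<close>. Accumulation of the label \<open>t\<close> alone would not do, as
        \<open>g t\<close> may take other values on the piece.\<close>
      moreover have "x \<notin> Gi t" using x t disj by (auto simp: Gi_def)
      ultimately have "x \<in> closure (Gi t) - Gi t" by (simp add: Gi_def)
      moreover have "le t t" using refl t sub by auto
      ultimately have "x \<in> closure {y \<in> Gi t. g t y = t}"
        using interior_map_onto.boundary[OF g[OF t]] by blast
      then show ?thesis using closure_mono[OF f_I[OF t]] by blast
    qed
    have f_open: "\<exists>U. open U \<and> x \<in> U \<and> (\<forall>y\<in>U. y \<in> G \<and> le (f x) (f y))" if x: "x \<in> G" for x
    proof (cases "lab x \<in> J")
      case True
      then have "le (f x) t" if "le s t" for t using that trans by (auto simp: f_def J_def)
      then show ?thesis using sf less.prems(2) x by blast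
    next
      case False
      then have i: "lab x \<in> I" using lab[OF x] by auto
      obtain U where U: "open U" "x \<in> U" "\<And>y. y \<in> U \<Longrightarrow> y \<in> Gi (lab x) \<and> le (g (lab x) x) (g (lab x) y)"
        using interior_map_onto.continuous[OF g[OF i] mem[OF x]] by blast
      then have "y \<in> G \<and> le (f x) (f y)" if "y \<in> U" for y
      proof -
        have "y \<in> G" "lab y = lab x" "le (g (lab x) x) (g (lab x) y)"
          using U(3)[OF that] by (simp_all add: Gi_def)
        then show ?thesis using False by (simp add: f_def)
      qed
      then show ?thesis using U by blast
    qed
    have f_back: "x \<in> closure {y \<in> G. f y = t}" if x: "x \<in> G" and t: "le (f x) t" for x t
    proof (cases "lab x \<in> J")
      case True
      then show ?thesis using acc[of x t] x t sf[OF x] trans closure_subset[of G] by blast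
    next
      case False
      then have i: "lab x \<in> I" using lab[OF x] by auto
      have "le (g (lab x) x) t" using t False by (simp add: f_def)
      then have "x \<in> closure {y \<in> Gi (lab x). g (lab x) y = t}"
        by (rule interior_map_onto.dense[OF g[OF i] mem[OF x]])
      then show ?thesis using closure_mono[OF f_I[OF i]] by blast
    qed
    have f_root: "\<exists>x\<in>G. f x = s"
    proof -
      obtain x where "x \<in> G" "lab x = s" using lab_ne[of s] sJ by auto
      then show ?thesis using sJ by (auto simp: f_def)
    qed
    have "interior_map_onto le s G f"
    proof
      show "x \<in> closure {y \<in> G. f y = t}" if "x \<in> closure G" "x \<notin> G" "le s t" for x t
        using acc that by blast
    qed (use sf f_open f_back f_root in blast)+
    then show ?thesis by blast
  qed
qed

section \<open>Semantics over general frames\<close>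

text \<open>With \<open>fun_upd_apply\<close> as a simplification rule, updated assignments under a set comprehension
  are expanded into conditionals.\<close>

declare fun_upd_apply [simp del] fun_upd_same [simp] fun_upd_other [simp]

text \<open>One semantics for three structures: \<open>interior\<close> with all sets for the space,
  \<open>box\<close> with the definable sets for the canonical frame, \<open>fbox\<close> with all
  sets for the finite quotient. \<open>D\<close> restricts only the pre-fixed points that are
  intersected; nothing here forces the intersection itself into \<open>D\<close>.\<close>

primrec gtruth :: "('w set \<Rightarrow> 'w set) \<Rightarrow> 'w set set \<Rightarrow> 'v mfm \<Rightarrow> ('v \<Rightarrow> 'w set) \<Rightarrow> 'w set" where
  "gtruth bx D (MAtom p) h = h p"
| "gtruth bx D MTop h = UNIV"
| "gtruth bx D (MNeg a) h = - gtruth bx D a h"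
| "gtruth bx D (MAnd a b) h = gtruth bx D a h \<inter> gtruth bx D b h"
| "gtruth bx D (MBox a) h = bx (gtruth bx D a h)"
| "gtruth bx D (MMu q a) h = \<Inter>{S \<in> D. gtruth bx D a (h(q := S)) \<subseteq> S}"

lemma mtruth_gtruth: "mtruth a h = gtruth interior UNIV a h"
proof (induction a arbitrary: h)
  case (MBox a)
  then show ?case by (auto simp: interior_def)
next
  case (MMu q a)
  then show ?case by (simp add: lfp_def)
qed simp_all

lemma gtruth_cong:
  "(\<And>p. p \<in> mfree a \<Longrightarrow> h p = h' p) \<Longrightarrow> gtruth bx D a h = gtruth bx D a h'"
proof (induction a arbitrary: h h')
  case (MNeg a)
  have "gtruth bx D a h = gtruth bx D a h'" using MNeg.prems by (intro MNeg.IH) simp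
  then show ?case by simp
next
  case (MAnd a b)
  have "gtruth bx D a h = gtruth bx D a h'" "gtruth bx D b h = gtruth bx D b h'"
    using MAnd.prems by (intro MAnd.IH; simp)+
  then show ?case by simp
next
  case (MBox a)
  have "gtruth bx D a h = gtruth bx D a h'" using MBox.prems by (intro MBox.IH) simp
  then show ?case by simp
next
  case (MMu q a)
  have "gtruth bx D a (h(q := S)) = gtruth bx D a (h'(q := S))" for S
    using MMu.prems by (intro MMu.IH) (auto simp: fun_upd_apply)
  then show ?case by simp
qed auto

lemma gtruth_mono:
  assumes bx: "\<And>A B. A \<subseteq> B \<Longrightarrow> bx A \<subseteq> bx B" and "A \<subseteq> B"
  shows "mu_formula a \<Longrightarrow> mparity q a True \<Longrightarrow> gtruth bx D a (h(q := A)) \<subseteq> gtruth bx D a (h(q := B))"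
    and "mu_formula a \<Longrightarrow> mparity q a False \<Longrightarrow> gtruth bx D a (h(q := B)) \<subseteq> gtruth bx D a (h(q := A))"
proof (induction a arbitrary: h)
  case (MAtom p)
  { case 1 then show ?case using assms by (cases "p = q") auto }
  { case 2 then show ?case by (cases "p = q") auto }
next
  case (MAnd a b)
  { case 1
    then show ?case using MAnd.IH(1,3)[of h] unfolding gtruth.simps by (intro Int_mono) simp_all }
  { case 2
    then show ?case using MAnd.IH(2,4)[of h] unfolding gtruth.simps by (intro Int_mono) simp_all }
next
  case (MBox a)
  { case 1 then show ?case using MBox.IH(1) bx by simp }
  { case 2 then show ?case using MBox.IH(2) bx by simp }
next
  case (MMu p a)
  { case 1
    show ?case
    proof (cases "p = q")
      case False
      then have "gtruth bx D a (h(q := A, p := S)) \<subseteq> gtruth bx D a (h(q := B, p := S))" for S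
        using 1 MMu.IH(1)[of "h(p := S)"] by (simp add: fun_upd_twist)
      then show ?thesis by simp blast
    qed simp }
  { case 2
    show ?case
    proof (cases "p = q")
      case False
      then have "gtruth bx D a (h(q := B, p := S)) \<subseteq> gtruth bx D a (h(q := A, p := S))" for S
        using 2 MMu.IH(2)[of "h(p := S)"] by (simp add: fun_upd_twist)
      then show ?thesis by simp blast
    qed simp }
qed auto

lemma gtruth_msubst:
  "mfree_for s q a \<Longrightarrow> gtruth bx D (msubst a s q) h = gtruth bx D a (h(q := gtruth bx D s h))"
proof (induction a arbitrary: h)
  case (MMu p a)
  show ?case
  proof (cases "p = q")
    case False
    have "gtruth bx D (msubst a s q) (h(p := S)) = gtruth bx D a (h(q := gtruth bx D s h, p := S))" for S
    proof (cases "q \<in> mfree a")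
      case True
      then have "gtruth bx D s (h(p := S)) = gtruth bx D s h"
        using MMu.prems False by (intro gtruth_cong) (auto simp: fun_upd_apply)
      then show ?thesis using MMu False by (simp add: fun_upd_twist)
    next
      \<comment> \<open>Capture by \<open>p\<close> is not excluded here, but the value at
        \<open>q\<close> is then irrelevant to \<open>a\<close>.\<close>
      case f: False
      have "gtruth bx D a (h(p := S, q := T)) = gtruth bx D a (h(p := S, q := T'))" for T T'
        using f by (intro gtruth_cong) (auto simp: fun_upd_apply)
      then show ?thesis using MMu False by (simp add: fun_upd_twist)
    qed
    then show ?thesis using False by simp
  qed simp
qed auto

lemma gtruth_malpha: "malpha a b \<Longrightarrow> gtruth bx D a h = gtruth bx D b h"
proof (induction arbitrary: h rule: malpha.induct)
  case (malpha_rename r a q)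
  have "gtruth bx D (msubst a (MAtom r) q) (h(r := S)) = gtruth bx D a (h(q := S))" for S
  proof -
    have "gtruth bx D (msubst a (MAtom r) q) (h(r := S)) = gtruth bx D a (h(r := S, q := S))"
      by (simp only: gtruth_msubst[OF malpha_rename(2)] gtruth.simps fun_upd_same)
    also have "\<dots> = gtruth bx D a (h(q := S))"
      using malpha_rename(1) by (intro gtruth_cong) (auto simp: fun_upd_apply)
    finally show ?thesis .
  qed
  then show ?case by simp
qed simp_all

lemma gtruth_MMu_prefixed:
  assumes "\<And>A B. A \<subseteq> B \<Longrightarrow> bx A \<subseteq> bx B" "mu_formula (MMu q a)"
  shows "gtruth bx D a (h(q := gtruth bx D (MMu q a) h)) \<subseteq> gtruth bx D (MMu q a) h"
proof -
  have "gtruth bx D a (h(q := gtruth bx D (MMu q a) h)) \<subseteq> S"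
    if S: "S \<in> D" "gtruth bx D a (h(q := S)) \<subseteq> S" for S
  proof -
    have "gtruth bx D (MMu q a) h \<subseteq> S" using S by auto
    then have "gtruth bx D a (h(q := gtruth bx D (MMu q a) h)) \<subseteq> gtruth bx D a (h(q := S))"
      using assms by (intro gtruth_mono(1)) auto
    then show ?thesis using S by simp
  qed
  then show ?thesis by auto
qed

lemma gtruth_MMu_lower:
  "S \<in> D \<Longrightarrow> gtruth bx D a (h(q := S)) \<subseteq> S \<Longrightarrow> gtruth bx D (MMu q a) h \<subseteq> S"
  unfolding gtruth.simps by (rule Inter_lower) blast

text \<open>In the Knaster-Tarski argument the unfolded value must be one of the sets intersected,
  hence the membership in \<open>D\<close>.\<close>

lemma gtruth_MMu_fixed:
  assumes "\<And>A B. A \<subseteq> B \<Longrightarrow> bx A \<subseteq> bx B" "mu_formula (MMu q a)"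
    and "gtruth bx D a (h(q := gtruth bx D (MMu q a) h)) \<in> D"
  shows "gtruth bx D a (h(q := gtruth bx D (MMu q a) h)) = gtruth bx D (MMu q a) h"
proof (rule subset_antisym)
  show le: "gtruth bx D a (h(q := gtruth bx D (MMu q a) h)) \<subseteq> gtruth bx D (MMu q a) h"
    by (rule gtruth_MMu_prefixed[OF assms(1,2)])
  show "gtruth bx D (MMu q a) h \<subseteq> gtruth bx D a (h(q := gtruth bx D (MMu q a) h))"
    using assms le by (intro gtruth_MMu_lower gtruth_mono(1)) auto
qed

text \<open>\<open>- bx (- X)\<close> is the diamond of \<open>X\<close>. The union runs over all
  subsets, which suits the space and the finite quotient; the canonical frame is handled through
  \<open>tangle_valuation\<close>.\<close>

primrec gttruth :: "('w set \<Rightarrow> 'w set) \<Rightarrow> ('v \<Rightarrow> 'w set) \<Rightarrow> 'v tfm \<Rightarrow> 'w set" where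
  "gttruth bx h (TAtom p) = h p"
| "gttruth bx h TTop = UNIV"
| "gttruth bx h (TNeg a) = - gttruth bx h a"
| "gttruth bx h (TAnd a b) = gttruth bx h a \<inter> gttruth bx h b"
| "gttruth bx h (TBox a) = bx (gttruth bx h a)"
| "gttruth bx h (TTangle G) =
     \<Union>{S. \<forall>A \<in> fset (gttruth bx h |`| G). S \<subseteq> - bx (- (A \<inter> S))}"

lemma ttruth_gttruth: "ttruth h a = gttruth interior h a"
proof (induction a)
  case (TBox a)
  then show ?case by (auto simp: interior_def)
next
  case (TTangle G)
  then have eq: "ttruth h |`| G = gttruth interior h |`| G" by (intro fset.map_cong) auto
  show ?case unfolding ttruth.simps gttruth.simps eq closure_interior le_INF_iff Union_eq by blast
qed simp_all

text \<open>For least fixed points, the point is that \<open>{s. f -` {s} \<subseteq> A}\<close> is a prefixed point whenever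
  \<open>A\<close> is one.\<close>

lemma gtruth_vimage:
  assumes vim: "\<And>Z. f -` bx Z = bx' (f -` Z)"
    and mono: "\<And>A B. A \<subseteq> B \<Longrightarrow> bx A \<subseteq> bx B" "\<And>A B. A \<subseteq> B \<Longrightarrow> bx' A \<subseteq> bx' B"
  shows "mu_formula a \<Longrightarrow> gtruth bx' UNIV a (\<lambda>p. f -` h p) = f -` gtruth bx UNIV a h"
proof (induction a arbitrary: h)
  case (MMu q a)
  let ?h = "\<lambda>p. f -` h p"
  let ?A = "gtruth bx' UNIV (MMu q a) ?h"
  let ?B = "gtruth bx UNIV (MMu q a) h"
  have IH: "gtruth bx' UNIV a (?h(q := f -` Z)) = f -` gtruth bx UNIV a (h(q := Z))" for Z
  proof -
    have "?h(q := f -` Z) = (\<lambda>p. f -` (h(q := Z)) p)" by (auto simp: fun_eq_iff fun_upd_apply)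
    then show ?thesis using MMu.IH[of "h(q := Z)"] MMu.prems by simp
  qed
  have mu: "mu_formula (MMu q a)" using MMu by simp
  show ?case
  proof (rule subset_antisym)
    have "gtruth bx UNIV a (h(q := ?B)) \<subseteq> ?B"
      by (rule gtruth_MMu_prefixed[OF mono(1) mu])
    then show "?A \<subseteq> f -` ?B"
      unfolding gtruth.simps(6)[of bx'] using IH[of ?B] by blast
    define Z where "Z = {s. f -` {s} \<subseteq> ?A}"
    have "f -` Z \<subseteq> ?A" by (auto simp: Z_def simp del: gtruth.simps)
    then have "gtruth bx' UNIV a (?h(q := f -` Z)) \<subseteq> gtruth bx' UNIV a (?h(q := ?A))"
      using mu by (intro gtruth_mono(1) mono) auto
    also have "\<dots> \<subseteq> ?A" by (rule gtruth_MMu_prefixed[OF mono(2) mu])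
    finally have "f -` gtruth bx UNIV a (h(q := Z)) \<subseteq> ?A" using IH by simp
    then have "gtruth bx UNIV a (h(q := Z)) \<subseteq> Z" unfolding Z_def by blast
    then have "?B \<subseteq> Z" by (intro gtruth_MMu_lower) auto
    then show "f -` ?B \<subseteq> ?A" unfolding Z_def by blast
  qed
qed (use vim in \<open>simp_all add: vimage_Compl\<close>)

text \<open>Since \<open>f\<close> commutes with the modality, the direct image of a witness
  \<open>S\<close> for the tangle is a witness in the target, and the preimage of a witness in the
  target is one in the source.\<close>

lemma gttruth_vimage:
  assumes vim: "\<And>Z. f -` bx Z = bx' (f -` Z)"
    and mono: "\<And>A B. A \<subseteq> B \<Longrightarrow> bx A \<subseteq> bx B" "\<And>A B. A \<subseteq> B \<Longrightarrow> bx' A \<subseteq> bx' B"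
  shows "gttruth bx' (\<lambda>p. f -` h p) a = f -` gttruth bx h a"
proof (induction a)
  case (TTangle G)
  let ?h = "\<lambda>p. f -` h p"
  show ?case
  proof (rule subset_antisym)
    show "gttruth bx' ?h (TTangle G) \<subseteq> f -` gttruth bx h (TTangle G)"
    proof
      fix x assume "x \<in> gttruth bx' ?h (TTangle G)"
      then obtain S where S: "x \<in> S" "\<And>g. g \<in> fset G \<Longrightarrow> S \<subseteq> - bx' (- (gttruth bx' ?h g \<inter> S))"
        by auto
      have "f ` S \<subseteq> - bx (- (gttruth bx h g \<inter> f ` S))" if g: "g \<in> fset G" for g
      proof -
        have "- bx' (- (gttruth bx' ?h g \<inter> S)) \<subseteq> - bx' (- (f -` (gttruth bx h g \<inter> f ` S)))"
          using TTangle[OF g] by (intro Compl_anti_mono mono(2)) auto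
        also have "\<dots> = f -` (- bx (- (gttruth bx h g \<inter> f ` S)))"
          by (metis vim vimage_Compl)
        finally show ?thesis using S(2)[OF g] by blast
      qed
      then show "x \<in> f -` gttruth bx h (TTangle G)" using S(1) by auto
    qed
    show "f -` gttruth bx h (TTangle G) \<subseteq> gttruth bx' ?h (TTangle G)"
    proof
      fix x assume "x \<in> f -` gttruth bx h (TTangle G)"
      then obtain S where S: "f x \<in> S" "\<And>g. g \<in> fset G \<Longrightarrow> S \<subseteq> - bx (- (gttruth bx h g \<inter> S))"
        by auto
      have "f -` S \<subseteq> - bx' (- (gttruth bx' ?h g \<inter> f -` S))" if g: "g \<in> fset G" for g
      proof -
        have "f -` (- bx (- (gttruth bx h g \<inter> S))) = - bx' (- (gttruth bx' ?h g \<inter> f -` S))"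
          using TTangle[OF g] by (metis vim vimage_Compl vimage_Int)
        then show ?thesis using S(2)[OF g] by blast
      qed
      then show "x \<in> gttruth bx' ?h (TTangle G)" using S(1) by auto
    qed
  qed
qed (use vim in \<open>simp_all add: vimage_Compl\<close>)

section \<open>Finite quotients of general frames\<close>

locale general_frame =
  fixes R :: "'w \<Rightarrow> 'w \<Rightarrow> bool" and D :: "'w set set"
  assumes R_refl: "R x x" and R_trans: "R x y \<Longrightarrow> R y z \<Longrightarrow> R x z"
    and D_Compl: "A \<in> D \<Longrightarrow> - A \<in> D" and D_Int: "A \<in> D \<Longrightarrow> B \<in> D \<Longrightarrow> A \<inter> B \<in> D"
    and D_UNIV: "UNIV \<in> D" and D_box: "A \<in> D \<Longrightarrow> {x. \<forall>y. R x y \<longrightarrow> y \<in> A} \<in> D"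
begin

definition box :: "'w set \<Rightarrow> 'w set" where
  "box A = {x. \<forall>y. R x y \<longrightarrow> y \<in> A}"

lemma mem_box: "x \<in> box A \<longleftrightarrow> (\<forall>y. R x y \<longrightarrow> y \<in> A)"
  by (simp add: box_def)

lemma box_mono: "A \<subseteq> B \<Longrightarrow> box A \<subseteq> box B"
  unfolding box_def by blast

lemma D_Un:
  assumes "A \<in> D" "B \<in> D" shows "A \<union> B \<in> D"
proof -
  have "A \<union> B = - (- A \<inter> - B)" by blast
  then show ?thesis using D_Compl[OF D_Int[OF D_Compl[OF assms(1)] D_Compl[OF assms(2)]]] by metis
qed

lemma D_empty: "{} \<in> D"
  using D_Compl[OF D_UNIV] by simp

lemma D_UN: "finite I \<Longrightarrow> (\<And>i. i \<in> I \<Longrightarrow> A i \<in> D) \<Longrightarrow> (\<Union>i\<in>I. A i) \<in> D"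
  by (induction I rule: finite_induct) (simp_all add: D_Un D_empty)

lemma D_INT: "finite I \<Longrightarrow> (\<And>i. i \<in> I \<Longrightarrow> A i \<in> D) \<Longrightarrow> (\<Inter>i\<in>I. A i) \<in> D"
  by (induction I rule: finite_induct) (simp_all add: D_Int D_UNIV)

text \<open>A finite colouring with definable fibres. Pairing, and passing to the set of colours
  seen from a world, preserve this; so types, futures, profiles and stability all turn out
  definable.\<close>

definition fin_def :: "('w \<Rightarrow> 'c) \<Rightarrow> bool" where
  "fin_def c \<longleftrightarrow> finite (range c) \<and> (\<forall>a. {x. c x = a} \<in> D)"

lemma fin_def_Collect:
  assumes "fin_def c" shows "{x. P (c x)} \<in> D"
proof -
  have "{x. P (c x)} = (\<Union>a\<in>{a \<in> range c. P a}. {x. c x = a})" by auto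
  also have "\<dots> \<in> D" using assms by (intro D_UN) (auto simp: fin_def_def)
  finally show ?thesis .
qed

lemma fin_def_Pair:
  assumes "fin_def c" "fin_def d" shows "fin_def (\<lambda>x. (c x, d x))"
  unfolding fin_def_def
proof (intro conjI allI)
  have "range (\<lambda>x. (c x, d x)) \<subseteq> range c \<times> range d" by auto
  then show "finite (range (\<lambda>x. (c x, d x)))"
    using assms by (auto simp: fin_def_def intro: finite_subset[OF _ finite_cartesian_product])
  fix a
  have "{x. (c x, d x) = a} = {x. c x = fst a} \<inter> {x. d x = snd a}" by (auto simp: prod_eq_iff)
  then show "{x. (c x, d x) = a} \<in> D" using assms by (auto simp: fin_def_def intro: D_Int)
qed

lemma fin_def_image:
  assumes "fin_def c" shows "fin_def (\<lambda>x. c ` {y. R x y})"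
  unfolding fin_def_def
proof (intro conjI allI)
  have "range (\<lambda>x. c ` {y. R x y}) \<subseteq> Pow (range c)" by auto
  then show "finite (range (\<lambda>x. c ` {y. R x y}))"
    using assms by (auto simp: fin_def_def intro: finite_subset)
  fix G
  show "{x. c ` {y. R x y} = G} \<in> D"
  proof (cases "G \<subseteq> range c")
    case True
    have dia: "{x. \<exists>y. R x y \<and> c y = a} \<in> D" for a
    proof -
      have "{x. \<exists>y. R x y \<and> c y = a} = - {x. \<forall>y. R x y \<longrightarrow> y \<in> - {y. c y = a}}" by auto
      also have "\<dots> \<in> D" using assms by (intro D_Compl D_box) (auto simp: fin_def_def)
      finally show ?thesis .
    qed
    have "{x. c ` {y. R x y} = G} =
      (\<Inter>a\<in>range c. if a \<in> G then {x. \<exists>y. R x y \<and> c y = a} else - {x. \<exists>y. R x y \<and> c y = a})"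
    proof (intro set_eqI)
      fix x
      have mem: "x \<in> (if a \<in> G then {x. \<exists>y. R x y \<and> c y = a} else - {x. \<exists>y. R x y \<and> c y = a})
        \<longleftrightarrow> (a \<in> G \<longleftrightarrow> a \<in> c ` {y. R x y})" for a by auto
      have "(\<forall>a\<in>range c. a \<in> G \<longleftrightarrow> a \<in> c ` {y. R x y}) \<longleftrightarrow> c ` {y. R x y} = G"
        using True by blast
      then show "x \<in> {x. c ` {y. R x y} = G} \<longleftrightarrow> x \<in> (\<Inter>a\<in>range c. if a \<in> G then {x. \<exists>y. R x y \<and> c y = a} else - {x. \<exists>y. R x y \<and> c y = a})"
        unfolding INT_iff mem by simp
    qed
    also have "\<dots> \<in> D" using assms dia by (intro D_INT) (auto simp: fin_def_def intro: D_Compl)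
    finally show ?thesis .
  next
    case False
    then have "{x. c ` {y. R x y} = G} = {}" by auto
    then show ?thesis using D_empty by simp
  qed
qed

end

section \<open>Types, futures, profiles and the quotient preorder\<close>

locale filtered_frame = general_frame R D
  for R :: "'w \<Rightarrow> 'w \<Rightarrow> bool" and D :: "'w set set" +
  fixes \<Sigma> :: "'w set set"
  assumes fin_\<Sigma>: "finite \<Sigma>" and \<Sigma>_D: "\<Sigma> \<subseteq> D"
begin

definition ty :: "'w \<Rightarrow> 'w set set" where
  "ty x = {A \<in> \<Sigma>. x \<in> A}"

definition fut :: "'w \<Rightarrow> 'w set set set" where
  "fut x = ty ` {y. R x y}"

definition prof :: "'w \<Rightarrow> ('w set set \<times> 'w set set set) set" where
  "prof x = (\<lambda>y. (ty y, fut y)) ` {y. R x y}"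

definition stable :: "'w \<Rightarrow> bool" where
  "stable x \<longleftrightarrow> (\<forall>y. R x y \<longrightarrow> fut y = fut x \<longrightarrow> prof y = prof x)"

lemma ty_mem: "A \<in> \<Sigma> \<Longrightarrow> A \<in> ty x \<longleftrightarrow> x \<in> A"
  by (simp add: ty_def)

lemma fin_def_ty: "fin_def ty"
  unfolding fin_def_def
proof (intro conjI allI)
  have "range ty \<subseteq> Pow \<Sigma>" by (auto simp: ty_def)
  then show "finite (range ty)" using fin_\<Sigma> by (auto intro: finite_subset)
  fix t
  show "{x. ty x = t} \<in> D"
  proof (cases "t \<subseteq> \<Sigma>")
    case True
    then have "{x. ty x = t} = (\<Inter>A\<in>\<Sigma>. if A \<in> t then A else - A)"
      by (auto simp: ty_def split: if_splits)
    also have "\<dots> \<in> D" using fin_\<Sigma> \<Sigma>_D by (intro D_INT) (auto intro: D_Compl)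
    finally show ?thesis .
  next
    case False
    then have "{x. ty x = t} = {}" by (auto simp: ty_def)
    then show ?thesis using D_empty by simp
  qed
qed

lemma fin_def_fut: "fin_def fut"
  unfolding fut_def by (rule fin_def_image[OF fin_def_ty])

lemma fin_def_prof: "fin_def prof"
  unfolding prof_def by (rule fin_def_image[OF fin_def_Pair[OF fin_def_ty fin_def_fut]])

lemma finite_fut: "finite (fut x)"
  using fin_def_ty unfolding fut_def fin_def_def by (auto intro: finite_subset[of _ "range ty"])

lemma finite_prof: "finite (prof x)"
  using fin_def_Pair[OF fin_def_ty fin_def_fut]
  unfolding prof_def fin_def_def by (auto intro: finite_subset[of _ "range (\<lambda>y. (ty y, fut y))"])

lemma fst_prof: "fst ` prof x = fut x"
  by (simp add: prof_def fut_def image_image)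

lemma fut_antimono: "R x y \<Longrightarrow> fut y \<subseteq> fut x"
  unfolding fut_def by (intro image_mono Collect_mono impI) (rule R_trans)

lemma prof_antimono: "R x y \<Longrightarrow> prof y \<subseteq> prof x"
  unfolding prof_def by (intro image_mono Collect_mono impI) (rule R_trans)

lemma stable_prof: "stable x \<Longrightarrow> R x y \<Longrightarrow> fut y = fut x \<Longrightarrow> prof y = prof x"
  unfolding stable_def by blast

lemma stable_step:
  assumes "stable x" "R x y" "fut y = fut x" shows "stable y"
  unfolding stable_def
proof (intro allI impI)
  fix z assume "R y z" "fut z = fut y"
  then have "prof z = prof x" using stable_prof[OF assms(1)] R_trans[OF assms(2)] assms(3) by simp
  then show "prof z = prof y" using stable_prof[OF assms] by simp
qed

text \<open>Two minimisations: \<open>a\<close> above \<open>y\<close> with the type of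
  \<open>y\<close> and least future, then \<open>b\<close> above \<open>a\<close> with the same
  future and least profile. The future of \<open>b\<close> still contains the type of
  \<open>a\<close>, so some \<open>c\<close> above \<open>b\<close> has that type; minimality of
  \<open>a\<close> preserves its future, and minimality of \<open>b\<close> makes it stable.\<close>

lemma stable_above:
  obtains z where "R y z" "ty z = ty y" "stable z"
proof -
  define P where "P z \<longleftrightarrow> R y z \<and> ty z = ty y" for z
  have "P y" by (simp add: P_def R_refl)
  then obtain a where a: "P a" "\<And>z. P z \<Longrightarrow> card (fut a) \<le> card (fut z)"
    using ex_has_least_nat[of P y "\<lambda>z. card (fut z)"] by auto
  define Q where "Q z \<longleftrightarrow> R a z \<and> fut z = fut a" for z
  have "Q a" by (simp add: Q_def R_refl)
  then obtain b where b: "Q b" "\<And>z. Q z \<Longrightarrow> card (prof b) \<le> card (prof z)"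
    using ex_has_least_nat[of Q a "\<lambda>z. card (prof z)"] by auto
  have "ty a \<in> fut b" using b(1) R_refl by (auto simp: Q_def fut_def)
  then obtain c where c: "R b c" "ty c = ty a" by (auto simp: fut_def)
  have Pc: "P c"
    using a(1) b(1) c R_trans[OF _ R_trans[OF _ c(1)]] unfolding P_def Q_def by metis
  have "fut c \<subseteq> fut a" using fut_antimono[OF c(1)] b(1) by (simp add: Q_def)
  then have fc: "fut c = fut a" using a(2)[OF Pc] finite_fut card_seteq by blast
  have "prof d = prof c" if d: "R c d" "fut d = fut c" for d
  proof -
    have "Q d" using b(1) R_trans[OF _ R_trans[OF c(1) d(1)]] d(2) fc unfolding Q_def by metis
    moreover have "prof c \<subseteq> prof b" "prof d \<subseteq> prof c" using prof_antimono c d by auto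
    moreover have "Q c" using b(1) R_trans[OF _ c(1)] fc unfolding Q_def by metis
    ultimately have "prof c = prof b" "prof d = prof b"
      using b(2)[of c] b(2)[of d] card_seteq[OF finite_prof[of b]] by blast+
    then show ?thesis by simp
  qed
  then have "stable c" by (simp add: stable_def)
  then show ?thesis using that[of c] Pc by (auto simp: P_def)
qed

type_synonym (in -) 'w state = "('w set set \<times> 'w set set set) set \<times> 'w set set"

definition state :: "'w \<Rightarrow> 'w state" where
  "state x = (prof x, ty x)"

definition states :: "'w state set" where
  "states = state ` {x. stable x}"

text \<open>Given the inclusion, the second conjunct says that the future, the set of first
  components, shrinks properly. A merely smaller profile would not do: a world seen from a stable
  one with unchanged future has unchanged profile.\<close>

definition below :: "('w set set \<times> 'w set set set) set \<Rightarrow> ('w set set \<times> 'w set set set) set \<Rightarrow> bool" where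
  "below K K' \<longleftrightarrow> K' \<subseteq> K \<and> fst ` K' \<noteq> fst ` K"

definition le :: "'w state \<Rightarrow> 'w state \<Rightarrow> bool" where
  "le s s' \<longleftrightarrow> s' \<in> states \<and> (fst s' = fst s \<or> below (fst s) (fst s'))"

definition fbox :: "'w state set \<Rightarrow> 'w state set" where
  "fbox Z = {s. \<forall>s'. le s s' \<longrightarrow> s' \<in> Z}"

lemma mem_fbox: "s \<in> fbox Z \<longleftrightarrow> (\<forall>s'. le s s' \<longrightarrow> s' \<in> Z)"
  by (simp add: fbox_def)

lemma fbox_mono: "A \<subseteq> B \<Longrightarrow> fbox A \<subseteq> fbox B"
  unfolding fbox_def by blast

lemma finite_states: "finite states"
proof -
  have "states \<subseteq> range (\<lambda>x. (prof x, ty x))" by (auto simp: states_def state_def)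
  then show ?thesis
    using fin_def_Pair[OF fin_def_prof fin_def_ty] unfolding fin_def_def by (auto intro: finite_subset)
qed

lemma below_trans:
  assumes "below K K'" "below K' K''" shows "below K K''"
proof -
  have "K' \<subseteq> K" "K'' \<subseteq> K'" using assms by (simp_all add: below_def)
  moreover from this have "fst ` K' \<subseteq> fst ` K" "fst ` K'' \<subseteq> fst ` K'" by (simp_all add: image_mono)
  moreover have "fst ` K' \<noteq> fst ` K" using assms by (simp add: below_def)
  ultimately show ?thesis unfolding below_def by (metis subset_antisym subset_trans)
qed

lemma le_refl: "s \<in> states \<Longrightarrow> le s s"
  by (simp add: le_def)

lemma le_trans:
  assumes "le s t" "le t u" shows "le s u"
proof (cases "fst t = fst s \<or> fst u = fst t")
  case True
  then show ?thesis using assms unfolding le_def by metis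
next
  case False
  then have "below (fst s) (fst t)" "below (fst t) (fst u)" "u \<in> states"
    using assms by (simp_all add: le_def)
  then show ?thesis unfolding le_def using below_trans by blast
qed

lemma le_states: "le s t \<Longrightarrow> t \<in> states"
  by (simp add: le_def)

lemma state_in: "stable x \<Longrightarrow> state x \<in> states"
  by (simp add: states_def)

lemma below_prof:
  assumes "R x y" "fut y \<noteq> fut x" shows "below (prof x) (prof y)"
  using assms(2) prof_antimono[OF assms(1)] by (simp add: below_def fst_prof)

text \<open>With unchanged future \<open>y\<close> itself is stable and in the same cluster.
  Otherwise \<open>y\<close> may be unstable and is replaced by a stable world above it of the same
  type, whose future is smaller as well.\<close>

lemma state_above:
  assumes "stable x" "R x y"
  obtains z where "stable z" "ty z = ty y" "le (state x) (state z)"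
    "fut y \<noteq> fut x \<Longrightarrow> below (prof x) (prof z)"
proof (cases "fut y = fut x")
  case True
  then have "stable y" "prof y = prof x"
    using stable_step[OF assms] stable_prof[OF assms] by auto
  then show ?thesis using that[of y] True by (auto simp: le_def state_def states_def)
next
  case False
  obtain z where z: "R y z" "ty z = ty y" "stable z" by (rule stable_above)
  have "fut z \<subset> fut x" using fut_antimono[OF assms(2)] fut_antimono[OF z(1)] False by auto
  then have "below (prof x) (prof z)" using below_prof[OF R_trans[OF assms(2) z(1)]] by blast
  then show ?thesis using that[of z] z by (auto simp: le_def state_def states_def)
qed

text \<open>This is what the pairs in profiles are for: the pair of \<open>z\<close> lies in the
  profile of \<open>x\<close>, so \<open>x\<close> sees a world with the type and future of
  \<open>z\<close>, though perhaps not its profile. Within one cluster, stability of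
  \<open>x\<close> recovers the profile too.\<close>

lemma state_above_converse:
  assumes x: "stable x" and z: "stable z" and le: "le (state x) (state z)"
  obtains y where "R x y" "ty y = ty z" "fut y = fut z"
    "prof z = prof x \<Longrightarrow> prof y = prof x \<and> stable y"
proof -
  have "prof z \<subseteq> prof x" using le by (auto simp: le_def state_def below_def)
  moreover have "(ty z, fut z) \<in> prof z" using R_refl by (auto simp: prof_def)
  ultimately obtain y where y: "R x y" "ty y = ty z" "fut y = fut z" by (auto simp: prof_def)
  have "prof y = prof x \<and> stable y" if "prof z = prof x"
  proof -
    have "fut z = fut x" using that fst_prof by metis
    then show ?thesis using stable_prof[OF x y(1)] stable_step[OF x y(1)] y by simp
  qed
  then show ?thesis using that y by blast
qed

end

section \<open>Truth in the finite quotient\<close>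

context general_frame
begin

abbreviation val :: "'v mfm \<Rightarrow> ('v \<Rightarrow> 'w set) \<Rightarrow> 'w set" where
  "val \<equiv> gtruth box D"

text \<open>Demanded for all definable assignments, not for a single one, because assignments get
  changed at bound atoms.\<close>

primrec mdefinable :: "'v mfm \<Rightarrow> bool" where
  "mdefinable (MAtom p) = True"
| "mdefinable MTop = True"
| "mdefinable (MNeg a) = mdefinable a"
| "mdefinable (MAnd a b) = (mdefinable a \<and> mdefinable b)"
| "mdefinable (MBox a) = mdefinable a"
| "mdefinable (MMu q a) = (mdefinable a \<and> (\<forall>h. (\<forall>p. h p \<in> D) \<longrightarrow> val (MMu q a) h \<in> D))"

lemma val_D: "mdefinable a \<Longrightarrow> (\<And>p. h p \<in> D) \<Longrightarrow> val a h \<in> D"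
  by (induction a) (simp_all add: D_UNIV D_Compl D_Int D_box[folded box_def])

lemma upd_D: "(\<And>p. h p \<in> D) \<Longrightarrow> S \<in> D \<Longrightarrow> (h(q := S)) p \<in> D"
  by (simp add: fun_upd_apply)

text \<open>The values of all subformulas, bound atoms being interpreted by the fixed points they
  range over.\<close>

primrec vals :: "'v mfm \<Rightarrow> ('v \<Rightarrow> 'w set) \<Rightarrow> 'w set set" where
  "vals (MAtom p) k = {k p}"
| "vals MTop k = {UNIV}"
| "vals (MNeg a) k = insert (val (MNeg a) k) (vals a k)"
| "vals (MAnd a b) k = insert (val (MAnd a b) k) (vals a k \<union> vals b k)"
| "vals (MBox a) k = insert (val (MBox a) k) (vals a k)"
| "vals (MMu q a) k = insert (val (MMu q a) k) (vals a (k(q := val (MMu q a) k)))"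

lemma val_in_vals: "val a k \<in> vals a k"
  by (cases a) simp_all

lemma atom_in_vals: "p \<in> mfree a \<Longrightarrow> k p \<in> vals a k"
proof (induction a arbitrary: k)
  case (MMu q a)
  then show ?case using MMu.IH[of "k(q := val (MMu q a) k)"] by (simp del: gtruth.simps)
qed auto

lemma finite_vals: "finite (vals a k)"
  by (induction a arbitrary: k) simp_all

lemma vals_D: "mdefinable a \<Longrightarrow> (\<And>p. k p \<in> D) \<Longrightarrow> vals a k \<subseteq> D"
proof (induction a arbitrary: k)
  case (MMu q a)
  have A: "val (MMu q a) k \<in> D" by (rule val_D) (rule MMu.prems)+
  have "vals a (k(q := val (MMu q a) k)) \<subseteq> D"
    using MMu.prems A by (intro MMu.IH) (simp_all add: upd_D del: gtruth.simps)
  then show ?case using A by (simp del: gtruth.simps)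
next
  case (MNeg a)
  then show ?case using val_D[of "MNeg a" k] by simp
next
  case (MAnd a b)
  then show ?case using val_D[of "MAnd a b" k] by simp
next
  case (MBox a)
  then show ?case using val_D[of "MBox a" k] by simp
qed (simp_all add: D_UNIV)

text \<open>Truth at a world depends only on what the world sees. For \<open>MMu\<close> the
  comparison needs a pre-fixed point lying in \<open>D\<close>, so the two fixed points are combined
  by Boolean operations with the definable set \<open>V\<close>.\<close>

lemma val_local:
  assumes V: "V \<in> D" "\<And>x y. x \<in> V \<Longrightarrow> R x y \<Longrightarrow> y \<in> V"
  shows "mu_formula a \<Longrightarrow> mdefinable a \<Longrightarrow> (\<And>p. h p \<in> D) \<Longrightarrow> (\<And>p. k p \<in> D) \<Longrightarrow>
    (\<And>p x. p \<in> mfree a \<Longrightarrow> x \<in> V \<Longrightarrow> x \<in> h p \<longleftrightarrow> x \<in> k p) \<Longrightarrow>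
    x \<in> V \<Longrightarrow> x \<in> val a h \<longleftrightarrow> x \<in> val a k"
proof (induction a arbitrary: h k x)
  case (MNeg a)
  then show ?case by simp
next
  case (MAnd a b)
  have "x \<in> val a h \<longleftrightarrow> x \<in> val a k" by (rule MAnd.IH(1)) (use MAnd.prems in auto)
  moreover have "x \<in> val b h \<longleftrightarrow> x \<in> val b k" by (rule MAnd.IH(2)) (use MAnd.prems in auto)
  ultimately show ?case by simp
next
  case (MBox a)
  have "y \<in> val a h \<longleftrightarrow> y \<in> val a k" if "R x y" for y
    using MBox.prems V(2)[OF _ that] by (intro MBox.IH) auto
  then show ?case by (auto simp: mem_box)
next
  case (MMu q a)
  have half: "val (MMu q a) h \<inter> V \<subseteq> val (MMu q a) k"
    if hD: "\<And>p. h p \<in> D" and kD: "\<And>p. k p \<in> D"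
      and eq: "\<And>p x. p \<in> mfree (MMu q a) \<Longrightarrow> x \<in> V \<Longrightarrow> x \<in> h p \<longleftrightarrow> x \<in> k p" for h k
  proof -
    define A where "A = val (MMu q a) h"
    define B where "B = val (MMu q a) k"
    \<comment> \<open>This is \<open>A \<inter> B\<close> inside \<open>V\<close> and
      \<open>A\<close> outside. Inside \<open>V\<close> the induction hypothesis trades it for
      \<open>A \<inter> B\<close> under \<open>k\<close>, and monotonicity leads into
      \<open>B\<close>; so \<open>S\<close> is pre-fixed for \<open>h\<close>, which forces
      \<open>A \<subseteq> S\<close>.\<close>
    define S where "S = A \<inter> (B \<union> - V)"
    have AD: "A \<in> D" and BD: "B \<in> D" unfolding A_def B_def
      using MMu.prems hD kD by (auto intro: val_D simp del: gtruth.simps)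
    have SD: "S \<in> D" unfolding S_def by (intro D_Int D_Un D_Compl AD BD V)
    have mono: "val a (h(q := X)) \<subseteq> val a (h(q := Y))" if "X \<subseteq> Y" for h X Y
      using MMu.prems that by (intro gtruth_mono(1) box_mono) auto
    have pre: "val a (h(q := A)) \<subseteq> A" "val a (k(q := B)) \<subseteq> B"
      unfolding A_def B_def by (rule gtruth_MMu_prefixed; fact box_mono MMu.prems)+
    have "val a (h(q := S)) \<subseteq> A" using mono[of S A h] pre(1) by (auto simp: S_def)
    moreover have "x \<in> B" if x: "x \<in> V" "x \<in> val a (h(q := S))" for x
    proof -
      have "x \<in> val a (h(q := S)) \<longleftrightarrow> x \<in> val a (k(q := A \<inter> B))"
      proof (rule MMu.IH)
        show "mu_formula a" "mdefinable a" using MMu.prems by auto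
        show "(h(q := S)) p \<in> D" "(k(q := A \<inter> B)) p \<in> D" for p
          using hD kD SD AD BD by (simp_all add: upd_D D_Int)
        show "x \<in> (h(q := S)) p \<longleftrightarrow> x \<in> (k(q := A \<inter> B)) p" if "p \<in> mfree a" "x \<in> V" for p x
          using that eq[of p x] by (cases "p = q") (auto simp: S_def)
      qed fact
      then have "x \<in> val a (k(q := A \<inter> B))" using x by simp
      then show ?thesis using mono[of "A \<inter> B" B k] pre(2) by auto
    qed
    ultimately have "val a (h(q := S)) \<subseteq> S" by (auto simp: S_def)
    then have "A \<subseteq> S" unfolding A_def by (rule gtruth_MMu_lower[OF SD])
    then show ?thesis unfolding A_def[symmetric] B_def[symmetric] by (auto simp: S_def)
  qed
  have "val (MMu q a) h \<inter> V \<subseteq> val (MMu q a) k"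
    by (rule half) (use MMu.prems in auto)
  moreover have "val (MMu q a) k \<inter> V \<subseteq> val (MMu q a) h"
    by (rule half) (use MMu.prems in auto)
  ultimately show ?case using MMu.prems by blast
qed auto

end

section \<open>Transfer of fixed points to the finite quotient\<close>

context filtered_frame
begin

definition cluster :: "('w set set \<times> 'w set set set) set \<Rightarrow> 'w set" where
  "cluster K = {x. prof x = K \<and> stable x}"

text \<open>An up-closed definable set disjoint from the cluster. By stability, a world of the
  cluster sees only worlds of these two sets.\<close>

definition strict :: "('w set set \<times> 'w set set set) set \<Rightarrow> 'w set" where
  "strict K = {x. fut x \<subset> fst ` K}"

text \<open>Stability can be read off a finite colour: future, profile, and the set of pairs
  (future, profile) seen.\<close>

lemma fin_def_stable: "{x. P (prof x) (ty x) (stable x)} \<in> D"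
proof -
  let ?c = "\<lambda>x. (ty x, fut x, prof x, (\<lambda>y. (fut y, prof y)) ` {y. R x y})"
  have "fin_def ?c"
    by (intro fin_def_Pair fin_def_image fin_def_ty fin_def_fut fin_def_prof)
  from fin_def_Collect[OF this, of "\<lambda>(t, F, K, I). P K t (\<forall>(F', K') \<in> I. F' = F \<longrightarrow> K' = K)"]
  show ?thesis by (simp add: stable_def)
qed

lemma cluster_D: "{x \<in> cluster K. P (ty x)} \<in> D"
  using fin_def_stable[of "\<lambda>K' t b. (K' = K \<and> b) \<and> P t"] by (simp add: cluster_def)

lemma strict_D: "strict K \<in> D"
  unfolding strict_def by (rule fin_def_Collect[OF fin_def_fut])

lemma strict_up: "x \<in> strict K \<Longrightarrow> R x y \<Longrightarrow> y \<in> strict K"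
  using fut_antimono[of x y] unfolding strict_def by blast

lemma cluster_strict: "x \<in> cluster K \<Longrightarrow> x \<notin> strict K"
  using fst_prof[of x] unfolding cluster_def strict_def by blast

lemma ty_eq_mem: "A \<in> \<Sigma> \<Longrightarrow> ty x = ty y \<Longrightarrow> x \<in> A \<longleftrightarrow> y \<in> A"
  using ty_mem[of A x] ty_mem[of A y] by simp

lemma not_below_refl: "\<not> below K K"
  by (simp add: below_def)

lemma below_card: "finite K \<Longrightarrow> below K K' \<Longrightarrow> card K' < card K"
  unfolding below_def by (intro psubset_card_mono) blast+

abbreviation fval :: "'v mfm \<Rightarrow> ('v \<Rightarrow> 'w state set) \<Rightarrow> 'w state set" where
  "fval \<equiv> gtruth fbox UNIV"

text \<open>On a cluster \<open>K\<close> the truth set of \<open>a\<close> is a union of types, and these are computed by the finite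
  model. The assignment \<open>h\<close> may differ from the closure assignment \<open>k\<close> on the cluster, where it
  must be a union of types; above the cluster all truth values are already settled by \<open>k\<close>.\<close>

lemma cluster_truth:
  fixes a :: "'v mfm"
  assumes "finite K" "mu_formula a" "mdefinable a" "\<And>p. h p \<in> D" "\<And>p. k p \<in> D" "vals a k \<subseteq> \<Sigma>"
    "\<And>p x. p \<in> mfree a \<Longrightarrow> x \<in> cluster K \<Longrightarrow> x \<in> h p \<longleftrightarrow> state x \<in> g p"
    "\<And>p x. p \<in> mfree a \<Longrightarrow> x \<in> strict K \<Longrightarrow> x \<in> h p \<longleftrightarrow> x \<in> k p"
    "\<And>p x. p \<in> mfree a \<Longrightarrow> stable x \<Longrightarrow> below K (prof x) \<Longrightarrow> state x \<in> g p \<longleftrightarrow> x \<in> k p"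
    "x \<in> cluster K"
  shows "x \<in> val a h \<longleftrightarrow> state x \<in> fval a g"
  using assms
proof (induction "card K" arbitrary: K a h k g x rule: less_induct)
  case outer: less
  note finK = outer.prems(1)
  \<comment> \<open>The profile of \<open>z\<close> is smaller than \<open>K\<close>, so the outer
    induction applies, with \<open>k\<close> also in the role of \<open>h\<close>.\<close>
  have above: "state z \<in> fval a g \<longleftrightarrow> z \<in> val a k"
    if "mu_formula a" "mdefinable a" "\<And>p. k p \<in> D" "vals a k \<subseteq> \<Sigma>"
      and g: "\<And>p x. p \<in> mfree a \<Longrightarrow> stable x \<Longrightarrow> below K (prof x) \<Longrightarrow> state x \<in> g p \<longleftrightarrow> x \<in> k p"
      and z: "stable z" "below K (prof z)" for a :: "'v mfm" and k g z
  proof -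
    have "z \<in> val a k \<longleftrightarrow> state z \<in> fval a g"
    proof (rule outer.hyps[of "prof z"])
      show "card (prof z) < card K" by (rule below_card[OF finK z(2)])
      show "finite (prof z)" by (rule finite_prof)
      show "x \<in> k p \<longleftrightarrow> state x \<in> g p" if "p \<in> mfree a" "x \<in> cluster (prof z)" for p x
        using g[of p x] that z by (auto simp: cluster_def)
      show "state x \<in> g p \<longleftrightarrow> x \<in> k p" if "p \<in> mfree a" "stable x" "below (prof z) (prof x)" for p x
        using g[of p x] that z below_trans by blast
      show "z \<in> cluster (prof z)" using z by (simp add: cluster_def)
    qed (use that in auto)
    then show ?thesis by simp
  qed
  note local = val_local[OF strict_D[of K] strict_up]
  from outer.prems(2-) show ?case
  proof (induction a arbitrary: h k g x)
    case (MAtom p)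
    then show ?case by simp
  next
    case MTop
    then show ?case by simp
  next
    case (MNeg a)
    have "x \<in> val a h \<longleftrightarrow> state x \<in> fval a g"
      by (rule MNeg.IH[OF _ _ _ MNeg.prems(4)]) (use MNeg.prems in \<open>auto simp del: gtruth.simps\<close>)
    then show ?case by simp
  next
    case (MAnd a b)
    have "x \<in> val a h \<longleftrightarrow> state x \<in> fval a g"
      by (rule MAnd.IH(1)[OF _ _ _ MAnd.prems(4)]) (use MAnd.prems in \<open>auto simp del: gtruth.simps\<close>)
    moreover have "x \<in> val b h \<longleftrightarrow> state x \<in> fval b g"
      by (rule MAnd.IH(2)[OF _ _ _ MAnd.prems(4)]) (use MAnd.prems in \<open>auto simp del: gtruth.simps\<close>)
    ultimately show ?case by simp
  next
    case (MBox a)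
    have prems: "mu_formula a" "mdefinable a" "vals a k \<subseteq> \<Sigma>" "mfree (MBox a) = mfree a"
      using MBox.prems by auto
    have in_cluster: "y \<in> val a h \<longleftrightarrow> state y \<in> fval a g" if "y \<in> cluster K" for y
      by (rule MBox.IH[OF _ _ _ MBox.prems(4)]) (use MBox.prems that in \<open>auto simp del: gtruth.simps\<close>)
    have in_strict: "y \<in> val a h \<longleftrightarrow> y \<in> val a k" if "y \<in> strict K" for y
      by (rule local) (use MBox.prems that in auto)
    have in_above: "state z \<in> fval a g \<longleftrightarrow> z \<in> val a k" if "stable z" "below K (prof z)" for z
      by (rule above) (use MBox.prems that in auto)
    \<comment> \<open>Membership in \<open>\<Sigma>\<close> carries truth between a world of
      \<open>strict K\<close>, which may be unstable, and a stable world of the same type.\<close>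
    have \<Sigma>: "val a k \<in> \<Sigma>" using prems val_in_vals by blast
    have x: "stable x" "prof x = K" "fut x = fst ` K"
      using MBox.prems(9) fst_prof[of x] by (simp_all add: cluster_def)
    show ?case
    proof
      assume L: "x \<in> val (MBox a) h"
      have "s' \<in> fval a g" if s': "le (state x) s'" for s'
      proof -
        obtain z where z: "stable z" "s' = state z" using s' by (auto simp: le_def states_def)
        obtain y where y: "R x y" "ty y = ty z" "fut y = fut z"
          "prof z = prof x \<Longrightarrow> prof y = prof x \<and> stable y"
          using state_above_converse[OF x(1) z(1)] s' z(2) by blast
        have yh: "y \<in> val a h" using L y by (simp add: mem_box)
        show ?thesis
        proof (cases "prof z = K")
          case True
          then have "y \<in> cluster K" "state y = state z"
            using y x by (auto simp: cluster_def state_def)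
          then show ?thesis using in_cluster yh z by simp
        next
          case False
          then have b: "below K (prof z)" using s' z x by (auto simp: le_def state_def)
          then have "y \<in> strict K" using y(3) fst_prof[of z] image_mono[of "prof z" K fst]
            by (auto simp: strict_def below_def)
          then have "z \<in> val a k" using in_strict yh ty_eq_mem[OF \<Sigma> y(2)] by blast
          then show ?thesis using in_above z b by simp
        qed
      qed
      then show "state x \<in> fval (MBox a) g" unfolding gtruth.simps mem_fbox by blast
    next
      assume "state x \<in> fval (MBox a) g"
      then have Rr: "s' \<in> fval a g" if "le (state x) s'" for s'
        using that unfolding gtruth.simps mem_fbox by blast
      have "y \<in> val a h" if y: "R x y" for y
      proof (cases "fut y = fut x")
        case True
        then have "y \<in> cluster K" "le (state x) (state y)"
          using stable_step[OF x(1) y] stable_prof[OF x(1) y] x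
          by (auto simp: cluster_def le_def state_def states_def)
        then show ?thesis using in_cluster Rr by blast
      next
        case False
        obtain z where z: "stable z" "ty z = ty y" "le (state x) (state z)" "below K (prof z)"
          using state_above[OF x(1) y] False x(2) by metis
        have "state z \<in> fval a g" using Rr z by blast
        then have "z \<in> val a k" using in_above z by blast
        then have "y \<in> val a k" using ty_eq_mem[OF \<Sigma> z(2)] by blast
        moreover have "y \<in> strict K" using False fut_antimono[OF y] x by (auto simp: strict_def)
        ultimately show ?thesis using in_strict by blast
      qed
      then show "x \<in> val (MBox a) h" by (simp add: mem_box)
    qed
  next
    case (MMu q a)
    define A where "A = val (MMu q a) h"
    define B where "B = fval (MMu q a) g"
    \<comment> \<open>The closure value of the fixed point: \<open>A\<close> agrees with it on
      \<open>strict K\<close>, and \<open>B\<close> on the states above the cluster, so that only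
      the cluster is left to compare.\<close>
    define L where "L = val (MMu q a) k"
    have mu: "mu_formula (MMu q a)" "mu_formula a" "mpositive q a" "mdefinable (MMu q a)" "mdefinable a"
      using MMu.prems by auto
    have AD: "A \<in> D" and LD: "L \<in> D"
      unfolding A_def L_def by (rule val_D; use MMu.prems in blast)+
    have L\<Sigma>: "L \<in> \<Sigma>" and vals: "vals a (k(q := L)) \<subseteq> \<Sigma>"
      using MMu.prems(5) unfolding L_def by (auto simp del: gtruth.simps)
    have L_fixed: "val a (k(q := L)) = L"
      unfolding L_def using mu MMu.prems LD[unfolded L_def]
      by (intro gtruth_MMu_fixed box_mono val_D upd_D) auto
    have A_strict: "y \<in> A \<longleftrightarrow> y \<in> L" if "y \<in> strict K" for y
      unfolding A_def L_def by (rule local) (use MMu.prems that in auto)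
    have B_above: "state z \<in> B \<longleftrightarrow> z \<in> L" if "stable z" "below K (prof z)" for z
      unfolding B_def L_def by (rule above) (use MMu.prems that in auto)
    have kD: "(k(q := L)) p \<in> D" for p using MMu.prems LD by (simp add: upd_D)
    have IH: "y \<in> val a (h(q := S)) \<longleftrightarrow> state y \<in> fval a (g(q := G))"
      if S: "S \<in> D" and c: "\<And>y. y \<in> cluster K \<Longrightarrow> y \<in> S \<longleftrightarrow> state y \<in> G"
        and s: "\<And>y. y \<in> strict K \<Longrightarrow> y \<in> S \<longleftrightarrow> y \<in> L"
        and ab: "\<And>z. stable z \<Longrightarrow> below K (prof z) \<Longrightarrow> state z \<in> G \<longleftrightarrow> z \<in> L"
        and y: "y \<in> cluster K" for S G y
    proof (rule MMu.IH[OF _ _ _ kD])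
      show "(h(q := S)) p \<in> D" for p
        using MMu.prems S by (simp add: upd_D)
      show "x \<in> (h(q := S)) p \<longleftrightarrow> state x \<in> (g(q := G)) p" if "p \<in> mfree a" "x \<in> cluster K" for p x
        using MMu.prems(6)[of p x] c that by (cases "p = q") auto
      show "x \<in> (h(q := S)) p \<longleftrightarrow> x \<in> (k(q := L)) p" if "p \<in> mfree a" "x \<in> strict K" for p x
        using MMu.prems(7)[of p x] s that by (cases "p = q") auto
      show "state x \<in> (g(q := G)) p \<longleftrightarrow> x \<in> (k(q := L)) p"
        if "p \<in> mfree a" "stable x" "below K (prof x)" for p x
        using MMu.prems(8)[of p x] ab that by (cases "p = q") auto
    qed (use mu vals y in auto)
    show ?case
    proof
      assume "x \<in> val (MMu q a) h"
      \<comment> \<open>A competitor for \<open>A\<close>: the preimage of \<open>B\<close> on the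
        cluster, \<open>L\<close> on \<open>strict K\<close>, and everything elsewhere, where being
        pre-fixed is then automatic. It is definable because its part in the cluster is a union of
        types.\<close>
      define S where "S = {y \<in> cluster K. (K, ty y) \<in> B} \<union> (strict K \<inter> L) \<union> - ({y \<in> cluster K. True} \<union> strict K)"
      have SD: "S \<in> D" unfolding S_def
        by (intro D_Un D_Int D_Compl cluster_D strict_D LD)
      have S_c: "y \<in> S \<longleftrightarrow> state y \<in> B" if "y \<in> cluster K" for y
        using that cluster_strict[OF that] by (auto simp: S_def cluster_def state_def)
      have S_s: "y \<in> S \<longleftrightarrow> y \<in> L" if "y \<in> strict K" for y
        using that cluster_strict[of y K] by (auto simp: S_def)
      have "val a (h(q := S)) \<subseteq> S"
      proof
        fix y assume y: "y \<in> val a (h(q := S))"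
        consider "y \<in> cluster K" | "y \<in> strict K" | "y \<notin> cluster K \<union> strict K" by blast
        then show "y \<in> S"
        proof cases
          case 1
          then have "state y \<in> fval a (g(q := B))" using IH[OF SD S_c S_s B_above] y by blast
          moreover have "fval a (g(q := B)) \<subseteq> B"
            unfolding B_def by (rule gtruth_MMu_prefixed[OF fbox_mono mu(1)])
          ultimately show ?thesis using S_c 1 by blast
        next
          case 2
          have "y \<in> val a (h(q := S)) \<longleftrightarrow> y \<in> val a (k(q := L))"
          proof (rule local)
            show "(h(q := S)) p \<in> D" "(k(q := L)) p \<in> D" for p
              using MMu.prems SD LD by (simp_all add: upd_D)
            show "x \<in> (h(q := S)) p \<longleftrightarrow> x \<in> (k(q := L)) p" if "p \<in> mfree a" "x \<in> strict K" for p x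
              using MMu.prems(7)[of p x] S_s that by (cases "p = q") auto
          qed (use mu 2 in auto)
          then show ?thesis using L_fixed S_s 2 y by blast
        next
          case 3
          then show ?thesis by (simp add: S_def)
        qed
      qed
      then have "A \<subseteq> S" unfolding A_def by (rule gtruth_MMu_lower[OF SD])
      then show "state x \<in> fval (MMu q a) g"
        using \<open>x \<in> val (MMu q a) h\<close> S_c MMu.prems(9) unfolding A_def B_def by blast
    next
      assume "state x \<in> fval (MMu q a) g"
      \<comment> \<open>A competitor for \<open>B\<close>. It is not yet known that \<open>A\<close>
        is a union of types on the cluster, so \<open>G\<close> admits only those states of the
        cluster all of whose worlds lie in \<open>A\<close>. The matching \<open>S\<close> is
        definable and contained in \<open>A\<close>, so monotonicity makes up for the worlds of
        \<open>A\<close> left out.\<close>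
      define G where "G = {s. \<forall>y. stable y \<and> state y = s \<longrightarrow>
        (prof y = K \<longrightarrow> y \<in> A) \<and> (below K (prof y) \<longrightarrow> y \<in> L)}"
      define S where "S = {y \<in> cluster K. \<forall>y'\<in>cluster K. ty y' = ty y \<longrightarrow> y' \<in> A} \<union> (strict K \<inter> L)"
      have SD: "S \<in> D" unfolding S_def
        by (intro D_Un D_Int cluster_D strict_D LD)
      have SA: "S \<subseteq> A" using A_strict by (auto simp: S_def)
      have S_c: "y \<in> S \<longleftrightarrow> state y \<in> G" if "y \<in> cluster K" for y
        using that cluster_strict[OF that] not_below_refl
        by (auto simp: S_def G_def cluster_def state_def)
      have S_s: "y \<in> S \<longleftrightarrow> y \<in> L" if "y \<in> strict K" for y
        using that cluster_strict[of y K] by (auto simp: S_def)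
      have G_above: "state z \<in> G \<longleftrightarrow> z \<in> L" if "stable z" "below K (prof z)" for z
      proof -
        have eq: "prof y = prof z" "ty y = ty z" if "state y = state z" for y
          using that by (simp_all add: state_def)
        have "prof z \<noteq> K" using that(2) not_below_refl by blast
        then have "state z \<in> G \<longleftrightarrow> (\<forall>y. stable y \<and> state y = state z \<longrightarrow> y \<in> L)"
          unfolding G_def mem_Collect_eq using eq(1) that(2) by metis
        then show ?thesis using eq(2) ty_eq_mem[OF L\<Sigma>] that(1) by blast
      qed
      have "fval a (g(q := G)) \<subseteq> G"
      proof
        fix s assume s: "s \<in> fval a (g(q := G))"
        have "y \<in> A" if "stable y" "state y = s" "prof y = K" for y
        proof -
          have y: "y \<in> cluster K" using that by (simp add: cluster_def)
          have "y \<in> val a (h(q := S))" using IH[OF SD S_c S_s G_above y] s that by simp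
          moreover have "val a (h(q := S)) \<subseteq> val a (h(q := A))"
            using mu SA by (intro gtruth_mono(1) box_mono)
          moreover have "val a (h(q := A)) \<subseteq> A"
            unfolding A_def by (rule gtruth_MMu_prefixed[OF box_mono mu(1)])
          ultimately show ?thesis by blast
        qed
        moreover have "y \<in> L" if y: "stable y" "state y = s" "below K (prof y)" for y
        proof -
          have "state y \<in> fval a (g(q := G)) \<longleftrightarrow> y \<in> val a (k(q := L))"
          proof (rule above)
            show "(k(q := L)) p \<in> D" for p using MMu.prems LD by (simp add: upd_D)
            show "state x \<in> (g(q := G)) p \<longleftrightarrow> x \<in> (k(q := L)) p"
              if "p \<in> mfree a" "stable x" "below K (prof x)" for p x
              using MMu.prems(8)[of p x] G_above that by (cases "p = q") auto
          qed (use mu vals y in auto)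
          then show ?thesis using s y L_fixed by simp
        qed
        ultimately show "s \<in> G" by (auto simp: G_def)
      qed
      then have "B \<subseteq> G" unfolding B_def by (rule gtruth_MMu_lower[OF UNIV_I])
      then have "state x \<in> G" using \<open>state x \<in> fval (MMu q a) g\<close> unfolding B_def by blast
      then show "x \<in> val (MMu q a) h"
        using MMu.prems(9) unfolding A_def[symmetric] by (simp add: G_def cluster_def)
    qed
  qed
qed

theorem state_truth:
  assumes "mu_formula a" "mdefinable a" "\<And>p. k p \<in> D" "vals a k \<subseteq> \<Sigma>" "stable x"
  shows "state x \<in> fval a (\<lambda>p. {state z | z. stable z \<and> z \<in> k p}) \<longleftrightarrow> x \<in> val a k"
proof -
  have g: "state x \<in> {state z | z. stable z \<and> z \<in> k p} \<longleftrightarrow> x \<in> k p" if "stable x" "p \<in> mfree a" for x p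
  proof -
    have "k p \<in> \<Sigma>" using atom_in_vals[OF that(2)] assms(4) by blast
    moreover have "ty z = ty x" if "state x = state z" for z using that by (simp add: state_def)
    ultimately show ?thesis using that(1) ty_eq_mem[of "k p"] by blast
  qed
  show ?thesis
    by (rule cluster_truth[of "prof x" a k k, symmetric]) (use assms g finite_prof in \<open>auto simp: cluster_def\<close>)
qed

end

section \<open>Transfer of tangles to the finite quotient\<close>

primrec tvals :: "('v tfm \<Rightarrow> 'w set) \<Rightarrow> 'v tfm \<Rightarrow> 'w set set" where
  "tvals v (TAtom p) = {v (TAtom p)}"
| "tvals v TTop = {v TTop}"
| "tvals v (TNeg a) = insert (v (TNeg a)) (tvals v a)"
| "tvals v (TAnd a b) = insert (v (TAnd a b)) (tvals v a \<union> tvals v b)"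
| "tvals v (TBox a) = insert (v (TBox a)) (tvals v a)"
| "tvals v (TTangle G) = insert (v (TTangle G)) (\<Union>(fset (tvals v |`| G)))"

lemma val_in_tvals: "v a \<in> tvals v a"
  by (cases a) simp_all

lemma finite_tvals: "finite (tvals v a)"
  by (induction a) auto

context general_frame
begin

text \<open>A tangle value need only be the largest tangle among the sets in \<open>D\<close>.\<close>

definition tangle_valuation :: "('v tfm \<Rightarrow> 'w set) \<Rightarrow> bool" where
  "tangle_valuation v \<longleftrightarrow> (\<forall>a. tangle_formula a \<longrightarrow> v a \<in> D) \<and> v TTop = UNIV \<and>
    (\<forall>a. tangle_formula a \<longrightarrow> v (TNeg a) = - v a) \<and>
    (\<forall>a b. tangle_formula a \<longrightarrow> tangle_formula b \<longrightarrow> v (TAnd a b) = v a \<inter> v b) \<and>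
    (\<forall>a. tangle_formula a \<longrightarrow> v (TBox a) = box (v a)) \<and>
    (\<forall>G g. tangle_formula (TTangle G) \<longrightarrow> g \<in> fset G \<longrightarrow>
       v (TTangle G) \<subseteq> - box (- (v g \<inter> v (TTangle G)))) \<and>
    (\<forall>G P. tangle_formula (TTangle G) \<longrightarrow> P \<in> D \<longrightarrow>
       (\<forall>g\<in>fset G. P \<subseteq> - box (- (v g \<inter> P))) \<longrightarrow> P \<subseteq> v (TTangle G))"

lemma tangle_valuation_D: "tangle_valuation v \<Longrightarrow> tangle_formula a \<Longrightarrow> v a \<in> D"
  by (drule tangle_valuation_def[THEN iffD1, THEN conjunct1]) (rule mp, erule spec)

lemma tangle_valuation_fix:
  "tangle_valuation v \<Longrightarrow> tangle_formula (TTangle G) \<Longrightarrow> g \<in> fset G \<Longrightarrow>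
    v (TTangle G) \<subseteq> - box (- (v g \<inter> v (TTangle G)))"
  by (drule tangle_valuation_def[THEN iffD1, THEN conjunct2, THEN conjunct2, THEN conjunct2, THEN conjunct2, THEN conjunct2, THEN conjunct1])
    (drule spec2, drule mp, assumption, erule mp)

lemma tangle_valuation_ind:
  "tangle_valuation v \<Longrightarrow> tangle_formula (TTangle G) \<Longrightarrow> P \<in> D \<Longrightarrow>
    (\<And>g. g \<in> fset G \<Longrightarrow> P \<subseteq> - box (- (v g \<inter> P))) \<Longrightarrow> P \<subseteq> v (TTangle G)"
  by (drule tangle_valuation_def[THEN iffD1, THEN conjunct2, THEN conjunct2, THEN conjunct2, THEN conjunct2, THEN conjunct2, THEN conjunct2])
    (drule spec2, drule mp, assumption, drule mp, assumption, erule mp, rule ballI)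

lemma tvals_D: "tangle_valuation v \<Longrightarrow> tangle_formula a \<Longrightarrow> tvals v a \<subseteq> D"
proof (induction a)
  case (TTangle G)
  have "v (TTangle G) \<in> D" by (rule tangle_valuation_D) (rule TTangle.prems)+
  moreover have "tvals v g \<subseteq> D" if "g \<in> fset G" for g
    using TTangle.IH[OF that] TTangle.prems that by simp
  ultimately show ?case unfolding tvals.simps fset.set_map by blast
qed (simp_all add: tangle_valuation_D del: tangle_formula.simps(6), (simp_all add: tangle_valuation_def)?)

end

context filtered_frame
begin

lemma mem_dia: "x \<in> - box (- A) \<longleftrightarrow> (\<exists>y. R x y \<and> y \<in> A)"
  by (simp add: mem_box)

lemma mem_fdia: "s \<in> - fbox (- A) \<longleftrightarrow> (\<exists>s'. le s s' \<and> s' \<in> A)"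
  unfolding Compl_iff mem_fbox by blast

lemma state_truth_box:
  assumes "A \<in> \<Sigma>" and Z: "\<And>z. stable z \<Longrightarrow> state z \<in> Z \<longleftrightarrow> z \<in> A" and x: "stable x"
  shows "state x \<in> fbox Z \<longleftrightarrow> x \<in> box A"
proof
  assume L: "state x \<in> fbox Z"
  show "x \<in> box A"
    unfolding mem_box
  proof (intro allI impI)
    fix y assume "R x y"
    then obtain z where z: "stable z" "ty z = ty y" "le (state x) (state z)"
      using state_above[OF x] by metis
    then have "state z \<in> Z" using L unfolding mem_fbox by blast
    then show "y \<in> A" using Z[OF z(1)] ty_eq_mem[OF assms(1) z(2)] by blast
  qed
next
  assume Rr: "x \<in> box A"
  show "state x \<in> fbox Z"
    unfolding mem_fbox
  proof (intro allI impI)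
    fix s assume s: "le (state x) s"
    then obtain z where z: "stable z" "s = state z" by (auto simp: le_def states_def)
    then obtain y where "R x y" "ty y = ty z"
      using state_above_converse[OF x z(1)] s by metis
    then have "z \<in> A" using Rr ty_eq_mem[OF assms(1)] unfolding mem_box by blast
    then show "s \<in> Z" using Z z by simp
  qed
qed

text \<open>A tangle of the quotient may run through several clusters. Induction on the profile
  leads to a cluster that the tangle cannot leave; there its worlds form a union of types, hence a
  definable tangle. Closure of tangles under predecessors carries truth back down.\<close>

theorem tangle_state_truth:
  assumes v: "tangle_valuation v"
  shows "tangle_formula a \<Longrightarrow> tvals v a \<subseteq> \<Sigma> \<Longrightarrow> stable x \<Longrightarrow>
    state x \<in> gttruth fbox (\<lambda>p. {state z | z. stable z \<and> z \<in> v (TAtom p)}) a \<longleftrightarrow> x \<in> v a"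
proof (induction a arbitrary: x)
  case (TAtom p)
  then have \<Sigma>: "v (TAtom p) \<in> \<Sigma>" by simp
  have "ty z = ty x" if "state x = state z" for z using that by (simp add: state_def)
  then show ?case using TAtom.prems(3) ty_eq_mem[OF \<Sigma>] unfolding gttruth.simps by blast
next
  case TTop
  then show ?case using v by (simp add: tangle_valuation_def)
next
  case (TNeg a)
  then show ?case using v by (simp add: tangle_valuation_def)
next
  case (TAnd a b)
  then show ?case using v by (simp add: tangle_valuation_def)
next
  case (TBox a)
  have "v a \<in> \<Sigma>" using TBox.prems(2) val_in_tvals by auto
  moreover have "v (TBox a) = box (v a)" using v TBox.prems by (simp add: tangle_valuation_def)
  ultimately show ?case using state_truth_box[OF _ _ TBox.prems(3)] TBox.IH TBox.prems by simp
next
  case (TTangle G)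
  let ?g = "\<lambda>p. {state z | z. stable z \<and> z \<in> v (TAtom p)}"
  let ?T = "v (TTangle G)"
  have IH: "state z \<in> gttruth fbox ?g b \<longleftrightarrow> z \<in> v b" if "b \<in> fset G" "stable z" for b z
    using TTangle.IH[OF that(1)] TTangle.prems that by auto
  have \<Sigma>: "v b \<in> \<Sigma>" if "b \<in> fset G" for b
    using TTangle.prems(2) val_in_tvals[of v b] that by auto
  have T\<Sigma>: "?T \<in> \<Sigma>" using TTangle.prems(2) by simp
  have TD: "?T \<in> D" using T\<Sigma> \<Sigma>_D by blast
  have fix_T: "?T \<subseteq> - box (- (v b \<inter> ?T))" if "b \<in> fset G" for b
    by (rule tangle_valuation_fix[OF v TTangle.prems(1) that])
  have ind: "P \<subseteq> ?T" if "P \<in> D" "\<And>b. b \<in> fset G \<Longrightarrow> P \<subseteq> - box (- (v b \<inter> P))" for P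
    by (rule tangle_valuation_ind[OF v TTangle.prems(1) that])
  \<comment> \<open>By transitivity the diamond of a tangle is tangled again, and it is definable,
    so the largest definable tangle contains it.\<close>
  have T_down: "y \<in> ?T" if "R y y'" "y' \<in> ?T" for y y'
  proof -
    let ?P = "- box (- ?T)"
    have sub: "?P \<subseteq> ?T"
    proof (rule ind)
      show "?P \<in> D" using TD by (intro D_Compl D_box[folded box_def])
      fix b assume "b \<in> fset G"
      show "?P \<subseteq> - box (- (v b \<inter> ?P))"
      proof (rule subsetI)
        fix u assume "u \<in> ?P"
        then obtain w where w: "R u w" "w \<in> ?T" unfolding mem_dia by blast
        then obtain w' where w': "R w w'" "w' \<in> v b" "w' \<in> ?T"
          using fix_T[OF \<open>b \<in> fset G\<close>] unfolding subset_iff mem_dia by blast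
        then have "w' \<in> ?P" using R_refl unfolding mem_dia by blast
        then show "u \<in> - box (- (v b \<inter> ?P))"
          unfolding mem_dia[of u] using w' R_trans[OF w(1) w'(1)] by blast
      qed
    qed
    have "y \<in> ?P" unfolding mem_dia using that by blast
    then show ?thesis using sub by blast
  qed
  show ?case
  proof
    assume "state x \<in> gttruth fbox ?g (TTangle G)"
    then obtain S where S: "state x \<in> S"
      and S': "\<And>b. b \<in> fset G \<Longrightarrow> S \<subseteq> - fbox (- (gttruth fbox ?g b \<inter> S))" by auto
    have "y \<in> ?T" if "stable y" "state y \<in> S" for y
      using that
    proof (induction "card (prof y)" arbitrary: y rule: less_induct)
      case less
      show ?case
      proof (cases "\<exists>w. stable w \<and> state w \<in> S \<and> below (prof y) (prof w)")
        case True
        then obtain w where w: "stable w" "state w \<in> S" "below (prof y) (prof w)" by blast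
        have "w \<in> ?T" using less.hyps[OF below_card[OF finite_prof w(3)] w(1,2)] .
        moreover have "le (state y) (state w)"
          using w by (simp add: le_def states_def) (simp add: state_def)
        then obtain y' where "R y y'" "ty y' = ty w"
          using state_above_converse[OF less.prems(1) w(1)] by metis
        ultimately show ?thesis using T_down[of y y'] ty_eq_mem[OF T\<Sigma>, of y' w] by simp
      next
        case False
        \<comment> \<open>With no escape to a smaller profile, the successors provided by
          \<open>S'\<close> stay in the cluster, so this union of types is tangled in the frame
          itself.\<close>
        define P where "P = {u \<in> cluster (prof y). (prof y, ty u) \<in> S}"
        have "P \<subseteq> ?T"
        proof (rule ind)
          show "P \<in> D" unfolding P_def by (rule cluster_D)
          fix b assume b: "b \<in> fset G"
          show "P \<subseteq> - box (- (v b \<inter> P))"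
          proof
            fix u assume "u \<in> P"
            then have u: "stable u" "prof u = prof y" "state u \<in> S"
              by (simp_all add: P_def cluster_def state_def)
            then obtain s where s: "le (state u) s" "s \<in> gttruth fbox ?g b" "s \<in> S"
              using S'[OF b] unfolding subset_iff mem_fdia by blast
            then obtain w where w: "stable w" "s = state w" by (auto simp: le_def states_def)
            have pw: "prof w = prof u"
              using s(1,3) w False u(2) by (auto simp: le_def state_def)
            obtain y2 where y2: "R u y2" "ty y2 = ty w" "prof y2 = prof u" "stable y2"
              using state_above_converse[OF u(1) w(1)] s(1) w(2) pw by metis
            have "w \<in> v b" using IH[OF b w(1)] s(2) w(2) by simp
            then have "y2 \<in> v b" using ty_eq_mem[OF \<Sigma>[OF b] y2(2)] by simp
            moreover have "y2 \<in> P"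
              using y2 s(3) w pw u(2) by (simp add: P_def cluster_def state_def)
            ultimately show "u \<in> - box (- (v b \<inter> P))" using y2(1) unfolding mem_dia by blast
          qed
        qed
        then show ?thesis using less.prems by (auto simp: P_def cluster_def state_def)
      qed
    qed
    then show "x \<in> ?T" using S TTangle.prems by blast
  next
    assume x: "x \<in> ?T"
    define S where "S = {state w | w. stable w \<and> w \<in> ?T}"
    have "S \<subseteq> - fbox (- (gttruth fbox ?g b \<inter> S))" if b: "b \<in> fset G" for b
    proof
      fix s assume "s \<in> S"
      then obtain w where w: "s = state w" "stable w" "w \<in> ?T" by (auto simp: S_def)
      then obtain y where y: "R w y" "y \<in> v b" "y \<in> ?T"
        using fix_T[OF b] unfolding subset_iff mem_dia by blast
      obtain z where z: "stable z" "ty z = ty y" "le (state w) (state z)"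
        using state_above[OF w(2) y(1)] by metis
      have "z \<in> v b" "z \<in> ?T" using y ty_eq_mem[OF _ z(2)] \<Sigma>[OF b] T\<Sigma> by blast+
      then have "state z \<in> gttruth fbox ?g b \<inter> S" using IH[OF b z(1)] z(1) by (auto simp: S_def)
      then show "s \<in> - fbox (- (gttruth fbox ?g b \<inter> S))" unfolding mem_fdia w(1) using z(3) by blast
    qed
    moreover have "state x \<in> S" using x TTangle.prems by (auto simp: S_def)
    ultimately show "state x \<in> gttruth fbox ?g (TTangle G)" by auto
  qed
qed

text \<open>Continuity of the interior map gives one inclusion between the two sets, density of its
  fibres the other.\<close>

lemma topological_realization:
  assumes "stable x"
  obtains f :: "'a::{metric_space, perfect_space} \<Rightarrow> 'w state" and y where "f y = state x"
    "\<And>Z. f -` fbox Z = interior (f -` Z)"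
proof -
  have "\<exists>f. interior_map_onto le (state x) (UNIV :: 'a set) f"
  proof (rule interior_map_exists[where le = le and S = states])
    show "le s u" if "le s t" "le t u" for s t u by (rule le_trans[OF that])
  qed (use finite_states le_refl le_states state_in[OF assms] in simp_all)
  then obtain f where f: "interior_map_onto le (state x) (UNIV :: 'a set) f" ..
  obtain y where y: "f y = state x"
    using interior_map_onto.root[OF f] by blast
  have continuous: "\<exists>U. open U \<and> z \<in> U \<and> (\<forall>y\<in>U. le (f z) (f y))" for z
    using interior_map_onto.continuous[OF f, of z] by blast
  have dense: "z \<in> closure {y. f y = t}" if "le (f z) t" for z t
    using interior_map_onto.dense[OF f UNIV_I that] by simp
  have "f -` fbox Z = interior (f -` Z)" for Z
  proof (rule set_eqI)
    fix z
    have "z \<in> interior (f -` Z)" if "f z \<in> fbox Z"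
    proof -
      obtain U where U: "open U \<and> z \<in> U \<and> (\<forall>y\<in>U. le (f z) (f y))"
        using continuous[of z] by (rule exE)
      have "U \<subseteq> f -` Z"
      proof
        fix y assume "y \<in> U"
        then have "le (f z) (f y)" using U by simp
        then have "f y \<in> Z" using that unfolding mem_fbox by blast
        then show "y \<in> f -` Z" by simp
      qed
      then show ?thesis using U by (intro interiorI[of U]) simp_all
    qed
    moreover have "f z \<in> fbox Z" if "z \<in> interior (f -` Z)"
      unfolding mem_fbox
    proof (intro allI impI)
      fix t assume "le (f z) t"
      then have "interior (f -` Z) \<inter> {y. f y = t} \<noteq> {}"
        using dense[of z t] that open_Int_closure_eq_empty[OF open_interior, of "f -` Z" "{y. f y = t}"] by blast
      then show "t \<in> Z" using interior_subset by blast
    qed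
    ultimately show "z \<in> f -` fbox Z \<longleftrightarrow> z \<in> interior (f -` Z)" by blast
  qed
  then show ?thesis using that y by blast
qed

end

context general_frame
begin

theorem mu_refutation:
  assumes "mu_formula a" "mdefinable a" "\<And>p. k p \<in> D" "x \<notin> val a k"
  shows "\<not> mvalid (X :: 'a::{metric_space, perfect_space} itself) a"
proof -
  interpret filtered_frame R D "vals a k"
    by (rule filtered_frame.intro[OF general_frame_axioms filtered_frame_axioms.intro])
      (rule finite_vals, rule vals_D[OF assms(2,3)])
  \<comment> \<open>The refuting world may be unstable; a stable world of the same type refutes the
    formula too, since its value belongs to \<open>vals a k\<close>.\<close>
  obtain z where z: "ty z = ty x" "stable z" by (rule stable_above)
  have "z \<notin> val a k" using ty_eq_mem[OF val_in_vals z(1)] assms(4) by blast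
  define g where "g p = {state z | z. stable z \<and> z \<in> k p}" for p
  have no: "state z \<notin> fval a g"
    unfolding g_def using state_truth[OF assms(1-3) subset_refl z(2)] \<open>z \<notin> val a k\<close> by blast
  obtain f :: "'a \<Rightarrow> 'w state" and y where f: "f y = state z" "\<And>Z. f -` fbox Z = interior (f -` Z)"
    by (rule topological_realization[OF z(2)]) blast
  have "mtruth a (\<lambda>p. f -` g p) = f -` fval a g"
    unfolding mtruth_gtruth using f(2) fbox_mono interior_mono assms(1)
    by (rule gtruth_vimage[where f = f and bx = fbox and bx' = interior])
  then have "y \<notin> mtruth a (\<lambda>p. f -` g p)" using no f(1) by simp
  then show ?thesis unfolding mvalid_def by blast
qed

theorem tangle_refutation:
  assumes "tangle_formula a" "tangle_valuation v" "x \<notin> v a"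
  shows "\<not> tvalid (X :: 'a::{metric_space, perfect_space} itself) a"
proof -
  interpret filtered_frame R D "tvals v a"
    by (rule filtered_frame.intro[OF general_frame_axioms filtered_frame_axioms.intro])
      (rule finite_tvals, rule tvals_D[OF assms(2,1)])
  obtain z where z: "ty z = ty x" "stable z" by (rule stable_above)
  have "z \<notin> v a" using ty_eq_mem[OF val_in_tvals z(1)] assms(3) by blast
  define g where "g p = {state z | z. stable z \<and> z \<in> v (TAtom p)}" for p
  have no: "state z \<notin> gttruth fbox g a"
    unfolding g_def using tangle_state_truth[OF assms(2,1) subset_refl z(2)] \<open>z \<notin> v a\<close> by blast
  obtain f :: "'a \<Rightarrow> 'w state" and y where f: "f y = state z" "\<And>Z. f -` fbox Z = interior (f -` Z)"
    by (rule topological_realization[OF z(2)]) blast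
  have "ttruth (\<lambda>p. f -` g p) a = f -` gttruth fbox g a"
    unfolding ttruth_gttruth using f(2) fbox_mono interior_mono
    by (rule gttruth_vimage[where f = f and bx = fbox and bx' = interior])
  then have "y \<notin> ttruth (\<lambda>p. f -` g p) a" using no f(1) by simp
  then show ?thesis unfolding tvalid_def by blast
qed

end

section \<open>Canonical general frames\<close>

primrec pinst :: "'f \<Rightarrow> ('f \<Rightarrow> 'f) \<Rightarrow> ('f \<Rightarrow> 'f \<Rightarrow> 'f) \<Rightarrow> (nat \<Rightarrow> 'f) \<Rightarrow> nat pfm \<Rightarrow> 'f" where
  "pinst tt neg con s (PAtom p) = s p"
| "pinst tt neg con s PTop = tt"
| "pinst tt neg con s (PNeg a) = neg (pinst tt neg con s a)"
| "pinst tt neg con s (PAnd a b) = con (pinst tt neg con s a) (pinst tt neg con s b)"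

abbreviation PImp :: "'v pfm \<Rightarrow> 'v pfm \<Rightarrow> 'v pfm" where
  "PImp a b \<equiv> PNeg (PAnd a (PNeg b))"

text \<open>The common part of both systems, so that the canonical frame is built once.
  \<open>form\<close> singles out the formulas among the terms of the datatype; tautologies are
  taken over \<open>nat\<close> atoms, independently of the language.\<close>

locale S4_logic =
  fixes form :: "'f \<Rightarrow> bool" and tt :: 'f and neg :: "'f \<Rightarrow> 'f" and con :: "'f \<Rightarrow> 'f \<Rightarrow> 'f"
    and nbox :: "'f \<Rightarrow> 'f" and prov :: "'f \<Rightarrow> bool"
  assumes form_top: "form tt" and form_neg: "form (neg a) \<longleftrightarrow> form a"
    and form_conj: "form (con a b) \<longleftrightarrow> form a \<and> form b" and form_nbox: "form (nbox a) \<longleftrightarrow> form a"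
    and prov_form: "prov a \<Longrightarrow> form a"
    and taut: "tautology t \<Longrightarrow> (\<And>n. form (s n)) \<Longrightarrow> prov (pinst tt neg con s t)"
    and ax_K: "form a \<Longrightarrow> form b \<Longrightarrow>
      prov (neg (con (nbox (neg (con a (neg b)))) (neg (neg (con (nbox a) (neg (nbox b)))))))"
    and ax_T: "form a \<Longrightarrow> prov (neg (con (nbox a) (neg a)))"
    and ax_4: "form a \<Longrightarrow> prov (neg (con (nbox a) (neg (nbox (nbox a)))))"
    and MP: "prov (neg (con a (neg b))) \<Longrightarrow> prov a \<Longrightarrow> prov b"
    and nec: "prov a \<Longrightarrow> prov (nbox a)"
    and consistent: "\<exists>a. form a \<and> \<not> prov a"
begin

abbreviation imp :: "'f \<Rightarrow> 'f \<Rightarrow> 'f" where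
  "imp a b \<equiv> neg (con a (neg b))"

lemmas form_simps = form_top form_neg form_conj form_nbox

section \<open>Propositional reasoning and maximal consistent sets\<close>

lemma taut3:
  assumes "tautology t" "form a" "form b" "form c"
  shows "prov (pinst tt neg con (\<lambda>n. if n = 0 then a else if n = 1 then b else c) t)"
  using assms by (intro taut) auto

lemma taut_K: "form a \<Longrightarrow> form b \<Longrightarrow> prov (imp a (imp b a))"
  using taut3[of "PImp (PAtom 0) (PImp (PAtom 1) (PAtom 0))" a b b] by (simp add: tautology_def)

lemma taut_S: "form a \<Longrightarrow> form b \<Longrightarrow> form c \<Longrightarrow>
    prov (imp (imp a (imp b c)) (imp (imp a b) (imp a c)))"
  using taut3[of "PImp (PImp (PAtom 0) (PImp (PAtom 1) (PAtom 2)))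
    (PImp (PImp (PAtom 0) (PAtom 1)) (PImp (PAtom 0) (PAtom 2)))" a b c] by (simp add: tautology_def)

lemma taut_refl: "form a \<Longrightarrow> prov (imp a a)"
  using taut3[of "PImp (PAtom 0) (PAtom 0)" a a a] by (simp add: tautology_def)

lemma taut_explosion: "form a \<Longrightarrow> form b \<Longrightarrow> prov (imp a (imp (neg a) b))"
  using taut3[of "PImp (PAtom 0) (PImp (PNeg (PAtom 0)) (PAtom 1))" a b b] by (simp add: tautology_def)

lemma taut_cases: "form a \<Longrightarrow> form b \<Longrightarrow> prov (imp (imp a b) (imp (imp (neg a) b) b))"
  using taut3[of "PImp (PImp (PAtom 0) (PAtom 1)) (PImp (PImp (PNeg (PAtom 0)) (PAtom 1)) (PAtom 1))" a b b]
  by (simp add: tautology_def) blast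

lemma taut_conj1: "form a \<Longrightarrow> form b \<Longrightarrow> prov (imp (con a b) a)"
  using taut3[of "PImp (PAnd (PAtom 0) (PAtom 1)) (PAtom 0)" a b b] by (simp add: tautology_def)

lemma taut_conj2: "form a \<Longrightarrow> form b \<Longrightarrow> prov (imp (con a b) b)"
  using taut3[of "PImp (PAnd (PAtom 0) (PAtom 1)) (PAtom 1)" a b b] by (simp add: tautology_def)

lemma taut_conjI: "form a \<Longrightarrow> form b \<Longrightarrow> prov (imp a (imp b (con a b)))"
  using taut3[of "PImp (PAtom 0) (PImp (PAtom 1) (PAnd (PAtom 0) (PAtom 1)))" a b b]
  by (simp add: tautology_def)

lemma taut_top: "prov tt"
  using taut[of PTop "\<lambda>_. tt"] form_top by (simp add: tautology_def)

text \<open>Necessitation is available only inside \<open>prov\<close>, not for consequences of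
  hypotheses; otherwise the deduction theorem would fail.\<close>

inductive deriv :: "'f set \<Rightarrow> 'f \<Rightarrow> bool" for \<Gamma> where
  deriv_ax: "prov a \<Longrightarrow> deriv \<Gamma> a"
| deriv_hyp: "a \<in> \<Gamma> \<Longrightarrow> form a \<Longrightarrow> deriv \<Gamma> a"
| deriv_mp: "deriv \<Gamma> (imp a b) \<Longrightarrow> deriv \<Gamma> a \<Longrightarrow> deriv \<Gamma> b"

lemma deriv_form: "deriv \<Gamma> a \<Longrightarrow> form a"
  by (induction rule: deriv.induct) (auto simp: prov_form form_simps)

lemma deriv_mono: "deriv \<Gamma> a \<Longrightarrow> \<Gamma> \<subseteq> \<Delta> \<Longrightarrow> deriv \<Delta> a"
  by (induction rule: deriv.induct) (auto intro: deriv.intros)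

lemma deriv_cut: "deriv \<Delta> a \<Longrightarrow> (\<And>b. b \<in> \<Delta> \<Longrightarrow> form b \<Longrightarrow> deriv \<Gamma> b) \<Longrightarrow> deriv \<Gamma> a"
  by (induction rule: deriv.induct) (auto intro: deriv.intros)

lemma deduction: "deriv (insert a \<Gamma>) b \<Longrightarrow> form a \<Longrightarrow> deriv \<Gamma> (imp a b)"
proof (induction rule: deriv.induct)
  case (deriv_ax b)
  then show ?case using taut_K[of b a] prov_form by (meson deriv.deriv_ax deriv.deriv_mp)
next
  case (deriv_hyp b)
  show ?case
  proof (cases "b = a")
    case True
    then show ?thesis using taut_refl deriv_hyp by (simp add: deriv.deriv_ax)
  next
    case False
    then have "deriv \<Gamma> b" using deriv_hyp by (auto intro: deriv.deriv_hyp)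
    then show ?thesis using taut_K[of b a] deriv_hyp by (meson deriv.deriv_ax deriv.deriv_mp)
  qed
next
  case (deriv_mp b c)
  have "form b" "form c" using deriv_form[OF deriv_mp.hyps(1)] by (auto simp: form_simps)
  then have "deriv \<Gamma> (imp (imp a (imp b c)) (imp (imp a b) (imp a c)))"
    using taut_S deriv_mp.prems by (simp add: deriv.deriv_ax)
  then show ?case using deriv_mp.IH deriv_mp.prems by (meson deriv.deriv_mp)
qed

lemma deriv_empty: "deriv {} a \<Longrightarrow> prov a"
  by (induction rule: deriv.induct) (auto intro: MP)

lemma deriv_chain:
  assumes "deriv (\<Union>C) a" "C \<noteq> {}" "\<And>X Y. X \<in> C \<Longrightarrow> Y \<in> C \<Longrightarrow> X \<subseteq> Y \<or> Y \<subseteq> X"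
  shows "\<exists>\<Gamma>\<in>C. deriv \<Gamma> a"
  using assms(1)
proof (induction rule: deriv.induct)
  case (deriv_ax a)
  then show ?case using assms(2) by (auto intro: deriv.deriv_ax)
next
  case (deriv_hyp a)
  then show ?case by (auto intro: deriv.deriv_hyp)
next
  case (deriv_mp a b)
  then obtain X Y where XY: "X \<in> C" "Y \<in> C" "deriv X (imp a b)" "deriv Y a" by blast
  then consider "X \<subseteq> Y" | "Y \<subseteq> X" using assms(3) by blast
  then show ?case using XY deriv_mono deriv.deriv_mp by cases blast+
qed

definition mcs :: "'f set \<Rightarrow> bool" where
  "mcs \<Gamma> \<longleftrightarrow> (\<forall>a. deriv \<Gamma> a \<longrightarrow> a \<in> \<Gamma>) \<and> (\<forall>a\<in>\<Gamma>. form a) \<and>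
    (\<forall>a. form a \<longrightarrow> (neg a \<in> \<Gamma> \<longleftrightarrow> a \<notin> \<Gamma>))"

lemma Lindenbaum:
  assumes nd: "\<not> deriv \<Gamma> a" and a: "form a"
  obtains \<Delta> where "mcs \<Delta>" "\<And>b. b \<in> \<Gamma> \<Longrightarrow> form b \<Longrightarrow> b \<in> \<Delta>" "a \<notin> \<Delta>"
proof -
  let ?P = "{\<Delta>. \<not> deriv \<Delta> a \<and> \<Gamma> \<subseteq> \<Delta>}"
  have "\<exists>M\<in>?P. \<forall>X\<in>?P. M \<subseteq> X \<longrightarrow> X = M"
  proof (rule subset_Zorn_nonempty)
    show "?P \<noteq> {}" using nd by blast
    fix C assume C: "C \<noteq> {}" "subset.chain ?P C"
    have chain: "X \<subseteq> Y \<or> Y \<subseteq> X" if "X \<in> C" "Y \<in> C" for X Y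
      using C(2) that unfolding subset.chain_def by blast
    have CP: "C \<subseteq> ?P" using C(2) unfolding subset.chain_def by blast
    then have "\<not> deriv (\<Union>C) a" using deriv_chain[OF _ C(1) chain] by blast
    then show "\<Union>C \<in> ?P" using CP C(1) by blast
  qed
  then obtain M where M': "M \<in> ?P" "\<forall>X\<in>?P. M \<subseteq> X \<longrightarrow> X = M" by (rule bexE)
  then have M: "\<not> deriv M a" "\<Gamma> \<subseteq> M" by simp_all
  have max: "X = M" if "\<not> deriv X a" "M \<subseteq> X" for X
    using M'(2) that M(2) by simp
  have closed: "b \<in> M" if "deriv M b" for b
  proof (rule ccontr)
    assume "b \<notin> M"
    then have "deriv (insert b M) a" using max[of "insert b M"] by blast
    then have "deriv M a"
      by (rule deriv_cut) (use that in \<open>auto intro: deriv.deriv_hyp\<close>)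
    then show False using M by simp
  qed
  have ins: "deriv M (imp b a)" if "b \<notin> M" "form b" for b
    using max[of "insert b M"] that deduction by blast
  have neg: "neg b \<in> M \<longleftrightarrow> b \<notin> M" if b: "form b" for b
  proof
    assume n: "neg b \<in> M"
    show "b \<notin> M"
    proof
      assume "b \<in> M"
      have "deriv M (imp b (imp (neg b) a))"
        using taut_explosion[OF b a] by (rule deriv.deriv_ax)
      moreover have "deriv M b" "deriv M (neg b)"
        using n \<open>b \<in> M\<close> b by (auto intro: deriv.deriv_hyp simp: form_simps)
      ultimately show False using M(1) by (meson deriv.deriv_mp)
    qed
  next
    assume n: "b \<notin> M"
    show "neg b \<in> M"
    proof (rule ccontr)
      assume "neg b \<notin> M"
      then have "deriv M (imp (neg b) a)" using ins b by (simp add: form_simps)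
      moreover have "deriv M (imp (imp b a) (imp (imp (neg b) a) a))"
        using taut_cases[OF b a] by (rule deriv.deriv_ax)
      ultimately show False using ins[OF n b] M(1) by (meson deriv.deriv_mp)
    qed
  qed
  \<comment> \<open>The Zorn-maximal set contains every term that is not a formula, since such
    hypotheses yield no derivations; they are discarded here.\<close>
  let ?D = "{b \<in> M. form b}"
  have mono: "deriv M b" if "deriv ?D b" for b using that by (rule deriv_mono) auto
  have "mcs ?D" unfolding mcs_def
    using closed neg mono deriv_form by (auto simp: form_simps)
  moreover have "a \<notin> ?D" using M(1) by (auto intro: deriv.deriv_hyp)
  ultimately show ?thesis using that[of ?D] M(2) by blast
qed

lemma mcs_exists: "\<exists>\<Gamma>. mcs \<Gamma>"
proof -
  obtain a where a: "form a" "\<not> prov a" using consistent by blast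
  then have "\<not> deriv {} a" using deriv_empty by blast
  then show ?thesis using Lindenbaum[OF _ a(1)] by metis
qed

text \<open>Worlds are arbitrary sets of formulas; those that are not maximal consistent stand for one
  fixed maximal consistent set, which saves a type of maximal consistent sets.\<close>

definition world :: "'f set \<Rightarrow> 'f set" where
  "world \<Gamma> = (if mcs \<Gamma> then \<Gamma> else (SOME \<Gamma>. mcs \<Gamma>))"

lemma mcs_world: "mcs (world \<Gamma>)"
  using someI_ex[OF mcs_exists] by (simp add: world_def)

lemma world_mcs: "mcs \<Gamma> \<Longrightarrow> world \<Gamma> = \<Gamma>"
  by (simp add: world_def)

definition acc :: "'f set \<Rightarrow> 'f set \<Rightarrow> bool" where
  "acc \<Gamma> \<Delta> \<longleftrightarrow> (\<forall>a. nbox a \<in> world \<Gamma> \<longrightarrow> a \<in> world \<Delta>)"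

definition ext :: "'f \<Rightarrow> 'f set set" where
  "ext a = {\<Gamma>. a \<in> world \<Gamma>}"

definition exts :: "'f set set set" where
  "exts = ext ` {a. form a}"

lemma world_deriv: "deriv (world \<Gamma>) a \<Longrightarrow> a \<in> world \<Gamma>"
  using mcs_world[of \<Gamma>] by (simp add: mcs_def)

lemma world_form: "a \<in> world \<Gamma> \<Longrightarrow> form a"
  using mcs_world[of \<Gamma>] by (simp add: mcs_def)

lemma world_prov: "prov a \<Longrightarrow> a \<in> world \<Gamma>"
  by (intro world_deriv deriv.deriv_ax)

lemma world_mp: "imp a b \<in> world \<Gamma> \<Longrightarrow> a \<in> world \<Gamma> \<Longrightarrow> b \<in> world \<Gamma>"
  by (meson world_deriv world_form deriv.deriv_hyp deriv.deriv_mp)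

lemma world_neg: "form a \<Longrightarrow> neg a \<in> world \<Gamma> \<longleftrightarrow> a \<notin> world \<Gamma>"
  using mcs_world[of \<Gamma>] by (simp add: mcs_def)

lemma world_conj:
  assumes "form a" "form b" shows "con a b \<in> world \<Gamma> \<longleftrightarrow> a \<in> world \<Gamma> \<and> b \<in> world \<Gamma>"
  using world_mp[OF world_prov[OF taut_conj1[OF assms]]] world_mp[OF world_prov[OF taut_conj2[OF assms]]]
    world_mp[OF world_mp[OF world_prov[OF taut_conjI[OF assms]]]] by blast

lemma world_exists:
  assumes "\<not> deriv \<Gamma> a" "form a"
  obtains \<Delta> where "\<And>b. b \<in> \<Gamma> \<Longrightarrow> form b \<Longrightarrow> b \<in> world \<Delta>" "a \<notin> world \<Delta>"
proof -
  obtain \<Delta> where \<Delta>: "mcs \<Delta>" "\<And>b. b \<in> \<Gamma> \<Longrightarrow> form b \<Longrightarrow> b \<in> \<Delta>" "a \<notin> \<Delta>"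
    using Lindenbaum[OF assms] by metis
  show ?thesis by (rule that[of \<Delta>]) (use \<Delta> world_mcs in auto)
qed

text \<open>The formulas boxed in a world are closed under derivation, by necessitation and K. If
  \<open>a\<close> does not follow from them, Lindenbaum's lemma gives an accessible world without
  \<open>a\<close>.\<close>

lemma world_nbox:
  assumes a: "form a" shows "nbox a \<in> world \<Gamma> \<longleftrightarrow> (\<forall>\<Delta>. acc \<Gamma> \<Delta> \<longrightarrow> a \<in> world \<Delta>)"
proof
  assume "nbox a \<in> world \<Gamma>"
  then show "\<forall>\<Delta>. acc \<Gamma> \<Delta> \<longrightarrow> a \<in> world \<Delta>" by (simp add: acc_def)
next
  assume all: "\<forall>\<Delta>. acc \<Gamma> \<Delta> \<longrightarrow> a \<in> world \<Delta>"
  let ?\<Theta> = "{b. nbox b \<in> world \<Gamma>}"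
  have box: "nbox b \<in> world \<Gamma>" if "deriv ?\<Theta> b" for b
    using that
  proof (induction rule: deriv.induct)
    case (deriv_ax b)
    then show ?case by (intro world_prov nec)
  next
    case (deriv_hyp b)
    then show ?case by simp
  next
    case (deriv_mp b c)
    have "form b" "form c" using deriv_form[OF deriv_mp.hyps(1)] by (auto simp: form_simps)
    then show ?case using deriv_mp.IH world_mp world_prov[OF ax_K] by meson
  qed
  have "deriv ?\<Theta> a"
  proof (rule ccontr)
    assume "\<not> deriv ?\<Theta> a"
    then obtain \<Delta> where \<Delta>: "\<And>b. b \<in> ?\<Theta> \<Longrightarrow> form b \<Longrightarrow> b \<in> world \<Delta>" "a \<notin> world \<Delta>"
      by (rule world_exists[OF _ a]) blast
    have "acc \<Gamma> \<Delta>" unfolding acc_def using \<Delta>(1) world_form form_nbox by blast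
    then show False using all \<Delta>(2) by blast
  qed
  then show "nbox a \<in> world \<Gamma>" by (rule box)
qed

lemma ext_top: "ext tt = UNIV"
  using world_prov[OF taut_top] by (auto simp: ext_def)

lemma ext_neg: "form a \<Longrightarrow> ext (neg a) = - ext a"
  by (auto simp: ext_def world_neg)

lemma ext_conj: "form a \<Longrightarrow> form b \<Longrightarrow> ext (con a b) = ext a \<inter> ext b"
  by (auto simp: ext_def world_conj)

lemma ext_nbox: "form a \<Longrightarrow> ext (nbox a) = {x. \<forall>y. acc x y \<longrightarrow> y \<in> ext a}"
  by (simp add: ext_def world_nbox)

lemma ext_in_exts: "form a \<Longrightarrow> ext a \<in> exts"
  by (simp add: exts_def)

text \<open>Makes \<open>exts\<close> a copy of the Lindenbaum algebra: axioms and rules of either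
  system turn into inclusions between definable sets.\<close>

lemma ext_subset:
  assumes "form a" "form b" shows "ext a \<subseteq> ext b \<longleftrightarrow> prov (imp a b)"
proof
  assume le: "ext a \<subseteq> ext b"
  show "prov (imp a b)"
  proof (rule ccontr)
    assume "\<not> prov (imp a b)"
    then have "\<not> deriv {a} b" using deduction[of a "{}" b] deriv_empty assms by blast
    then obtain \<Delta> where "a \<in> world \<Delta>" "b \<notin> world \<Delta>"
      using world_exists[OF _ assms(2)] assms(1) by (metis insertI1)
    then show False using le by (auto simp: ext_def)
  qed
next
  assume "prov (imp a b)"
  then show "ext a \<subseteq> ext b" unfolding ext_def using world_mp[OF world_prov] by blast
qed

lemma ext_UNIV: "form a \<Longrightarrow> ext a = UNIV \<longleftrightarrow> prov a"
proof -
  assume a: "form a"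
  have "ext a = UNIV \<longleftrightarrow> prov (imp tt a)"
    using ext_subset[OF form_top a] ext_top by auto
  also have "\<dots> \<longleftrightarrow> prov a"
    using MP[OF _ taut_top] MP[OF taut_K[OF a form_top]] by blast
  finally show ?thesis .
qed

sublocale canonical: general_frame acc exts
proof
  show "acc x x" for x
    unfolding acc_def using world_mp[OF world_prov[OF ax_T]] world_form form_nbox by blast
  show "acc x z" if "acc x y" "acc y z" for x y z
    using that unfolding acc_def using world_mp[OF world_prov[OF ax_4]] world_form form_nbox by meson
  show "- A \<in> exts" if A: "A \<in> exts" for A
  proof -
    obtain a where "form a" "A = ext a" using A by (auto simp: exts_def)
    then show ?thesis using ext_in_exts[of "neg a"] by (simp add: ext_neg form_simps)
  qed
  show "A \<inter> B \<in> exts" if A: "A \<in> exts" and B: "B \<in> exts" for A B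
  proof -
    obtain a b where "form a" "A = ext a" "form b" "B = ext b" using A B by (auto simp: exts_def)
    then show ?thesis using ext_in_exts[of "con a b"] by (simp add: ext_conj form_simps)
  qed
  show "UNIV \<in> exts" using ext_in_exts[OF form_top] by (simp add: ext_top)
  show "{x. \<forall>y. acc x y \<longrightarrow> y \<in> A} \<in> exts" if A: "A \<in> exts" for A
  proof -
    obtain a where "form a" "A = ext a" using A by (auto simp: exts_def)
    then show ?thesis using ext_in_exts[of "nbox a"] by (simp add: ext_nbox form_simps)
  qed
qed

lemma ext_box: "form a \<Longrightarrow> ext (nbox a) = canonical.box (ext a)"
  by (simp add: ext_nbox canonical.box_def)

end

section \<open>The fixed point system\<close>

lemma ptruth_map: "ptruth v (map_pfm f t) \<longleftrightarrow> ptruth (v \<circ> f) t"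
  by (induction t) auto

lemma tautology_map: "tautology t \<Longrightarrow> tautology (map_pfm f t)"
  by (simp add: tautology_def ptruth_map)

section \<open>Free atoms, parity and renaming of bound atoms\<close>

lemma finite_mfree: "finite (mfree a)"
  by (induction a) auto

lemma msubst_not_free: "q \<notin> mfree a \<Longrightarrow> msubst a s q = a"
  by (induction a) auto

lemma mparity_not_free: "q \<notin> mfree a \<Longrightarrow> mparity q a e"
  by (induction a arbitrary: e) auto

lemma mfree_for_not_free: "q \<notin> mfree a \<Longrightarrow> mfree_for s q a"
  by (induction a) auto

lemma mfree_msubst: "mfree (msubst a s q) \<subseteq> (mfree a - {q}) \<union> (if q \<in> mfree a then mfree s else {})"
  by (induction a) (auto split: if_splits)

lemma mparity_msubst: "p \<notin> mfree s \<Longrightarrow> p \<noteq> q \<Longrightarrow> mparity p (msubst a s q) e \<longleftrightarrow> mparity p a e"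
  by (induction a arbitrary: e) (auto simp: mparity_not_free)

lemma mu_formula_msubst:
  "mu_formula a \<Longrightarrow> mu_formula s \<Longrightarrow> mfree_for s q a \<Longrightarrow> mu_formula (msubst a s q)"
proof (induction a)
  case (MMu p a)
  show ?case
  proof (cases "p = q \<or> q \<notin> mfree a")
    case True
    then show ?thesis using MMu.prems by (auto simp: msubst_not_free)
  next
    case False
    then show ?thesis using MMu by (auto simp: mparity_msubst)
  qed
qed auto

lemma mparity_rename:
  "r \<notin> mfree a \<Longrightarrow> mfree_for (MAtom r) q a \<Longrightarrow> mparity r (msubst a (MAtom r) q) e \<longleftrightarrow> mparity q a e"
proof (induction a arbitrary: e)
  case (MMu p a)
  show ?case
  proof (cases "p = q")
    case True
    then show ?thesis using MMu.prems by (auto simp: mparity_not_free)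
  next
    case pq: False
    show ?thesis
    proof (cases "p = r")
      case True
      then show ?thesis using MMu.prems pq by (auto simp: mparity_not_free)
    next
      case False
      then show ?thesis using MMu pq by auto
    qed
  qed
qed auto

lemma mu_formula_rename:
  "mfree_for (MAtom r) q a \<Longrightarrow> mu_formula (msubst a (MAtom r) q) \<longleftrightarrow> mu_formula a"
proof (induction a)
  case (MMu p a)
  show ?case
  proof (cases "p = q \<or> q \<notin> mfree a")
    case True
    then show ?thesis by (auto simp: msubst_not_free)
  next
    case False
    then show ?thesis using MMu by (auto simp: mparity_msubst)
  qed
qed auto

lemma malpha_mparity: "malpha a b \<Longrightarrow> mparity p a e \<longleftrightarrow> mparity p b e"
proof (induction arbitrary: e rule: malpha.induct)
  case (malpha_rename r a q)
  consider "p = r" | "p = q" "p \<noteq> r" | "p \<noteq> q" "p \<noteq> r" by blast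
  then show ?case
  proof cases
    case 1
    then show ?thesis using malpha_rename by (auto simp: mparity_not_free)
  next
    case 2
    then have "q \<notin> mfree (msubst a (MAtom r) q)"
      using mfree_msubst[of a "MAtom r" q] by (auto split: if_splits)
    then show ?thesis using 2 by (auto simp: mparity_not_free)
  next
    case 3
    then show ?thesis by (auto simp: mparity_msubst)
  qed
qed auto

lemma malpha_mu_formula: "malpha a b \<Longrightarrow> mu_formula a \<longleftrightarrow> mu_formula b"
proof (induction rule: malpha.induct)
  case (malpha_Mu a a' q)
  then show ?case using malpha_mparity[OF malpha_Mu.hyps] by simp
next
  case (malpha_rename r a q)
  then show ?case by (simp add: mparity_rename mu_formula_rename)
qed auto

lemma S4mu_mu_formula: "S4mu a \<Longrightarrow> mu_formula a"
proof (induction rule: S4mu.induct)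
  case (S4mu_fixax q a)
  then show ?case using mu_formula_msubst[OF _ S4mu_fixax(1,2)] by simp
next
  case (S4mu_alpha a b)
  then show ?case using malpha_mu_formula by blast
qed auto

section \<open>Soundness of the fixed point system\<close>

lemma mtruth_minst: "x \<in> mtruth (minst s t) h \<longleftrightarrow> ptruth (\<lambda>p. x \<in> mtruth (s p) h) t"
  by (induction t) auto

lemma S4mu_sound: "S4mu a \<Longrightarrow> mtruth a h = UNIV"
proof (induction arbitrary: h rule: S4mu.induct)
  case (S4mu_taut t s)
  then show ?case by (auto simp: tautology_def mtruth_minst)
next
  case (S4mu_K a b)
  have "x \<in> mtruth (MBox b) h" if "x \<in> mtruth (MBox (MImp a b)) h" "x \<in> mtruth (MBox a) h" for x
  proof -
    have "interior (mtruth (MImp a b) h) \<inter> interior (mtruth a h) \<subseteq> interior (mtruth b h)"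
      unfolding interior_Int[symmetric] by (rule interior_mono) auto
    then show ?thesis using that by (auto simp: mtruth_gtruth)
  qed
  then show ?case by auto
next
  case (S4mu_T a)
  then show ?case by auto
next
  case (S4mu_4 a)
  have "mtruth (MBox a) h \<subseteq> mtruth (MBox (MBox a)) h"
    by (simp add: mtruth_gtruth)
  then show ?case by auto
next
  case (S4mu_fixax q a)
  have "gtruth interior UNIV a (h(q := gtruth interior UNIV (MMu q a) h)) \<subseteq> gtruth interior UNIV (MMu q a) h"
    by (rule gtruth_MMu_prefixed[OF interior_mono S4mu_fixax(1)])
  then show ?case using gtruth_msubst[OF S4mu_fixax(2), of interior UNIV h]
    unfolding mtruth_gtruth gtruth.simps(3,4) by blast
next
  case (S4mu_MP a b)
  then show ?case by auto
next
  case (S4mu_nec a)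
  then show ?case by auto
next
  case (S4mu_fixrule q a b)
  have "gtruth interior UNIV a (h(q := gtruth interior UNIV b h)) \<subseteq> gtruth interior UNIV b h"
    using S4mu_fixrule(4)[of h] gtruth_msubst[OF S4mu_fixrule(2), of interior UNIV h]
    unfolding mtruth_gtruth gtruth.simps(3,4) by blast
  then have "gtruth interior UNIV (MMu q a) h \<subseteq> gtruth interior UNIV b h"
    by (rule gtruth_MMu_lower[OF UNIV_I])
  then show ?case unfolding mtruth_gtruth gtruth.simps(3,4) by blast
next
  case (S4mu_alpha a b)
  then show ?case using gtruth_malpha unfolding mtruth_gtruth by metis
qed

text \<open>\<open>minstance a \<sigma> b\<close>: up to the choice of bound atoms, \<open>b\<close> is the result of the simultaneous
  capture-avoiding substitution \<open>\<sigma>\<close> in \<open>a\<close>.\<close>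

primrec minstance :: "'v mfm \<Rightarrow> ('v \<Rightarrow> 'v mfm) \<Rightarrow> 'v mfm \<Rightarrow> bool" where
  "minstance (MAtom p) \<sigma> b \<longleftrightarrow> b = \<sigma> p"
| "minstance MTop \<sigma> b \<longleftrightarrow> b = MTop"
| "minstance (MNeg a) \<sigma> b \<longleftrightarrow> (\<exists>a'. b = MNeg a' \<and> minstance a \<sigma> a')"
| "minstance (MAnd a c) \<sigma> b \<longleftrightarrow> (\<exists>a' c'. b = MAnd a' c' \<and> minstance a \<sigma> a' \<and> minstance c \<sigma> c')"
| "minstance (MBox a) \<sigma> b \<longleftrightarrow> (\<exists>a'. b = MBox a' \<and> minstance a \<sigma> a')"
| "minstance (MMu q a) \<sigma> b \<longleftrightarrow> (\<exists>r a'. b = MMu r a' \<and> (\<forall>p\<in>mfree a - {q}. r \<notin> mfree (\<sigma> p)) \<and>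
     minstance a (\<sigma>(q := MAtom r)) a')"

lemma minstance_cong: "(\<And>p. p \<in> mfree a \<Longrightarrow> \<sigma> p = \<tau> p) \<Longrightarrow> minstance a \<sigma> b \<longleftrightarrow> minstance a \<tau> b"
proof (induction a arbitrary: \<sigma> \<tau> b)
  case (MNeg a)
  have "minstance a \<sigma> c \<longleftrightarrow> minstance a \<tau> c" for c by (rule MNeg.IH) (use MNeg.prems in simp)
  then show ?case by simp
next
  case (MAnd a a')
  have "minstance a \<sigma> c \<longleftrightarrow> minstance a \<tau> c" for c by (rule MAnd.IH) (use MAnd.prems in simp)
  moreover have "minstance a' \<sigma> c \<longleftrightarrow> minstance a' \<tau> c" for c by (rule MAnd.IH) (use MAnd.prems in simp)
  ultimately show ?case by simp
next
  case (MBox a)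
  have "minstance a \<sigma> c \<longleftrightarrow> minstance a \<tau> c" for c by (rule MBox.IH) (use MBox.prems in simp)
  then show ?case by simp
next
  case (MMu q a)
  have "minstance a (\<sigma>(q := MAtom r)) c \<longleftrightarrow> minstance a (\<tau>(q := MAtom r)) c" for r c
    by (rule MMu.IH) (use MMu.prems in \<open>simp add: fun_upd_apply\<close>)
  moreover have "(\<forall>p\<in>mfree a - {q}. r \<notin> mfree (\<sigma> p)) \<longleftrightarrow> (\<forall>p\<in>mfree a - {q}. r \<notin> mfree (\<tau> p))" for r
    using MMu.prems by simp
  ultimately show ?case by simp
qed simp_all

lemma minstance_self: "minstance a MAtom a"
proof (induction a)
  case (MMu q a)
  have "MAtom(q := MAtom q) = MAtom" by (auto simp: fun_upd_apply)
  then show ?case using MMu by auto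
qed simp_all

lemma mfree_minstance: "minstance a \<sigma> b \<Longrightarrow> mfree b = (\<Union>p\<in>mfree a. mfree (\<sigma> p))"
proof (induction a arbitrary: \<sigma> b)
  case (MMu q a)
  then obtain r a' where b: "b = MMu r a'" "\<And>p. p \<in> mfree a - {q} \<Longrightarrow> r \<notin> mfree (\<sigma> p)"
    and a': "minstance a (\<sigma>(q := MAtom r)) a'" by auto
  have eq: "mfree ((\<sigma>(q := MAtom r)) p) - {r} = (if p = q then {} else mfree (\<sigma> p))" if "p \<in> mfree a" for p
    using b(2)[of p] that by (auto simp: fun_upd_apply)
  have "mfree b = (\<Union>p\<in>mfree a. mfree ((\<sigma>(q := MAtom r)) p) - {r})"
    using MMu.IH[OF a'] b(1) by auto
  also have "\<dots> = (\<Union>p\<in>mfree a. if p = q then {} else mfree (\<sigma> p))" using eq by simp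
  also have "\<dots> = (\<Union>p\<in>mfree (MMu q a). mfree (\<sigma> p))" by auto
  finally show ?case .
qed auto

text \<open>Meant for the bound atom of an instance of \<open>MMu\<close>: it enters only through
  the atom it replaces, so it inherits the parity of that atom, and positivity survives.\<close>

lemma minstance_mparity:
  "minstance a \<sigma> b \<Longrightarrow> (\<And>p. p \<in> mfree a \<Longrightarrow> x \<notin> mfree (\<sigma> p) \<or> \<sigma> p = MAtom x \<and> mparity p a e) \<Longrightarrow>
    mparity x b e"
proof (induction a arbitrary: \<sigma> b e)
  case (MAtom p)
  then show ?case using mparity_not_free by fastforce
next
  case (MNeg a)
  then obtain a' where a': "b = MNeg a'" "minstance a \<sigma> a'" by auto
  have "mparity x a' (\<not> e)" by (rule MNeg.IH[OF a'(2)]) (use MNeg.prems in simp)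
  then show ?case using a' by simp
next
  case (MAnd a c)
  then obtain a' c' where a': "b = MAnd a' c'" "minstance a \<sigma> a'" "minstance c \<sigma> c'" by auto
  have "mparity x a' e" by (rule MAnd.IH(1)[OF a'(2)]) (use MAnd.prems(2) in auto)
  moreover have "mparity x c' e" by (rule MAnd.IH(2)[OF a'(3)]) (use MAnd.prems(2) in auto)
  ultimately show ?case using a' by simp
next
  case (MBox a)
  then obtain a' where a': "b = MBox a'" "minstance a \<sigma> a'" by auto
  have "mparity x a' e" by (rule MBox.IH[OF a'(2)]) (use MBox.prems in simp)
  then show ?case using a' by simp
next
  case (MMu q a)
  then obtain r a' where b: "b = MMu r a'" "minstance a (\<sigma>(q := MAtom r)) a'" by auto
  show ?case
  proof (cases "r = x")
    case False
    have "mparity x a' e"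
    proof (rule MMu.IH[OF b(2)])
      fix p assume "p \<in> mfree a"
      then show "x \<notin> mfree ((\<sigma>(q := MAtom r)) p) \<or> (\<sigma>(q := MAtom r)) p = MAtom x \<and> mparity p a e"
        using MMu.prems(2)[of p] False by (cases "p = q") auto
    qed
    then show ?thesis using b by simp
  qed (use b in simp)
qed simp

lemma minstance_mu_formula:
  "minstance a \<sigma> b \<Longrightarrow> mu_formula a \<Longrightarrow> (\<And>p. p \<in> mfree a \<Longrightarrow> mu_formula (\<sigma> p)) \<Longrightarrow> mu_formula b"
proof (induction a arbitrary: \<sigma> b)
  case (MMu q a)
  then obtain r a' where b: "b = MMu r a'" "\<And>p. p \<in> mfree a - {q} \<Longrightarrow> r \<notin> mfree (\<sigma> p)"
    "minstance a (\<sigma>(q := MAtom r)) a'" by auto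
  have "mu_formula a'"
    by (rule MMu.IH[OF b(3)]) (use MMu.prems in \<open>auto simp: fun_upd_apply\<close>)
  moreover have "mpositive r a'"
    by (rule minstance_mparity[OF b(3)]) (use b(2) MMu.prems in \<open>auto simp: fun_upd_apply\<close>)
  ultimately show ?case using b(1) by simp
next
  case (MAnd a c)
  then obtain a' c' where a': "b = MAnd a' c'" "minstance a \<sigma> a'" "minstance c \<sigma> c'" by auto
  have "mu_formula a'" by (rule MAnd.IH(1)[OF a'(2)]) (use MAnd.prems in auto)
  moreover have "mu_formula c'" by (rule MAnd.IH(2)[OF a'(3)]) (use MAnd.prems in auto)
  ultimately show ?case using a' by simp
qed auto

lemma minstance_msubst:
  "minstance a \<sigma> b \<Longrightarrow> mfree_for s x b \<Longrightarrow> minstance a (\<lambda>p. msubst (\<sigma> p) s x) (msubst b s x)"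
proof (induction a arbitrary: \<sigma> b)
  case (MMu q a)
  then obtain r a' where b: "b = MMu r a'" "\<And>p. p \<in> mfree a - {q} \<Longrightarrow> r \<notin> mfree (\<sigma> p)"
    "minstance a (\<sigma>(q := MAtom r)) a'" by auto
  show ?case
  proof (cases "r = x")
    \<comment> \<open>The substitution stops at the binder \<open>x\<close>, and the composed one
      changes nothing either, since \<open>x\<close> is free in no relevant
      \<open>\<sigma> p\<close>.\<close>
    case True
    have "minstance (MMu q a) \<sigma> b \<longleftrightarrow> minstance (MMu q a) (\<lambda>p. msubst (\<sigma> p) s x) b"
      by (rule minstance_cong) (use b(2) True in \<open>auto simp: msubst_not_free\<close>)
    then show ?thesis using MMu.prems(1) b(1) True by simp
  next
    case False
    have ff: "mfree_for s x a'" "x \<in> mfree a' \<Longrightarrow> r \<notin> mfree s" using MMu.prems(2) b(1) False by auto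
    have "(\<lambda>p. msubst ((\<sigma>(q := MAtom r)) p) s x) = (\<lambda>p. msubst (\<sigma> p) s x)(q := MAtom r)"
      using False by (auto simp: fun_upd_apply)
    then have "minstance a ((\<lambda>p. msubst (\<sigma> p) s x)(q := MAtom r)) (msubst a' s x)"
      using MMu.IH[OF b(3) ff(1)] by simp
    moreover have "r \<notin> mfree (msubst (\<sigma> p) s x)" if p: "p \<in> mfree a - {q}" for p
    proof (cases "x \<in> mfree (\<sigma> p)")
      case True
      then have "x \<in> mfree a'" using mfree_minstance[OF b(3)] p by (auto simp: fun_upd_apply)
      then show ?thesis using mfree_msubst[of "\<sigma> p" s x] ff(2) b(2)[OF p] by (auto split: if_splits)
    next
      case f: False
      then show ?thesis using b(2)[OF p] by (simp add: msubst_not_free)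
    qed
    ultimately show ?thesis using b(1) False by auto
  qed
qed auto

context
  assumes inf: "infinite (UNIV :: 'v set)"
begin

lemma fresh_atom: "finite N \<Longrightarrow> \<exists>r :: 'v. r \<notin> N"
  using inf ex_new_if_finite by blast

text \<open>Choosing the bound atoms of the skeleton \<open>a\<close> outside \<open>N\<close> makes later substitutions for an atom
  \<open>x\<close> admissible, provided \<open>x\<close> does not occur inside the substituted formulas.\<close>

lemma minstance_exists:
  fixes a :: "'v mfm"
  assumes "finite N"
  shows "\<exists>b. minstance a \<sigma> b \<and> (\<forall>x s. mfree s \<subseteq> N \<longrightarrow>
    (\<forall>p\<in>mfree a. \<sigma> p = MAtom x \<or> x \<notin> mfree (\<sigma> p)) \<longrightarrow> mfree_for s x b)"
proof (induction a arbitrary: \<sigma>)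
  case (MAtom p)
  have "mfree_for s x (\<sigma> p)" if "\<sigma> p = MAtom x \<or> x \<notin> mfree (\<sigma> p)" for s x
    using that mfree_for_not_free by (cases "\<sigma> p = MAtom x") auto
  then show ?case by simp
next
  case (MNeg a)
  then obtain b where "minstance a \<sigma> b" "\<forall>x s. mfree s \<subseteq> N \<longrightarrow>
    (\<forall>p\<in>mfree a. \<sigma> p = MAtom x \<or> x \<notin> mfree (\<sigma> p)) \<longrightarrow> mfree_for s x b" by blast
  then show ?case by (intro exI[of _ "MNeg b"]) simp
next
  case (MBox a)
  then obtain b where "minstance a \<sigma> b" "\<forall>x s. mfree s \<subseteq> N \<longrightarrow>
    (\<forall>p\<in>mfree a. \<sigma> p = MAtom x \<or> x \<notin> mfree (\<sigma> p)) \<longrightarrow> mfree_for s x b" by blast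
  then show ?case by (intro exI[of _ "MBox b"]) simp
next
  case (MAnd a c)
  obtain b where b: "minstance a \<sigma> b" "\<forall>x s. mfree s \<subseteq> N \<longrightarrow>
    (\<forall>p\<in>mfree a. \<sigma> p = MAtom x \<or> x \<notin> mfree (\<sigma> p)) \<longrightarrow> mfree_for s x b" using MAnd.IH(1) by blast
  obtain d where d: "minstance c \<sigma> d" "\<forall>x s. mfree s \<subseteq> N \<longrightarrow>
    (\<forall>p\<in>mfree c. \<sigma> p = MAtom x \<or> x \<notin> mfree (\<sigma> p)) \<longrightarrow> mfree_for s x d" using MAnd.IH(2) by blast
  show ?case using b d by (intro exI[of _ "MAnd b d"]) simp
next
  case (MMu q a)
  have "finite (N \<union> (\<Union>p\<in>mfree a - {q}. mfree (\<sigma> p)))" using assms finite_mfree by auto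
  then obtain r where r: "r \<notin> N" "\<And>p. p \<in> mfree a - {q} \<Longrightarrow> r \<notin> mfree (\<sigma> p)"
    using fresh_atom by blast
  obtain b where b: "minstance a (\<sigma>(q := MAtom r)) b" "\<And>x s. mfree s \<subseteq> N \<Longrightarrow>
    (\<forall>p\<in>mfree a. (\<sigma>(q := MAtom r)) p = MAtom x \<or> x \<notin> mfree ((\<sigma>(q := MAtom r)) p)) \<Longrightarrow> mfree_for s x b"
    using MMu.IH[of "\<sigma>(q := MAtom r)"] by blast
  have "mfree_for s x (MMu r b)" if s: "mfree s \<subseteq> N"
    and x: "\<forall>p\<in>mfree (MMu q a). \<sigma> p = MAtom x \<or> x \<notin> mfree (\<sigma> p)" for x s
  proof (cases "r = x")
    case False
    have "mfree_for s x b"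
      by (rule b(2)[OF s]) (use x False in \<open>auto simp: fun_upd_apply\<close>)
    then show ?thesis using s r(1) by auto
  qed simp
  moreover have "minstance (MMu q a) \<sigma> (MMu r b)" using b(1) r(2) by simp
  ultimately show ?case by blast
qed simp

text \<open>Makes the literal \<open>msubst\<close> of the fixed point axiom and rule usable: the
  bound atoms inside \<open>b\<close> avoid \<open>N\<close>, so formulas with free atoms in
  \<open>N\<close> may replace \<open>r\<close>, and the result is an instance of the body with
  \<open>q\<close> sent to that formula.\<close>

lemma minstance_MMu_exists:
  fixes a :: "'v mfm"
  assumes "finite N"
  shows "\<exists>r b. minstance (MMu q a) \<sigma> (MMu r b) \<and> (\<forall>s. mfree s \<subseteq> N \<longrightarrow> mfree_for s r b) \<and>
    (\<forall>s. mfree_for s r b \<longrightarrow> minstance a (\<sigma>(q := s)) (msubst b s r))"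
proof -
  have "finite (\<Union>p\<in>mfree a - {q}. mfree (\<sigma> p))" using finite_mfree by auto
  then obtain r where r: "\<And>p. p \<in> mfree a - {q} \<Longrightarrow> r \<notin> mfree (\<sigma> p)"
    using fresh_atom by blast
  obtain b where b: "minstance a (\<sigma>(q := MAtom r)) b" "\<And>x s. mfree s \<subseteq> N \<Longrightarrow>
    (\<forall>p\<in>mfree a. (\<sigma>(q := MAtom r)) p = MAtom x \<or> x \<notin> mfree ((\<sigma>(q := MAtom r)) p)) \<Longrightarrow> mfree_for s x b"
    using minstance_exists[OF assms, of a "\<sigma>(q := MAtom r)"] by blast
  have "mfree_for s r b" if "mfree s \<subseteq> N" for s
    by (rule b(2)[OF that]) (use r in \<open>auto simp: fun_upd_apply\<close>)
  moreover have "minstance a (\<sigma>(q := s)) (msubst b s r)" if "mfree_for s r b" for s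
  proof -
    have "minstance a (\<lambda>p. msubst ((\<sigma>(q := MAtom r)) p) s r) (msubst b s r)"
      by (rule minstance_msubst[OF b(1) that])
    then show ?thesis
      by (rule iffD1[OF minstance_cong, rotated]) (use r in \<open>auto simp: msubst_not_free fun_upd_apply\<close>)
  qed
  moreover have "minstance (MMu q a) \<sigma> (MMu r b)" using b(1) r by simp
  ultimately show ?thesis by blast
qed

lemma fresh_for: "\<exists>N. finite N \<and> (\<forall>r. r \<notin> N \<longrightarrow> r \<notin> mfree a \<and> mfree_for (MAtom r) q a)"
proof (induction a)
  case (MAtom p)
  then show ?case by (intro exI[of _ "{p}"]) simp
next
  case (MAnd a b)
  then obtain M N where "finite M" "finite N"
    "\<forall>r. r \<notin> M \<longrightarrow> r \<notin> mfree a \<and> mfree_for (MAtom r) q a"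
    "\<forall>r. r \<notin> N \<longrightarrow> r \<notin> mfree b \<and> mfree_for (MAtom r) q b" by blast
  then show ?case by (intro exI[of _ "M \<union> N"]) simp
next
  case (MMu p a)
  then obtain N where "finite N" "\<forall>r. r \<notin> N \<longrightarrow> r \<notin> mfree a \<and> mfree_for (MAtom r) q a" by blast
  then show ?case by (intro exI[of _ "insert p N"]) auto
qed auto

text \<open>Both outer bound atoms are renamed to a common fresh \<open>s\<close>; the renamed
  bodies are then instances of \<open>a\<close> under one substitution, and the induction hypothesis
  applies.\<close>

lemma minstance_unique:
  fixes a :: "'v mfm"
  shows "minstance a \<sigma> b \<Longrightarrow> minstance a \<sigma> c \<Longrightarrow> malpha b c"
proof (induction a arbitrary: \<sigma> b c)
  case (MMu q a)
  obtain r b' where b: "b = MMu r b'" "\<And>p. p \<in> mfree a - {q} \<Longrightarrow> r \<notin> mfree (\<sigma> p)"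
    "minstance a (\<sigma>(q := MAtom r)) b'" using MMu.prems(1) by auto
  obtain t c' where c: "c = MMu t c'" "\<And>p. p \<in> mfree a - {q} \<Longrightarrow> t \<notin> mfree (\<sigma> p)"
    "minstance a (\<sigma>(q := MAtom t)) c'" using MMu.prems(2) by auto
  obtain M where M: "finite M" "\<And>s. s \<notin> M \<Longrightarrow> s \<notin> mfree b' \<and> mfree_for (MAtom s) r b'"
    using fresh_for[of b' r] by blast
  obtain N where N: "finite N" "\<And>s. s \<notin> N \<Longrightarrow> s \<notin> mfree c' \<and> mfree_for (MAtom s) t c'"
    using fresh_for[of c' t] by blast
  obtain s where "s \<notin> M \<union> N" using M(1) N(1) fresh_atom[of "M \<union> N"] by blast
  then have s: "s \<notin> mfree b'" "mfree_for (MAtom s) r b'" "s \<notin> mfree c'" "mfree_for (MAtom s) t c'"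
    using M N by auto
  have inst: "minstance a (\<sigma>(q := MAtom s)) (msubst d (MAtom s) u)"
    if u: "\<And>p. p \<in> mfree a - {q} \<Longrightarrow> u \<notin> mfree (\<sigma> p)" and d: "minstance a (\<sigma>(q := MAtom u)) d"
      "mfree_for (MAtom s) u d" for u d
  proof -
    have "minstance a (\<lambda>p. msubst ((\<sigma>(q := MAtom u)) p) (MAtom s) u) (msubst d (MAtom s) u)"
      by (rule minstance_msubst[OF d])
    then show ?thesis
      by (rule iffD1[OF minstance_cong, rotated]) (use u in \<open>auto simp: msubst_not_free fun_upd_apply\<close>)
  qed
  have "malpha (msubst b' (MAtom s) r) (msubst c' (MAtom s) t)"
    by (rule MMu.IH[OF inst[OF b(2,3) s(2)] inst[OF c(2,3) s(4)]])
  then have "malpha (MMu s (msubst b' (MAtom s) r)) (MMu s (msubst c' (MAtom s) t))"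
    by (rule malpha_Mu)
  moreover have "malpha b (MMu s (msubst b' (MAtom s) r))"
    unfolding b(1) by (rule malpha_rename[OF s(1,2)])
  moreover have "malpha c (MMu s (msubst c' (MAtom s) t))"
    unfolding c(1) by (rule malpha_rename[OF s(3,4)])
  ultimately show ?case by (meson malpha_sym malpha_trans)
qed (auto intro: malpha.intros)

section \<open>Canonical frame and completeness of the fixed point system\<close>

lemma S4_logic_mu: "S4_logic mu_formula MTop MNeg MAnd MBox (S4mu :: 'v mfm \<Rightarrow> bool)"
proof
  show "S4mu (pinst MTop MNeg MAnd s t)" if "tautology t" "\<And>n. mu_formula (s n)" for t and s :: "nat \<Rightarrow> 'v mfm"
  proof -
    \<comment> \<open>\<open>S4mu_taut\<close> speaks of propositional formulas over the atoms of
      the language; an injection of the naturals carries over the tautologies used in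
      \<open>S4_logic\<close>.\<close>
    obtain f :: "nat \<Rightarrow> 'v" where f: "inj f" using infinite_countable_subset[OF inf] by auto
    have eq: "minst (s \<circ> inv f) (map_pfm f u) = pinst MTop MNeg MAnd s u" for u
      using f by (induction u) (auto simp: inv_f_f)
    have "mu_formula (pinst MTop MNeg MAnd s u)" for u using that(2) by (induction u) auto
    then show ?thesis using S4mu_taut[OF tautology_map[OF that(1), of f], of "s \<circ> inv f"] eq by simp
  qed
  have "\<not> S4mu (MNeg MTop :: 'v mfm)"
  proof
    assume "S4mu (MNeg MTop :: 'v mfm)"
    from S4mu_sound[OF this, of "\<lambda>_. {} :: real set"] show False by simp
  qed
  then show "\<exists>a :: 'v mfm. mu_formula a \<and> \<not> S4mu a" by (intro exI[of _ "MNeg MTop"]) simp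
qed (auto intro: S4mu.intros S4mu_mu_formula)

interpretation mu: S4_logic mu_formula MTop MNeg MAnd MBox "S4mu :: 'v mfm \<Rightarrow> bool"
  by (rule S4_logic_mu)

lemma ext_malpha:
  assumes "malpha b c" "mu_formula b" shows "mu.ext b = mu.ext c"
proof -
  have c: "mu_formula c" using assms malpha_mu_formula by blast
  have "S4mu (MImp b c)"
    by (rule S4mu_alpha[OF mu.taut_refl[OF assms(2)]]) (rule malpha_Neg malpha_And malpha_refl assms(1))+
  moreover have "S4mu (MImp c b)"
    by (rule S4mu_alpha[OF mu.taut_refl[OF c]]) (rule malpha_Neg malpha_And malpha_refl malpha_sym[OF assms(1)])+
  ultimately show ?thesis using mu.ext_subset assms(2) c by blast
qed

text \<open>The truth lemma, for all substitutions at once: the sets over which \<open>MMu\<close>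
  intersects are extensions of formulas \<open>s\<close>, and giving \<open>q\<close> such a value
  amounts to substituting \<open>s\<close> for \<open>q\<close>. The fixed point axiom yields one
  inclusion, the fixed point rule the other.\<close>

lemma val_ext:
  fixes a :: "'v mfm"
  shows "minstance a \<sigma> b \<Longrightarrow> mu_formula a \<Longrightarrow> (\<And>p. p \<in> mfree a \<Longrightarrow> mu_formula (\<sigma> p)) \<Longrightarrow>
    (\<And>p. p \<in> mfree a \<Longrightarrow> h p = mu.ext (\<sigma> p)) \<Longrightarrow> mu.canonical.val a h = mu.ext b"
proof (induction a arbitrary: \<sigma> b h)
  case (MAtom p)
  then show ?case by simp
next
  case MTop
  then show ?case using mu.ext_top by simp
next
  case (MNeg a)
  then obtain a' where a': "b = MNeg a'" "minstance a \<sigma> a'" by auto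
  have "mu.canonical.val a h = mu.ext a'" by (rule MNeg.IH[OF a'(2)]) (use MNeg.prems in auto)
  moreover have "mu_formula a'" by (rule minstance_mu_formula[OF a'(2)]) (use MNeg.prems in auto)
  ultimately show ?case using a'(1) mu.ext_neg by simp
next
  case (MAnd a c)
  then obtain a' c' where a': "b = MAnd a' c'" "minstance a \<sigma> a'" "minstance c \<sigma> c'" by auto
  have "mu.canonical.val a h = mu.ext a'" by (rule MAnd.IH(1)[OF a'(2)]) (use MAnd.prems in auto)
  moreover have "mu_formula a'" by (rule minstance_mu_formula[OF a'(2)]) (use MAnd.prems in auto)
  moreover have "mu.canonical.val c h = mu.ext c'" by (rule MAnd.IH(2)[OF a'(3)]) (use MAnd.prems in auto)
  moreover have "mu_formula c'" by (rule minstance_mu_formula[OF a'(3)]) (use MAnd.prems in auto)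
  ultimately show ?case using a'(1) mu.ext_conj by simp
next
  case (MBox a)
  then obtain a' where a': "b = MBox a'" "minstance a \<sigma> a'" by auto
  have "mu.canonical.val a h = mu.ext a'" by (rule MBox.IH[OF a'(2)]) (use MBox.prems in auto)
  moreover have "mu_formula a'" by (rule minstance_mu_formula[OF a'(2)]) (use MBox.prems in auto)
  ultimately show ?case using a'(1) mu.ext_box by simp
next
  case (MMu q a)
  have mu: "mu_formula (MMu r c)" if "minstance (MMu q a) \<sigma> (MMu r c)" for r c
    by (rule minstance_mu_formula[OF that]) (use MMu.prems in auto)
  have ext_b: "mu.ext b = mu.ext (MMu r c)" if "minstance (MMu q a) \<sigma> (MMu r c)" for r c
    using ext_malpha[OF minstance_unique[OF that MMu.prems(1)] mu[OF that]] by simp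
  have val_a: "mu.canonical.val a (h(q := mu.ext s)) = mu.ext d \<and> mu_formula d"
    if s: "mu_formula s" and d: "minstance a (\<sigma>(q := s)) d" for s d
  proof
    show "mu.canonical.val a (h(q := mu.ext s)) = mu.ext d"
      by (rule MMu.IH[OF d]) (use MMu.prems s in \<open>auto simp: fun_upd_apply\<close>)
    show "mu_formula d"
      by (rule minstance_mu_formula[OF d]) (use MMu.prems s in \<open>auto simp: fun_upd_apply\<close>)
  qed
  show ?case
  proof (rule subset_antisym)
    \<comment> \<open>By \<open>mfree_minstance\<close> these are the free atoms of the instance
      itself, so \<open>MMu r c\<close> may be substituted into its own body.\<close>
    let ?N = "\<Union>p\<in>mfree (MMu q a). mfree (\<sigma> p)"
    have "finite ?N" using finite_mfree by blast
    then obtain r c where c: "minstance (MMu q a) \<sigma> (MMu r c)" "\<And>s. mfree s \<subseteq> ?N \<Longrightarrow> mfree_for s r c"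
      "\<And>s. mfree_for s r c \<Longrightarrow> minstance a (\<sigma>(q := s)) (msubst c s r)"
      using minstance_MMu_exists[of ?N q a \<sigma>] by blast
    have ff: "mfree_for (MMu r c) r c" using c(2) mfree_minstance[OF c(1)] by simp
    have v: "mu.canonical.val a (h(q := mu.ext (MMu r c))) = mu.ext (msubst c (MMu r c) r)"
      "mu_formula (msubst c (MMu r c) r)" using val_a[OF mu[OF c(1)] c(3)[OF ff]] by auto
    have "S4mu (MImp (msubst c (MMu r c) r) (MMu r c))"
      by (rule S4mu_fixax[OF mu[OF c(1)] ff])
    then have "mu.ext (msubst c (MMu r c) r) \<subseteq> mu.ext (MMu r c)"
      using mu.ext_subset[OF v(2) mu[OF c(1)]] by blast
    then show "mu.canonical.val (MMu q a) h \<subseteq> mu.ext b"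
      unfolding ext_b[OF c(1)] using v(1)
      by (intro gtruth_MMu_lower mu.ext_in_exts mu[OF c(1)]) simp
    show "mu.ext b \<subseteq> mu.canonical.val (MMu q a) h"
      unfolding gtruth.simps
    proof (rule Inter_greatest)
      fix S assume "S \<in> {S \<in> mu.exts. mu.canonical.val a (h(q := S)) \<subseteq> S}"
      then obtain s where s: "mu_formula s" "S = mu.ext s" "mu.canonical.val a (h(q := mu.ext s)) \<subseteq> mu.ext s"
        by (auto simp: mu.exts_def)
      \<comment> \<open>The instance is chosen afresh for each \<open>s\<close>, its bound atoms
        avoiding the free atoms of \<open>s\<close>; by \<open>ext_b\<close> the extension does not
        depend on this choice.\<close>
      obtain r c where c: "minstance (MMu q a) \<sigma> (MMu r c)" "mfree_for s r c"
        "minstance a (\<sigma>(q := s)) (msubst c s r)"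
        using minstance_MMu_exists[OF finite_mfree, of q a \<sigma> s] by blast
      have "S4mu (MImp (msubst c s r) s)"
        using val_a[OF s(1) c(3)] s(3) mu.ext_subset[OF _ s(1)] by blast
      then have "S4mu (MImp (MMu r c) s)" by (rule S4mu_fixrule[OF mu[OF c(1)] c(2)])
      then show "mu.ext b \<subseteq> S"
        unfolding ext_b[OF c(1)] s(2) using mu.ext_subset[OF mu[OF c(1)] s(1)] by blast
    qed
  qed
qed

text \<open>Every definable assignment comes from a substitution \<open>\<sigma>\<close>, so by
  \<open>val_ext\<close> the value is the extension of an instance.\<close>

lemma mu_formula_mdefinable: "mu_formula (a :: 'v mfm) \<Longrightarrow> mu.canonical.mdefinable a"
proof (induction a)
  case (MMu q a)
  have "mu.canonical.val (MMu q a) h \<in> mu.exts" if h: "\<And>p. h p \<in> mu.exts" for h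
  proof -
    have "\<forall>p. \<exists>s. mu_formula s \<and> h p = mu.ext s" using h by (auto simp: mu.exts_def)
    then obtain \<sigma> where \<sigma>: "\<And>p. mu_formula (\<sigma> p) \<and> h p = mu.ext (\<sigma> p)" by metis
    obtain b where b: "minstance (MMu q a) \<sigma> b" using minstance_exists[of "{}"] by blast
    have "mu.canonical.val (MMu q a) h = mu.ext b"
      by (rule val_ext[OF b MMu.prems]) (use \<sigma> in auto)
    moreover have "mu_formula b" by (rule minstance_mu_formula[OF b MMu.prems]) (use \<sigma> in auto)
    ultimately show ?thesis using mu.ext_in_exts by simp
  qed
  then show ?case using MMu by (simp del: gtruth.simps)
qed simp_all

lemma S4mu_complete:
  fixes a :: "'v mfm"
  assumes "mu_formula a" "mvalid (X :: 'a::{metric_space, perfect_space} itself) a"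
  shows "S4mu a"
proof (rule ccontr)
  assume "\<not> S4mu a"
  then have "mu.ext a \<noteq> UNIV" using mu.ext_UNIV[OF assms(1)] by simp
  moreover have "mu.canonical.val a (\<lambda>p. mu.ext (MAtom p)) = mu.ext a"
    by (rule val_ext[OF minstance_self assms(1)]) simp_all
  ultimately obtain x where "x \<notin> mu.canonical.val a (\<lambda>p. mu.ext (MAtom p))" by blast
  then have "\<not> mvalid X a"
    by (intro mu.canonical.mu_refutation[OF assms(1) mu_formula_mdefinable[OF assms(1)]])
      (simp_all add: mu.ext_in_exts)
  then show False using assms(2) by simp
qed

end

section \<open>The tangle system\<close>

lemma tangle_formula_TConj: "tangle_formula (TConj gs) \<longleftrightarrow> (\<forall>g\<in>set gs. tangle_formula g)"
  by (induction gs rule: TConj.induct) auto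

lemma ttruth_TConj: "x \<in> ttruth h (TConj gs) \<longleftrightarrow> (\<forall>g\<in>set gs. x \<in> ttruth h g)"
  by (induction gs rule: TConj.induct) auto

lemma ttruth_TBox: "ttruth h (TBox a) = interior (ttruth h a)"
  by (simp add: ttruth_gttruth)

lemma ttruth_TDia: "ttruth h (TDia a) = closure (ttruth h a)"
  by (simp add: ttruth_gttruth closure_interior)

lemma ttruth_TImp: "x \<in> ttruth h (TImp a b) \<longleftrightarrow> (x \<in> ttruth h a \<longrightarrow> x \<in> ttruth h b)"
  by simp

lemma S4t_tangle_formula: "S4t a \<Longrightarrow> tangle_formula a"
proof (induction rule: S4t.induct)
  case (S4t_Ind G a gs)
  then have "tangle_formula g" if "g \<in> set gs" for g
    using that by (auto simp: fset_of_list_elem)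
  then have "tangle_formula (TConj (map (\<lambda>g. TDia (TAnd g a)) gs))"
    using S4t_Ind by (auto simp: tangle_formula_TConj)
  then show ?case using S4t_Ind by (simp only: tangle_formula.simps) blast
next
  case (S4t_Fix G g)
  then show ?case by auto
qed auto

lemma ttruth_tinst: "x \<in> ttruth h (tinst s t) \<longleftrightarrow> ptruth (\<lambda>p. x \<in> ttruth h (s p)) t"
  by (induction t) auto

lemma ttruth_TTangle_fix:
  assumes "g \<in> fset G"
  shows "ttruth h (TTangle G) \<subseteq> closure (ttruth h g \<inter> ttruth h (TTangle G))"
proof
  fix x assume "x \<in> ttruth h (TTangle G)"
  then obtain S where S: "x \<in> S" "S \<subseteq> (\<Inter>d \<in> fset G. closure (ttruth h d \<inter> S))"
    unfolding ttruth_TTangle by blast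
  then have "S \<subseteq> ttruth h (TTangle G)" unfolding ttruth_TTangle by blast
  then have "closure (ttruth h g \<inter> S) \<subseteq> closure (ttruth h g \<inter> ttruth h (TTangle G))"
    by (intro closure_mono) auto
  then show "x \<in> closure (ttruth h g \<inter> ttruth h (TTangle G))" using S assms by blast
qed

text \<open>Tangling is local: intersecting the truth set of \<open>a\<close> with the open set
  \<open>W\<close> keeps the accumulation at the remaining points, and that intersection is the
  witness.\<close>

lemma ttruth_TTangle_ind:
  assumes W: "open W" "x \<in> W" "x \<in> ttruth h a"
    and step: "\<And>g. g \<in> fset G \<Longrightarrow> W \<inter> ttruth h a \<subseteq> closure (ttruth h g \<inter> ttruth h a)"
  shows "x \<in> ttruth h (TTangle G)"
proof -
  have "W \<inter> ttruth h a \<subseteq> closure (ttruth h g \<inter> (W \<inter> ttruth h a))" if "g \<in> fset G" for g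
  proof -
    have "W \<inter> ttruth h a \<subseteq> W \<inter> closure (ttruth h g \<inter> ttruth h a)" using step[OF that] by blast
    also have "\<dots> \<subseteq> closure (W \<inter> (ttruth h g \<inter> ttruth h a))" by (rule open_Int_closure_subset[OF W(1)])
    also have "W \<inter> (ttruth h g \<inter> ttruth h a) = ttruth h g \<inter> (W \<inter> ttruth h a)" by blast
    finally show ?thesis .
  qed
  then have "W \<inter> ttruth h a \<subseteq> (\<Inter>d \<in> fset G. closure (ttruth h d \<inter> (W \<inter> ttruth h a)))" by blast
  then show ?thesis unfolding ttruth_TTangle using W(2,3) by blast
qed

lemma S4t_sound: "S4t a \<Longrightarrow> ttruth h a = UNIV"
proof (induction arbitrary: h rule: S4t.induct)
  case (S4t_taut t s)
  then show ?case by (auto simp: tautology_def ttruth_tinst)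
next
  case (S4t_K a b)
  have "interior (ttruth h (TImp a b)) \<inter> interior (ttruth h a) \<subseteq> interior (ttruth h b)"
    unfolding interior_Int[symmetric] by (rule interior_mono) auto
  then have "x \<in> ttruth h (TImp (TBox (TImp a b)) (TImp (TBox a) (TBox b)))" for x
    unfolding ttruth_TImp ttruth_TBox by blast
  then show ?case by blast
next
  case (S4t_T a)
  have "x \<in> ttruth h (TImp (TBox a) a)" for x
    unfolding ttruth_TImp ttruth_TBox using interior_subset by blast
  then show ?case by blast
next
  case (S4t_4 a)
  have "x \<in> ttruth h (TImp (TBox a) (TBox (TBox a)))" for x
    unfolding ttruth_TImp ttruth_TBox by simp
  then show ?case by blast
next
  case (S4t_Fix G g)
  have "x \<in> ttruth h (TImp (TTangle G) (TDia (TAnd g (TTangle G))))" for x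
    unfolding ttruth_TImp ttruth_TDia ttruth.simps(4) using ttruth_TTangle_fix[OF S4t_Fix(2)] by blast
  then show ?case by blast
next
  case (S4t_Ind G a gs)
  have gs: "set gs = fset G" using S4t_Ind(4) by (metis fset_of_list.rep_eq)
  have "x \<in> ttruth h (TTangle G)"
    if x: "x \<in> ttruth h (TBoxStar (TImp a (TConj (map (\<lambda>g. TDia (TAnd g a)) gs))))" "x \<in> ttruth h a" for x
  proof -
    let ?W = "interior (ttruth h (TImp a (TConj (map (\<lambda>g. TDia (TAnd g a)) gs))))"
    have "?W \<inter> ttruth h a \<subseteq> closure (ttruth h g \<inter> ttruth h a)" if g: "g \<in> fset G" for g
    proof
      fix y assume y: "y \<in> ?W \<inter> ttruth h a"
      then have "y \<in> ttruth h (TImp a (TConj (map (\<lambda>g. TDia (TAnd g a)) gs)))"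
        using interior_subset by blast
      then have "y \<in> ttruth h (TConj (map (\<lambda>g. TDia (TAnd g a)) gs))"
        using y unfolding ttruth_TImp by blast
      then have "y \<in> ttruth h (TDia (TAnd g a))" unfolding ttruth_TConj using g gs by auto
      then show "y \<in> closure (ttruth h g \<inter> ttruth h a)" unfolding ttruth_TDia by simp
    qed
    moreover have "x \<in> ?W" using x(1) unfolding ttruth.simps(4) ttruth_TBox by blast
    ultimately show ?thesis using ttruth_TTangle_ind[OF open_interior _ x(2)] by blast
  qed
  then show ?case unfolding ttruth.simps(3,4) by blast
next
  case (S4t_MP a b)
  then show ?case by auto
next
  case (S4t_nec a)
  then show ?case by (simp add: ttruth_TBox del: ttruth.simps)
qed

section \<open>Canonical frame and completeness of the tangle system\<close>

context
  assumes inf: "infinite (UNIV :: 'v set)"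
begin

lemma S4_logic_tangle: "S4_logic tangle_formula TTop TNeg TAnd TBox (S4t :: 'v tfm \<Rightarrow> bool)"
proof
  show "S4t (pinst TTop TNeg TAnd s t)" if "tautology t" "\<And>n. tangle_formula (s n)"
    for t and s :: "nat \<Rightarrow> 'v tfm"
  proof -
    obtain f :: "nat \<Rightarrow> 'v" where f: "inj f" using infinite_countable_subset[OF inf] by auto
    have eq: "tinst (s \<circ> inv f) (map_pfm f u) = pinst TTop TNeg TAnd s u" for u
      using f by (induction u) (auto simp: inv_f_f)
    have "tangle_formula (pinst TTop TNeg TAnd s u)" for u using that(2) by (induction u) auto
    then show ?thesis using S4t_taut[OF tautology_map[OF that(1), of f], of "s \<circ> inv f"] eq by simp
  qed
  have "\<not> S4t (TNeg TTop :: 'v tfm)"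
  proof
    assume "S4t (TNeg TTop :: 'v tfm)"
    from S4t_sound[OF this, of "\<lambda>_. {} :: real set"] show False by simp
  qed
  then show "\<exists>a :: 'v tfm. tangle_formula a \<and> \<not> S4t a" by (intro exI[of _ "TNeg TTop"]) simp
qed (auto intro: S4t_K S4t_T S4t_4 S4t_MP S4t_nec S4t_tangle_formula)

interpretation tangle: S4_logic tangle_formula TTop TNeg TAnd TBox "S4t :: 'v tfm \<Rightarrow> bool"
  by (rule S4_logic_tangle)

lemma ext_TDia: "tangle_formula a \<Longrightarrow> tangle.ext (TDia a) = - tangle.canonical.box (- tangle.ext a)"
  by (simp add: tangle.ext_neg tangle.ext_box)

lemma ext_TConj:
  "(\<And>g. g \<in> set gs \<Longrightarrow> tangle_formula g) \<Longrightarrow> tangle.ext (TConj gs) = (\<Inter>g\<in>set gs. tangle.ext g)"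
  by (induction gs rule: TConj.induct)
    (simp_all add: tangle.ext_top tangle.ext_conj tangle_formula_TConj)

text \<open>(Fix) says that the extension of \<open>TTangle G\<close> is tangled. For maximality, a
  definable tangled set is the extension of some \<open>a\<close>; the implication under
  \<open>TBoxStar\<close> in (Ind) is then a theorem, and necessitation supplies its boxed
  half.\<close>

lemma tangle_valuation_ext: "tangle.canonical.tangle_valuation tangle.ext"
  unfolding tangle.canonical.tangle_valuation_def
proof (intro conjI allI impI)
  fix G and g :: "'v tfm" assume G: "tangle_formula (TTangle G)" and g: "g \<in> fset G"
  have fg: "tangle_formula g" using G g by simp
  have "S4t (TImp (TTangle G) (TDia (TAnd g (TTangle G))))" using G g by (rule S4t_Fix)
  then have "tangle.ext (TTangle G) \<subseteq> tangle.ext (TDia (TAnd g (TTangle G)))"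
    using tangle.ext_subset G fg by simp
  then show "tangle.ext (TTangle G) \<subseteq> - tangle.canonical.box (- (tangle.ext g \<inter> tangle.ext (TTangle G)))"
    using G fg by (simp add: ext_TDia tangle.ext_conj)
next
  fix G :: "'v tfm fset" and P assume G: "tangle_formula (TTangle G)" and P: "P \<in> tangle.exts"
    and step: "\<forall>g\<in>fset G. P \<subseteq> - tangle.canonical.box (- (tangle.ext g \<inter> P))"
  obtain a where a: "tangle_formula a" "P = tangle.ext a" using P by (auto simp: tangle.exts_def)
  obtain gs where gs: "distinct gs" "set gs = fset G" using finite_distinct_list[OF finite_fset] by metis
  have gsG: "fset_of_list gs = G" using gs(2) by (metis fset_inverse fset_of_list.abs_eq)
  let ?C = "TConj (map (\<lambda>g. TDia (TAnd g a)) gs)"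
  have fg: "tangle_formula g" if "g \<in> set gs" for g using G gs(2) that by simp
  have fC: "tangle_formula ?C" using fg a(1) by (auto simp: tangle_formula_TConj)
  have "tangle.ext a \<subseteq> tangle.ext (TDia (TAnd g a))" if "g \<in> set gs" for g
    using step fg[OF that] a that gs(2) by (simp add: ext_TDia tangle.ext_conj)
  moreover have "tangle.ext ?C = (\<Inter>g\<in>set (map (\<lambda>g. TDia (TAnd g a)) gs). tangle.ext g)"
    using fg a(1) by (intro ext_TConj) auto
  ultimately have "tangle.ext a \<subseteq> tangle.ext ?C" by auto
  then have imp: "S4t (TImp a ?C)" using tangle.ext_subset[OF a(1) fC] by blast
  then have f: "tangle_formula (TImp a ?C)" "tangle_formula (TBox (TImp a ?C))"
    using S4t_tangle_formula by fastforce+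
  have "S4t (TBoxStar (TImp a ?C))"
    by (rule S4t_MP[OF S4t_MP[OF tangle.taut_conjI[OF f] imp] S4t_nec[OF imp]])
  then have "S4t (TImp a (TTangle G))"
    by (rule S4t_MP[OF S4t_Ind[OF G a(1) gs(1) gsG]])
  then show "P \<subseteq> tangle.ext (TTangle G)" using tangle.ext_subset[OF a(1) G] a(2) by blast
qed (simp_all add: tangle.ext_in_exts tangle.ext_top tangle.ext_neg tangle.ext_conj tangle.ext_box)

lemma S4t_complete:
  fixes a :: "'v tfm"
  assumes "tangle_formula a" "tvalid (X :: 'a::{metric_space, perfect_space} itself) a"
  shows "S4t a"
proof (rule ccontr)
  assume "\<not> S4t a"
  then have "tangle.ext a \<noteq> UNIV" using tangle.ext_UNIV[OF assms(1)] by simp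
  then obtain x where "x \<notin> tangle.ext a" by blast
  then have "\<not> tvalid X a"
    by (rule tangle.canonical.tangle_refutation[OF assms(1) tangle_valuation_ext])
  then show False using assms(2) by simp
qed

end

theorem theorem9p1:
  fixes X :: "'a::{metric_space, perfect_space} itself"
  assumes "infinite (UNIV :: 'v set)"
  shows "((\<forall>a::'v mfm. S4mu a \<longrightarrow> mvalid X a) \<and>
          (\<forall>a::'v mfm. mu_formula a \<and> mvalid X a \<longrightarrow> S4mu a)) \<and>
         ((\<forall>a::'v tfm. S4t a \<longrightarrow> tvalid X a) \<and>
          (\<forall>a::'v tfm. tangle_formula a \<and> tvalid X a \<longrightarrow> S4t a))"
  using S4mu_complete[OF assms] S4t_complete[OF assms]
  by (auto simp: mvalid_def tvalid_def S4mu_sound S4t_sound)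

end
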